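(* Let $\Omega\subset\mathbb{R}^d$ be a bounded Lipschitz domain, let $s\in(0,1)$, and let $f\in L^2(\Omega)$. Let $u$ be the (weak) solution of the Dirichlet problem $(-\Delta)^s u=f$ in $\Omega$, $u=0$ in $\Omega^c=\mathbb{R}^d\setminus\overline\Omega$. If $s\neq 1/2$, then $u\in\dot B^{s+r}_{2,\infty}(\Omega)$ with $r=\min\{s,1/2\}$, and $$\|u\|_{\dot B^{s+r}_{2,\infty}(\Omega)}\le \frac{C(\Omega,d)}{\sqrt{|1-2s|}}\,\|f\|_{L^2(\Omega)} .$$ If $s=1/2$, then $u\in\dot B^{1-\epsilon}_{2,\infty}(\Omega)$ for every $0<\epsilon<1$, and $$\|u\|_{\dot B^{1-\epsilon}_{2,\infty}(\Omega)}\le\frac{C(\Omega,d)}{\sqrt{\epsilon}}\,\|f\|_{L^2(\Omega)} .$$ Here $C(\Omega,d)$ denotes a constant depending only on $\Omega$ and $d$.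
   Context: **Fractional Laplacian and weak solution.** For $s\in(0,1)$, $$(-\Delta)^s v(x)=C(d,s)\,\mathrm{p.v.}\int_{\mathbb{R}^d}\frac{v(x)-v(y)}{|x-y|^{d+2s}}\,dy,\qquad C(d,s)=\frac{2^{2s}s\,\Gamma(s+\frac d2)}{\pi^{d/2}\Gamma(1-s)} .$$ Set $$(u,v)_{H^s(\mathbb{R}^d)}=\frac{C(d,s)}2\iint_{\mathbb{R}^d\times\mathbb{R}^d}\frac{(u(x)-u(y))(v(x)-v(y))}{|x-y|^{d+2s}}\,dx\,dy,\qquad |v|_{H^s(\mathbb{R}^d)}^2=(v,v)_{H^s(\mathbb{R}^d)},$$ and $\widetilde H^s(\Omega)=\{v\in H^s(\mathbb{R}^d):\mathrm{supp}\,v\subset\overline\Omega\}$, normed by $|\cdot|_{H^s(\mathbb{R}^d)}$; $H^{-s}(\Omega)$ is its dual. The weak solution for $f\in H^{-s}(\Omega)$ is the unique $u\in\widetilde H^s(\Omega)$ with $(u,v)_{H^s(\mathbb{R}^d)}=\langle f,v\rangle$ for all $v\in\widetilde H^s(\Omega)$; equivalently, the unique minimizer over $\widetilde H^s(\Omega)$ of $v\mapsto\frac12|v|_{H^s(\mathbb{R}^d)}^2-\langle f,v\rangle$. **Besov spaces.** For a compatible pair of Banach spaces $(X_0,X_1)$ let $$K(t,u)=\inf\{(\|u_0\|_{X_0}^2+t^2\|u_1\|_{X_1}^2)^{1/2}:u=u_0+u_1,\ u_i\in X_i\}.$$ For $\theta\in(0,1)$ the space $(X_0,X_1)_{\theta,\infty}$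 consists of all $u\in X_0+X_1$ with finite norm $\sup_{t>0}t^{-\theta}K(t,u)$. For $\sigma\in(0,2)$, $$B^\sigma_{2,\infty}(\mathbb{R}^d)=(L^2(\mathbb{R}^d),H^2(\mathbb{R}^d))_{\sigma/2,\infty},\qquad \dot B^\sigma_{2,\infty}(\Omega)=\{v\in B^\sigma_{2,\infty}(\mathbb{R}^d):\mathrm{supp}\,v\subset\overline\Omega\},$$ and $\|v\|_{\dot B^\sigma_{2,\infty}(\Omega)}=\|v\|_{B^\sigma_{2,\infty}(\mathbb{R}^d)}$. *)

theory Defs
  imports "HOL-Analysis.Analysis"
begin

section \<open>Lipschitz domains\<close>

text \<open>
  Near every boundary point the set is, in coordinates whose last axis is a unit vector \<open>e\<close>, the
  strict epigraph of a Lipschitz function on the hyperplane orthogonal to \<open>e\<close>.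
\<close>

definition lipschitz_boundary :: "'a::euclidean_space set \<Rightarrow> bool" where
  "lipschitz_boundary \<Omega> \<longleftrightarrow>
     (\<forall>p\<in>frontier \<Omega>. \<exists>r>0. \<exists>e L \<gamma>. norm e = 1 \<and> L-lipschitz_on {y. y \<bullet> e = 0} \<gamma> \<and>
        \<Omega> \<inter> ball p r = {x \<in> ball p r. \<gamma> (x - (x \<bullet> e) *\<^sub>R e) < x \<bullet> e})"

definition bounded_lipschitz_domain :: "'a::euclidean_space set \<Rightarrow> bool" where
  "bounded_lipschitz_domain \<Omega> \<longleftrightarrow>
     open \<Omega> \<and> connected \<Omega> \<and> \<Omega> \<noteq> {} \<and> bounded \<Omega> \<and> lipschitz_boundary \<Omega>"


section \<open>Square integrable functions and integer order Sobolev spaces\<close>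

text \<open>
  Elements of function spaces are represented by (Lebesgue measurable) functions rather than by
  classes modulo null sets; all notions below are invariant under changes on null sets.
\<close>

definition L2_space :: "'b measure \<Rightarrow> ('b \<Rightarrow> real) set" where
  "L2_space M = {v. v \<in> borel_measurable M \<and> integrable M (\<lambda>x. (v x)\<^sup>2)}"

definition L2_norm :: "'b measure \<Rightarrow> ('b \<Rightarrow> real) \<Rightarrow> real" where
  "L2_norm M v = sqrt (LINT x|M. (v x)\<^sup>2)"

text \<open>The support of \<open>v\<close> as an almost-everywhere class (equivalently, as a distribution).\<close>

definition ess_support :: "('a::euclidean_space \<Rightarrow> real) \<Rightarrow> 'a set" where
  "ess_support v = - \<Union>{U. open U \<and> (AE x in lebesgue. x \<in> U \<longrightarrow> v x = 0)}"

primrec iter_partial :: "'a list \<Rightarrow> ('a::euclidean_space \<Rightarrow> real) \<Rightarrow> 'a \<Rightarrow> real" where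
  "iter_partial [] \<phi> = \<phi>"
| "iter_partial (b # bs) \<phi> = (\<lambda>x. frechet_derivative (iter_partial bs \<phi>) (at x) b)"

text \<open>
  Smoothness: all iterated partial derivatives are (Frechet) differentiable everywhere, hence
  continuous.
\<close>

definition test_function :: "('a::euclidean_space \<Rightarrow> real) \<Rightarrow> bool" where
  "test_function \<phi> \<longleftrightarrow>
     (\<forall>bs\<in>lists Basis. iter_partial bs \<phi> differentiable_on UNIV) \<and>
     compact (closure {x. \<phi> x \<noteq> 0})"

definition weak_partial :: "'a list \<Rightarrow> ('a::euclidean_space \<Rightarrow> real) \<Rightarrow> ('a \<Rightarrow> real) \<Rightarrow> bool" where
  "weak_partial bs v g \<longleftrightarrow>
     (\<forall>\<phi>. test_function \<phi> \<longrightarrow>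
        (LINT x|lebesgue. v x * iter_partial bs \<phi> x) =
        (-1) ^ length bs * (LINT x|lebesgue. g x * \<phi> x))"

definition Hk_space :: "nat \<Rightarrow> ('a::euclidean_space \<Rightarrow> real) set" where
  "Hk_space k = {v \<in> L2_space lebesgue.
     \<forall>bs\<in>lists Basis. length bs \<le> k \<longrightarrow> (\<exists>g\<in>L2_space lebesgue. weak_partial bs v g)}"

text \<open>
  The sum runs over words of basis vectors instead of multi-indices, so that mixed derivatives are
  counted with multiplicity: for \<open>k = 2\<close> this is the sum of the squared \<open>L\<^sup>2\<close>-norms of the function,
  its gradient and its Hessian (in the Frobenius norm).  The weak derivative selected by
  \<open>SOME\<close> is unique up to null sets.
\<close>

definition Hk_norm :: "nat \<Rightarrow> ('a::euclidean_space \<Rightarrow> real) \<Rightarrow> real" where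
  "Hk_norm k v = sqrt (\<Sum>bs\<in>{bs \<in> lists Basis. length bs \<le> k}.
     (L2_norm lebesgue (SOME g. g \<in> L2_space lebesgue \<and> weak_partial bs v g))\<^sup>2)"


section \<open>Fractional Sobolev spaces and weak solutions\<close>

definition frac_const :: "nat \<Rightarrow> real \<Rightarrow> real" where
  "frac_const d s =
     2 powr (2 * s) * s * Gamma (s + real d / 2) / (pi powr (real d / 2) * Gamma (1 - s))"

definition Hs_form :: "real \<Rightarrow> ('a::euclidean_space \<Rightarrow> real) \<Rightarrow> ('a \<Rightarrow> real) \<Rightarrow> real" where
  "Hs_form s u v = frac_const DIM('a) s / 2 *
     (LINT (x, y)|(lebesgue \<Otimes>\<^sub>M lebesgue).
        (u x - u y) * (v x - v y) / norm (x - y) powr (real DIM('a) + 2 * s))"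

definition Hs_space :: "real \<Rightarrow> ('a::euclidean_space \<Rightarrow> real) set" where
  "Hs_space s = {v \<in> L2_space lebesgue. integrable (lebesgue \<Otimes>\<^sub>M lebesgue)
     (\<lambda>(x, y). (v x - v y)\<^sup>2 / norm (x - y) powr (real DIM('a) + 2 * s))}"

definition Hs_tilde :: "real \<Rightarrow> 'a::euclidean_space set \<Rightarrow> ('a \<Rightarrow> real) set" where
  "Hs_tilde s \<Omega> = {v \<in> Hs_space s. ess_support v \<subseteq> closure \<Omega>}"

text \<open>
  \<open>F\<close> is the right-hand side, viewed as a functional on \<open>Hs_tilde s \<Omega>\<close>; a function
  \<open>f\<close> in \<open>L\<^sup>2(\<Omega>)\<close> is identified with the functional \<open>L2_functional \<Omega> f\<close>.
\<close>

definition weak_solution ::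
    "real \<Rightarrow> 'a::euclidean_space set \<Rightarrow> (('a \<Rightarrow> real) \<Rightarrow> real) \<Rightarrow> ('a \<Rightarrow> real) \<Rightarrow> bool" where
  "weak_solution s \<Omega> F u \<longleftrightarrow>
     u \<in> Hs_tilde s \<Omega> \<and> (\<forall>v\<in>Hs_tilde s \<Omega>. Hs_form s u v = F v)"

definition L2_functional ::
    "'a::euclidean_space set \<Rightarrow> ('a \<Rightarrow> real) \<Rightarrow> ('a \<Rightarrow> real) \<Rightarrow> real" where
  "L2_functional \<Omega> f v = (LINT x|lebesgue_on \<Omega>. f x * v x)"


section \<open>Real interpolation and Besov spaces\<close>

text \<open>
  A normed space of functions is given by its carrier \<open>X\<close> and its norm \<open>n\<close>.
\<close>

definition K_functional ::
    "('a::euclidean_space \<Rightarrow> real) set \<Rightarrow> (('a \<Rightarrow> real) \<Rightarrow> real) \<Rightarrow>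
     ('a \<Rightarrow> real) set \<Rightarrow> (('a \<Rightarrow> real) \<Rightarrow> real) \<Rightarrow> real \<Rightarrow> ('a \<Rightarrow> real) \<Rightarrow> real" where
  "K_functional X0 n0 X1 n1 t u =
     Inf {sqrt ((n0 u0)\<^sup>2 + t\<^sup>2 * (n1 u1)\<^sup>2) | u0 u1.
       u0 \<in> X0 \<and> u1 \<in> X1 \<and> (AE x in lebesgue. u x = u0 x + u1 x)}"

definition interp_space ::
    "('a::euclidean_space \<Rightarrow> real) set \<Rightarrow> (('a \<Rightarrow> real) \<Rightarrow> real) \<Rightarrow>
     ('a \<Rightarrow> real) set \<Rightarrow> (('a \<Rightarrow> real) \<Rightarrow> real) \<Rightarrow> real \<Rightarrow> ('a \<Rightarrow> real) set" where
  "interp_space X0 n0 X1 n1 \<theta> =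
     {u. (\<exists>u0\<in>X0. \<exists>u1\<in>X1. AE x in lebesgue. u x = u0 x + u1 x) \<and>
         bdd_above ((\<lambda>t. t powr (- \<theta>) * K_functional X0 n0 X1 n1 t u) ` {0<..})}"

definition interp_norm ::
    "('a::euclidean_space \<Rightarrow> real) set \<Rightarrow> (('a \<Rightarrow> real) \<Rightarrow> real) \<Rightarrow>
     ('a \<Rightarrow> real) set \<Rightarrow> (('a \<Rightarrow> real) \<Rightarrow> real) \<Rightarrow> real \<Rightarrow> ('a \<Rightarrow> real) \<Rightarrow> real" where
  "interp_norm X0 n0 X1 n1 \<theta> u =
     (SUP t\<in>{0<..}. t powr (- \<theta>) * K_functional X0 n0 X1 n1 t u)"

definition besov_space :: "real \<Rightarrow> ('a::euclidean_space \<Rightarrow> real) set" where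
  "besov_space \<sigma> =
     interp_space (L2_space lebesgue) (L2_norm lebesgue) (Hk_space 2) (Hk_norm 2) (\<sigma> / 2)"

definition besov_norm :: "real \<Rightarrow> ('a::euclidean_space \<Rightarrow> real) \<Rightarrow> real" where
  "besov_norm \<sigma> =
     interp_norm (L2_space lebesgue) (L2_norm lebesgue) (Hk_space 2) (Hk_norm 2) (\<sigma> / 2)"

definition besov_dot :: "real \<Rightarrow> 'a::euclidean_space set \<Rightarrow> ('a \<Rightarrow> real) set" where
  "besov_dot \<sigma> \<Omega> = {v \<in> besov_space \<sigma>. ess_support v \<subseteq> closure \<Omega>}"

end

theory Submission
  imports Defs
begin

text \<open>
  The proof is the translation method of Savare.  If \<open>h\<close> points into the exterior cone of a Lipschitz
  chart and \<open>\<phi>\<close> is a cutoff, then \<open>T u = \<phi> u(\<cdot> + h) + (1 - \<phi>) u\<close> is again supported in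
  \<open>closure \<Omega>\<close>.  Convexity bounds the energy of \<open>T u\<close> by that of \<open>u\<close> up to an error, and since
  \<open>u\<close> minimizes the energy functional, the energy of \<open>T u - u\<close> is at most
  \<open>C N (N \<bar>h\<bar> + \<omega>(h))\<close>, where \<open>N\<close> is the norm of \<open>f\<close> and \<open>\<omega>(h)\<close> the \<open>L\<^sup>2\<close>-norm of
  \<open>u(\<cdot> + h) - u\<close>.  The cone spans the space, so a finite cover by charts yields
  \<open>S(k)\<^sup>2 \<le> C N \<bar>k\<bar> powr (2 s) (N \<bar>k\<bar> + sup {\<omega>(h) | \<bar>h\<bar> \<le> \<bar>k\<bar>})\<close> for the norm \<open>S(k)\<close> of the
  second difference.  Together with the parallelogram identity \<open>4 \<omega>(k)\<^sup>2 = \<omega>(2 k)\<^sup>2 + S(k)\<^sup>2\<close> this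
  is a closed recursion over dyadic scales; it needs no a priori regularity and produces the square
  roots in the constants.  Mollification by an even kernel turns decay of \<open>S\<close> into a bound of the
  K-functional.  All constants are uniform in \<open>s\<close> because the normalization of the energy is
  comparable to \<open>s (1 - s)\<close>.
\<close>

section \<open>Square integrable functions\<close>

text \<open>The obstacle is the support condition: a full translate of \<open>u\<close> is no
  admissible competitor, and localized translates stay supported in \<open>closure \<Omega>\<close>
  only for directions in a cone. An arbitrary \<open>k\<close> is reached as \<open>h1 - h2\<close>
  with both vectors in the cone. What then has small energy is
  \<open>\<phi> (u(\<cdot> + h1) - u(\<cdot> + h2))\<close>, whose first difference by
  \<open>k\<close> is locally a second difference of \<open>u\<close>. Hence the energy argument
  controls \<open>S\<close>, and first differences have to be recovered from \<open>S\<close> by the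
  recursion.

  The first differences obtained in this way lose the full reciprocal of the distance to the
  critical exponent. They enter the bound of \<open>S(k)\<^sup>2\<close> linearly, so
  \<open>S\<close> loses only the square root. Where the Besov norm still needs first differences,
  for the gradient of the mollification, a coarser bound without this loss is used instead.

  Uniformity in \<open>s\<close>: the squared first difference is at most a constant times
  \<open>|k| powr (2 s) s (1 - s)\<close> times the unnormalized energy, and the factor
  \<open>s (1 - s)\<close> is exactly what the normalization supplies. The number \<open>N\<close>
  is kept positive because it occurs as a denominator in the choice of a Young parameter.\<close>

lemma L2_spaceD:
  assumes "f \<in> L2_space M"
  shows "f \<in> borel_measurable M" "integrable M (\<lambda>x. (f x)\<^sup>2)"
  using assms by (auto simp: L2_space_def)

lemma L2_space_dominated:
  assumes f: "f \<in> borel_measurable M" and g: "integrable M g"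
    and le: "\<And>x. x \<in> space M \<Longrightarrow> (f x)\<^sup>2 \<le> g x"
  shows "f \<in> L2_space M"
proof -
  have "integrable M (\<lambda>x. (f x)\<^sup>2)"
    using f le by (intro Bochner_Integration.integrable_bound[OF g]) (auto intro!: AE_I2 intro: order_trans[OF _ abs_ge_self])
  then show ?thesis using f by (simp add: L2_space_def)
qed

lemma L2_space_cmult: "f \<in> L2_space M \<Longrightarrow> (\<lambda>x. c * f x) \<in> L2_space M"
  by (auto simp: L2_space_def power_mult_distrib)

lemma L2_space_add:
  assumes "f \<in> L2_space M" "g \<in> L2_space M"
  shows "(\<lambda>x. f x + g x) \<in> L2_space M"
proof (rule L2_space_dominated)
  show "integrable M (\<lambda>x. 2 * (f x)\<^sup>2 + 2 * (g x)\<^sup>2)"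
    using assms by (auto simp: L2_space_def)
  show "(f x + g x)\<^sup>2 \<le> 2 * (f x)\<^sup>2 + 2 * (g x)\<^sup>2" for x
    using zero_le_power2[of "f x - g x"] by (simp add: power2_sum power2_diff)
qed (use assms in \<open>auto simp: L2_space_def\<close>)

lemma L2_space_diff:
  assumes "f \<in> L2_space M" "g \<in> L2_space M"
  shows "(\<lambda>x. f x - g x) \<in> L2_space M"
  using L2_space_add[OF assms(1) L2_space_cmult[OF assms(2), of "-1"]] by simp

lemma L2_space_mono:
  assumes g: "g \<in> L2_space M" and f: "f \<in> borel_measurable M"
    and le: "\<And>x. x \<in> space M \<Longrightarrow> \<bar>f x\<bar> \<le> \<bar>g x\<bar>"
  shows "f \<in> L2_space M"
  using L2_space_dominated[OF f L2_spaceD(2)[OF g]] le by (metis abs_le_square_iff)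

lemma L2_integrable_mult:
  assumes "f \<in> L2_space M" "g \<in> L2_space M"
  shows "integrable M (\<lambda>x. f x * g x)"
proof (rule Bochner_Integration.integrable_bound)
  show "integrable M (\<lambda>x. (f x)\<^sup>2 + (g x)\<^sup>2)"
    using assms by (auto simp: L2_space_def)
  have "\<bar>f x * g x\<bar> \<le> (f x)\<^sup>2 + (g x)\<^sup>2" for x
  proof -
    have "2 * (\<bar>f x\<bar> * \<bar>g x\<bar>) \<le> (f x)\<^sup>2 + (g x)\<^sup>2"
      using zero_le_power2[of "\<bar>f x\<bar> - \<bar>g x\<bar>"] by (simp add: power2_diff)
    moreover have "0 \<le> \<bar>f x\<bar> * \<bar>g x\<bar>" by simp
    ultimately show ?thesis unfolding abs_mult by linarith
  qed
  then show "AE x in M. norm (f x * g x) \<le> norm ((f x)\<^sup>2 + (g x)\<^sup>2)"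
    by auto
qed (use assms in \<open>auto simp: L2_space_def\<close>)

lemma L2_norm_nonneg [simp]: "0 \<le> L2_norm M f"
  by (simp add: L2_norm_def)

lemma L2_norm_sq: "(L2_norm M f)\<^sup>2 = (LINT x|M. (f x)\<^sup>2)"
  by (simp add: L2_norm_def)

lemma L2_norm_cmult: "L2_norm M (\<lambda>x. c * f x) = \<bar>c\<bar> * L2_norm M f"
  by (simp add: L2_norm_def power_mult_distrib real_sqrt_mult)

lemma L2_norm_minus: "L2_norm M (\<lambda>x. - f x) = L2_norm M f"
  by (simp add: L2_norm_def)

lemma L2_norm_minus_commute: "L2_norm M (\<lambda>x. f x - g x) = L2_norm M (\<lambda>x. g x - f x)"
  by (simp add: L2_norm_def power2_commute)

lemma L2_norm_mono:
  assumes g: "g \<in> L2_space M"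
    and le: "\<And>x. x \<in> space M \<Longrightarrow> \<bar>f x\<bar> \<le> \<bar>g x\<bar>"
  shows "L2_norm M f \<le> L2_norm M g"
  unfolding L2_norm_def
proof (intro real_sqrt_le_mono integral_mono_AE')
  show "AE x in M. (f x)\<^sup>2 \<le> (g x)\<^sup>2" using le by (auto simp: abs_le_square_iff)
qed (use g in \<open>auto dest: L2_spaceD\<close>)

lemma L2_norm_eq_nn_integral:
  assumes "f \<in> L2_space M"
  shows "(\<integral>\<^sup>+x. ennreal ((f x)\<^sup>2) \<partial>M) = ennreal ((L2_norm M f)\<^sup>2)"
  unfolding L2_norm_sq using assms by (intro nn_integral_eq_integral) (auto dest: L2_spaceD)

lemma L2_spaceI_nn:
  assumes "f \<in> borel_measurable M" "(\<integral>\<^sup>+x. ennreal ((f x)\<^sup>2) \<partial>M) < \<infinity>"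
  shows "f \<in> L2_space M"
  using assms by (simp add: L2_space_def integrable_iff_bounded)

lemma L2_norm_le_nn:
  assumes "f \<in> L2_space M" "(\<integral>\<^sup>+x. ennreal ((f x)\<^sup>2) \<partial>M) \<le> ennreal (c\<^sup>2)" "0 \<le> c"
  shows "L2_norm M f \<le> c"
  using assms by (simp add: L2_norm_eq_nn_integral)

lemma L2_Cauchy_Schwarz:
  assumes f: "f \<in> L2_space M" and g: "g \<in> L2_space M"
  shows "\<bar>LINT x|M. f x * g x\<bar> \<le> L2_norm M f * L2_norm M g"
proof -
  have m [measurable]: "f \<in> borel_measurable M" "g \<in> borel_measurable M"
    using f g by (auto dest: L2_spaceD)
  have i: "integrable M (\<lambda>x. \<bar>f x\<bar> * \<bar>g x\<bar>)"
    using L2_integrable_mult[OF f g] by (simp flip: abs_mult)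
  have "(\<integral>\<^sup>+x. ennreal \<bar>f x\<bar> * ennreal \<bar>g x\<bar> \<partial>M)\<^sup>2 \<le>
      (\<integral>\<^sup>+x. (ennreal \<bar>f x\<bar>)^2 \<partial>M) * (\<integral>\<^sup>+x. (ennreal \<bar>g x\<bar>)^2 \<partial>M)"
    by (intro Cauchy_Schwarz_nn_integral) auto
  also have "\<dots> = ennreal ((L2_norm M f * L2_norm M g)\<^sup>2)"
    using L2_norm_eq_nn_integral[OF f] L2_norm_eq_nn_integral[OF g]
    by (simp add: ennreal_power power_mult_distrib ennreal_mult)
  also have "(\<integral>\<^sup>+x. ennreal \<bar>f x\<bar> * ennreal \<bar>g x\<bar> \<partial>M) = ennreal (LINT x|M. \<bar>f x\<bar> * \<bar>g x\<bar>)"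
    by (subst nn_integral_eq_integral[OF i, symmetric]) (auto simp: ennreal_mult)
  finally have "(LINT x|M. \<bar>f x\<bar> * \<bar>g x\<bar>)\<^sup>2 \<le> (L2_norm M f * L2_norm M g)\<^sup>2"
    by (simp add: ennreal_power)
  then have "(LINT x|M. \<bar>f x\<bar> * \<bar>g x\<bar>) \<le> L2_norm M f * L2_norm M g"
    by (rule power2_le_imp_le) simp
  moreover have "\<bar>LINT x|M. f x * g x\<bar> \<le> (LINT x|M. \<bar>f x * g x\<bar>)"
    using integral_norm_bound[of M "\<lambda>x. f x * g x"] by simp
  ultimately show ?thesis by (simp add: abs_mult)
qed

lemma L2_norm_sq_add:
  assumes f: "f \<in> L2_space M" and g: "g \<in> L2_space M"
  shows "(L2_norm M (\<lambda>x. f x + g x))\<^sup>2 =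
    (L2_norm M f)\<^sup>2 + 2 * (LINT x|M. f x * g x) + (L2_norm M g)\<^sup>2"
proof -
  have "(LINT x|M. (f x + g x)\<^sup>2) = (LINT x|M. (f x)\<^sup>2 + 2 * (f x * g x) + (g x)\<^sup>2)"
    by (simp add: power2_sum algebra_simps)
  also have "\<dots> = (LINT x|M. (f x)\<^sup>2) + 2 * (LINT x|M. f x * g x) + (LINT x|M. (g x)\<^sup>2)"
    using L2_integrable_mult[OF f g] f g by (simp add: L2_space_def)
  finally show ?thesis by (simp add: L2_norm_sq)
qed

lemma L2_norm_triangle:
  assumes f: "f \<in> L2_space M" and g: "g \<in> L2_space M"
  shows "L2_norm M (\<lambda>x. f x + g x) \<le> L2_norm M f + L2_norm M g"
proof (rule power2_le_imp_le)
  show "(L2_norm M (\<lambda>x. f x + g x))\<^sup>2 \<le> (L2_norm M f + L2_norm M g)\<^sup>2"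
    using L2_Cauchy_Schwarz[OF f g] by (simp add: L2_norm_sq_add[OF f g] power2_sum)
qed simp

lemma L2_norm_triangle_diff:
  assumes f: "f \<in> L2_space M" and g: "g \<in> L2_space M"
  shows "L2_norm M (\<lambda>x. f x - g x) \<le> L2_norm M f + L2_norm M g"
  using L2_norm_triangle[OF f L2_space_cmult[OF g, of "-1"]] by (simp add: L2_norm_minus)

lemma L2_norm_parallelogram:
  assumes f: "f \<in> L2_space M" and g: "g \<in> L2_space M"
  shows "(L2_norm M (\<lambda>x. f x + g x))\<^sup>2 + (L2_norm M (\<lambda>x. f x - g x))\<^sup>2 =
    2 * (L2_norm M f)\<^sup>2 + 2 * (L2_norm M g)\<^sup>2"
  using L2_norm_sq_add[OF f g] L2_norm_sq_add[OF f L2_space_cmult[OF g, of "-1"]]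
  by (simp add: L2_norm_minus)

section \<open>Translations, dilations and the Gagliardo energy\<close>

lemma nn_integral_lborel_translate:
  fixes f :: "'a::euclidean_space \<Rightarrow> ennreal"
  assumes [measurable]: "f \<in> borel_measurable borel"
  shows "(\<integral>\<^sup>+x. f (x + c) \<partial>lborel) = (\<integral>\<^sup>+x. f x \<partial>lborel)"
proof -
  have "(\<integral>\<^sup>+x. f x \<partial>lborel) = (\<integral>\<^sup>+x. f x \<partial>distr lborel borel ((+) c))"
    by (simp only: lborel_distr_plus)
  also have "\<dots> = (\<integral>\<^sup>+x. f (c + x) \<partial>lborel)" by (rule nn_integral_distr) auto
  finally show ?thesis by (simp add: add.commute)
qed

lemma nn_integral_lborel_affine:
  fixes f :: "'a::euclidean_space \<Rightarrow> ennreal"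
  assumes [measurable]: "f \<in> borel_measurable borel" and c: "c \<noteq> 0"
  shows "(\<integral>\<^sup>+x. f x \<partial>lborel) = ennreal (\<bar>c\<bar> ^ DIM('a)) * (\<integral>\<^sup>+x. f (t + c *\<^sub>R x) \<partial>lborel)"
  by (subst lborel_affine[OF c, of t])
     (simp add: nn_integral_density nn_integral_distr nn_integral_cmult)

lemma nn_integral_lborel_reflect:
  fixes f :: "'a::euclidean_space \<Rightarrow> ennreal"
  assumes [measurable]: "f \<in> borel_measurable borel"
  shows "(\<integral>\<^sup>+x. f (c - x) \<partial>lborel) = (\<integral>\<^sup>+x. f x \<partial>lborel)"
  using nn_integral_lborel_affine[of f "-1" c] by simp

lemma integral_lborel_translate:
  fixes f :: "'a::euclidean_space \<Rightarrow> real"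
  assumes [measurable]: "f \<in> borel_measurable borel"
  shows "(LINT x|lborel. f (x + c)) = (LINT x|lborel. f x)"
proof -
  have "(LINT x|lborel. f x) = (LINT x|distr lborel borel ((+) c). f x)"
    by (simp only: lborel_distr_plus)
  also have "\<dots> = (LINT x|lborel. f (c + x))" by (rule integral_distr) auto
  finally show ?thesis by (simp add: add.commute)
qed

lemma integrable_lborel_translate:
  fixes f :: "'a::euclidean_space \<Rightarrow> real"
  assumes "integrable lborel f"
  shows "integrable lborel (\<lambda>x. f (x + c))"
proof -
  have "integrable (distr lborel borel ((+) c)) f" using assms by (simp only: lborel_distr_plus)
  then have "integrable lborel (\<lambda>x. f (c + x))"
    using assms by (subst (asm) integrable_distr_eq) auto
  then show ?thesis by (simp add: add.commute)
qed

lemma L2_space_translate: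
  fixes u :: "'a::euclidean_space \<Rightarrow> real"
  assumes "u \<in> L2_space lborel"
  shows "(\<lambda>x. u (x + c)) \<in> L2_space lborel"
  using assms integrable_lborel_translate[of "\<lambda>x. (u x)\<^sup>2" c]
  by (auto simp: L2_space_def)

lemma L2_norm_translate:
  fixes u :: "'a::euclidean_space \<Rightarrow> real"
  assumes "u \<in> borel_measurable borel"
  shows "L2_norm lborel (\<lambda>x. u (x + c)) = L2_norm lborel u"
  using integral_lborel_translate[of "\<lambda>x. (u x)\<^sup>2" c] assms by (simp add: L2_norm_def)

section \<open>First and second differences in the mean, and the energy as an integral over
  shifts\<close>

definition modulus :: "('a::euclidean_space \<Rightarrow> real) \<Rightarrow> 'a \<Rightarrow> real" where
  "modulus u k = L2_norm lborel (\<lambda>x. u (x + k) - u x)"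

definition modulus2 :: "('a::euclidean_space \<Rightarrow> real) \<Rightarrow> 'a \<Rightarrow> real" where
  "modulus2 u k = L2_norm lborel (\<lambda>x. u (x + 2 *\<^sub>R k) - 2 * u (x + k) + u x)"

definition riesz_kernel :: "real \<Rightarrow> 'a::euclidean_space \<Rightarrow> real" where
  "riesz_kernel s h = 1 / norm h powr (real DIM('a) + 2 * s)"

text \<open>The squared Gagliardo seminorm after the substitution y = x + h, without the normalizing
  constant. Grouping by the shift exposes the first differences, and values in
  \<open>ennreal\<close> allow comparisons before finiteness is known.\<close>

definition energy :: "real \<Rightarrow> ('a::euclidean_space \<Rightarrow> real) \<Rightarrow> ennreal" where
  "energy s u = (\<integral>\<^sup>+h. ennreal (riesz_kernel s h) *
     (\<integral>\<^sup>+x. ennreal ((u (x + h) - u x)\<^sup>2) \<partial>lborel) \<partial>lborel)"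

lemma modulus_nonneg [simp]: "0 \<le> modulus u k" "0 \<le> modulus2 u k"
  by (simp_all add: modulus_def modulus2_def)

lemma riesz_kernel_nonneg [simp]: "0 \<le> riesz_kernel s h"
  by (simp add: riesz_kernel_def)

lemma riesz_kernel_minus [simp]: "riesz_kernel s (- h) = riesz_kernel s h"
  by (simp add: riesz_kernel_def)

lemma borel_measurable_riesz_kernel [measurable]: "riesz_kernel s \<in> borel_measurable borel"
  unfolding riesz_kernel_def[abs_def] by measurable

lemma nn_integral_diff_eq_modulus:
  assumes "u \<in> L2_space lborel"
  shows "(\<integral>\<^sup>+x. ennreal ((u (x + h) - u x)\<^sup>2) \<partial>lborel) = ennreal ((modulus u h)\<^sup>2)"
  unfolding modulus_def
  by (intro L2_norm_eq_nn_integral L2_space_diff L2_space_translate assms)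

lemma borel_measurable_modulus [measurable]:
  assumes "u \<in> L2_space lborel"
  shows "modulus u \<in> borel_measurable borel"
proof -
  have [measurable]: "u \<in> borel_measurable borel" using assms by (auto simp: L2_space_def)
  show ?thesis unfolding modulus_def[abs_def] L2_norm_def by measurable
qed

lemma energy_eq_modulus:
  assumes "u \<in> L2_space lborel"
  shows "energy s u = (\<integral>\<^sup>+h. ennreal (riesz_kernel s h * (modulus u h)\<^sup>2) \<partial>lborel)"
  unfolding energy_def nn_integral_diff_eq_modulus[OF assms] by (simp add: ennreal_mult)

lemma modulus_add_le:
  fixes u :: "'a::euclidean_space \<Rightarrow> real"
  assumes u: "u \<in> L2_space lborel"
  shows "modulus u (h + k) \<le> modulus u h + modulus u k"
proof -
  have [measurable]: "u \<in> borel_measurable borel" using u by (auto simp: L2_space_def)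
  have *: "(\<lambda>x. u (x + h) - u x) \<in> L2_space lborel" for h
    by (intro L2_space_diff L2_space_translate u)
  have "modulus u (h + k) = L2_norm lborel (\<lambda>x. (u (x + k + h) - u (x + k)) + (u (x + k) - u x))"
    by (simp add: modulus_def algebra_simps)
  also have "\<dots> \<le> L2_norm lborel (\<lambda>x. u (x + k + h) - u (x + k)) + modulus u k"
    unfolding modulus_def
    by (intro L2_norm_triangle * L2_space_translate[of "\<lambda>x. u (x + h) - u x" k])
  also have "L2_norm lborel (\<lambda>x. u (x + k + h) - u (x + k)) = modulus u h"
    unfolding modulus_def by (rule L2_norm_translate) measurable
  finally show ?thesis .
qed

lemma modulus_le_norm:
  fixes u :: "'a::euclidean_space \<Rightarrow> real"
  assumes u: "u \<in> L2_space lborel"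
  shows "modulus u k \<le> 2 * L2_norm lborel u"
  using L2_norm_triangle_diff[OF L2_space_translate[OF u] u, of k] L2_norm_translate[of u k] L2_spaceD(1)[OF u]
  by (simp add: modulus_def)

lemma modulus_scale_le:
  fixes u :: "'a::euclidean_space \<Rightarrow> real"
  assumes u: "u \<in> L2_space lborel"
  shows "modulus u (real n *\<^sub>R k) \<le> real n * modulus u k"
proof (induction n)
  case 0 then show ?case by (simp add: modulus_def L2_norm_def)
next
  case (Suc n)
  have "modulus u (real (Suc n) *\<^sub>R k) \<le> modulus u (real n *\<^sub>R k) + modulus u k"
    using modulus_add_le[OF u, of "real n *\<^sub>R k" k] by (simp add: scaleR_add_left add.commute)
  then show ?case using Suc by (simp add: algebra_simps)
qed

text \<open>Apply the parallelogram law to a(x) = u(x + k) - u(x) and its translate by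
  \<open>k\<close>: their sum is a first difference of step 2k, their difference is the second
  difference, and both have the same norm.\<close>

lemma modulus_parallelogram:
  fixes u :: "'a::euclidean_space \<Rightarrow> real"
  assumes u: "u \<in> L2_space lborel"
  shows "(modulus u (2 *\<^sub>R k))\<^sup>2 + (modulus2 u k)\<^sup>2 = 4 * (modulus u k)\<^sup>2"
proof -
  have [measurable]: "u \<in> borel_measurable borel" using u by (auto simp: L2_space_def)
  define a where "a = (\<lambda>x. u (x + k) - u x)"
  have a: "a \<in> L2_space lborel" unfolding a_def by (intro L2_space_diff L2_space_translate u)
  have ak: "(\<lambda>x. a (x + k)) \<in> L2_space lborel" by (rule L2_space_translate[OF a])
  have n: "L2_norm lborel (\<lambda>x. a (x + k)) = L2_norm lborel a"
    using a by (intro L2_norm_translate) (auto simp: L2_space_def)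
  have k2: "x + k + k = x + 2 *\<^sub>R k" for x by (simp add: scaleR_2)
  have 1: "(\<lambda>x. a (x + k) + a x) = (\<lambda>x. u (x + 2 *\<^sub>R k) - u x)"
    unfolding a_def k2 by auto
  have 2: "(\<lambda>x. a (x + k) - a x) = (\<lambda>x. u (x + 2 *\<^sub>R k) - 2 * u (x + k) + u x)"
    unfolding a_def k2 by auto
  have "modulus u k = L2_norm lborel a" by (simp add: modulus_def a_def)
  then show ?thesis
    using L2_norm_parallelogram[OF ak a] unfolding 1 2 n by (simp add: modulus_def modulus2_def)
qed

text \<open>Dyadic scaling produces ratios \<open>4 powr (-x)\<close> with x equal to
  \<open>s\<close>, \<open>1 - s\<close> or \<open>1 - \<tau>\<close>. That one minus the ratio is
  comparable to x turns the geometric sums into factors 1/x.\<close>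

lemma powr_4_bounds:
  fixes x :: real
  assumes "0 < x" "x < 1"
  shows "0 < 4 powr (-x)" "4 powr (-x) < 1" "x / 2 \<le> 1 - 4 powr (-x)" "1 - 4 powr (-x) \<le> 2 * x"
proof -
  have l: "ln 4 = 2 * ln (2::real)" using ln_realpow[of 2 2] by simp
  have l2: "ln (2::real) < 1" by (rule ln_2_less_1)
  have l1: "1/2 \<le> ln (2::real)"
    using ln_add_one_self_le_self2[of "-1/2"] by (simp add: ln_div)
  show "0 < 4 powr (-x)" by simp
  show lt: "4 powr (-x) < 1" using powr_less_cancel_iff[of 4 "-x" 0] assms by simp
  have "1 + x \<le> 1 + x * ln 4" using assms l l1 by (simp add: mult_left_le)
  also have "\<dots> \<le> 4 powr x" by (simp add: powr_def exp_ge_add_one_self_aux)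
  finally have "(1 + x) * 4 powr (-x) \<le> 4 powr x * 4 powr (-x)" by (intro mult_right_mono) auto
  also have "\<dots> = 1" by (simp flip: powr_add)
  finally have 1: "(1 + x) * 4 powr (-x) \<le> 1" .
  have "x * 1 \<le> (1 + x) * (1 - 4 powr (-x))" using 1 by (simp add: algebra_simps)
  also have "\<dots> \<le> 2 * (1 - 4 powr (-x))" using assms lt by (intro mult_right_mono) auto
  finally show "x / 2 \<le> 1 - 4 powr (-x)" by simp
  have "1 - x * ln 4 \<le> 4 powr (-x)"
    using exp_ge_add_one_self[of "-x * ln 4"] by (simp add: powr_def)
  moreover have "x * ln 4 \<le> x * 2" using assms l l2 by (intro mult_left_mono) auto
  ultimately show "1 - 4 powr (-x) \<le> 2 * x" by simp
qed

text \<open>Replaces the summation of a geometric series: an integral is bounded below by one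
  annulus plus a rescaled copy of itself, and the resulting inequality is solved for the integral.
  An infinite value satisfies the claim trivially.\<close>

lemma ennreal_geometric_lower_bound:
  fixes x :: ennreal
  assumes le: "ennreal a + ennreal q * x \<le> x" and a: "0 \<le> a" and q: "0 \<le> q" "q < 1"
  shows "ennreal (a / (1 - q)) \<le> x"
proof (cases x)
  case (real r)
  then have "ennreal (a + q * r) \<le> ennreal r"
    using le a q by (simp add: ennreal_mult ennreal_plus)
  then have "a + q * r \<le> r" using real by (simp add: ennreal_le_iff)
  then have "a / (1 - q) \<le> r" using q by (simp add: field_simps)
  then show ?thesis using real by (simp add: ennreal_le_iff)
qed simp

section \<open>Dyadic integration of the Riesz kernel\<close>

lemma riesz_kernel_scale:
  fixes h :: "'a::euclidean_space"
  assumes "0 < c"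
  shows "riesz_kernel s (c *\<^sub>R h) = riesz_kernel s h / (c ^ DIM('a) * c powr (2 * s))"
  using assms by (simp add: riesz_kernel_def powr_mult powr_add powr_realpow field_simps)

lemma riesz_kernel_antimono:
  fixes h :: "'a::euclidean_space"
  assumes "0 < r" "r \<le> norm h" "0 < s"
  shows "riesz_kernel s h \<le> r powr (- (real DIM('a) + 2 * s))"
  using assms unfolding riesz_kernel_def powr_minus_divide
  by (intro divide_left_mono powr_mono2) (auto intro!: mult_pos_pos)

lemma riesz_kernel_lower:
  fixes h :: "'a::euclidean_space"
  assumes "h \<noteq> 0" "norm h \<le> r" "0 < s"
  shows "r powr (- (real DIM('a) + 2 * s)) \<le> riesz_kernel s h"
proof -
  have "0 < norm h" using assms by simp
  then have "0 < r" using assms by linarith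
  then show ?thesis using assms unfolding riesz_kernel_def powr_minus_divide
    by (intro divide_left_mono powr_mono2) (auto intro!: mult_pos_pos)
qed

lemma ex_dyadic_scale:
  fixes r :: real
  assumes "1 \<le> r"
  shows "\<exists>j::nat. 2 ^ j \<le> r \<and> r < 2 ^ Suc j"
proof -
  obtain n :: nat where n: "r < 2 ^ n" using real_arch_pow[of 2 r] by auto
  define m where "m = (LEAST n. r < 2 ^ n)"
  have m: "r < 2 ^ m" unfolding m_def by (rule LeastI[of _ n]) (rule n)
  then have "m \<noteq> 0" using assms by (intro notI) simp
  then obtain j where j: "m = Suc j" by (cases m) auto
  have "\<not> r < 2 ^ j" using not_less_Least[of j "\<lambda>n. r < 2 ^ n"] j by (simp add: m_def)
  with m j show ?thesis by (intro exI[of _ j]) auto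
qed

text \<open>Annuli are enlarged to balls, which costs only a constant in upper bounds. Up to the
  volume of the unit ball, \<open>r j ^ DIM('a) * a j\<close> is the contribution of the j-th ball,
  so the hypothesis says that the contributions are geometric.\<close>

lemma nn_integral_dyadic_bound:
  fixes f :: "'a::euclidean_space \<Rightarrow> ennreal"
  assumes q: "0 \<le> q" "q < 1" and C: "0 \<le> C"
    and r: "\<And>j. 0 \<le> r j" and a: "\<And>j. 0 \<le> a j" "\<And>j. r j ^ DIM('a) * a j = C * q ^ j"
    and f: "\<And>h. f h = 0 \<or> (\<exists>j. norm h \<le> r j \<and> f h \<le> ennreal (a j))"
  shows "(\<integral>\<^sup>+h. f h \<partial>lborel) \<le> ennreal (unit_ball_vol (DIM('a)) * C / (1 - q))"
proof -
  let ?v = "unit_ball_vol (real DIM('a))"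
  have "(\<integral>\<^sup>+h. f h \<partial>lborel) \<le> (\<integral>\<^sup>+h. (\<Sum>j. ennreal (a j) * indicator (cball 0 (r j)) (h::'a)) \<partial>lborel)"
  proof (rule nn_integral_mono)
    fix h :: 'a
    show "f h \<le> (\<Sum>j. ennreal (a j) * indicator (cball 0 (r j)) h)"
    proof (cases "f h = 0")
      case False
      then obtain j where j: "norm h \<le> r j" "f h \<le> ennreal (a j)" using f by blast
      have "f h \<le> (\<Sum>i\<in>{j}. ennreal (a i) * indicator (cball 0 (r i)) h)" using j by simp
      also have "\<dots> \<le> (\<Sum>j. ennreal (a j) * indicator (cball 0 (r j)) h)"
        by (intro sum_le_suminf) auto
      finally show ?thesis .
    qed simp
  qed
  also have "\<dots> = (\<Sum>j. \<integral>\<^sup>+h. ennreal (a j) * indicator (cball 0 (r j)) (h::'a) \<partial>lborel)"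
    by (intro nn_integral_suminf borel_measurable_times_ennreal borel_measurable_indicator) auto
  also have "\<dots> = (\<Sum>j. ennreal (?v * C * q ^ j))"
  proof (intro suminf_cong)
    fix j
    have "(\<integral>\<^sup>+h. ennreal (a j) * indicator (cball 0 (r j)) (h::'a) \<partial>lborel) =
        ennreal (a j * (?v * r j ^ DIM('a)))"
      using r a by (simp add: nn_integral_cmult_indicator emeasure_cball ennreal_mult)
    also have "a j * (?v * r j ^ DIM('a)) = ?v * C * q ^ j" using a(2)[of j] by (simp add: algebra_simps)
    finally show "(\<integral>\<^sup>+h. ennreal (a j) * indicator (cball 0 (r j)) (h::'a) \<partial>lborel) = ennreal (?v * C * q ^ j)" .
  qed
  also have "\<dots> = ennreal (\<Sum>j. ?v * C * q ^ j)"
    using q C by (intro suminf_ennreal2) (auto intro!: summable_mult summable_geometric)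
  also have "(\<Sum>j. ?v * C * q ^ j) = ?v * C / (1 - q)"
    using q by (subst suminf_mult) (auto simp: suminf_geometric summable_geometric)
  finally show ?thesis .
qed

text \<open>The annuli outside the unit ball form a series of ratio \<open>4 powr (-s)\<close>,
  those inside, thanks to the weight, one of ratio \<open>4 powr (-(1 - s))\<close>. The two sums
  are of order 1/s and 1/(1 - s), and 1/s + 1/(1 - s) = 1/(s (1 - s)).\<close>

lemma riesz_kernel_tail_le:
  fixes s :: real
  assumes s: "0 < s" "s < 1"
  shows "(\<integral>\<^sup>+h. ennreal (riesz_kernel s h * min 1 ((norm h)\<^sup>2)) \<partial>(lborel::'a::euclidean_space measure))
    \<le> ennreal (unit_ball_vol DIM('a) * 2 ^ (DIM('a) + 4) / (s * (1 - s)))"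
proof -
  let ?n = "DIM('a)" let ?v = "unit_ball_vol (real DIM('a))"
  define p where "p = real ?n + 2 * s"
  define f where "f h = ennreal (riesz_kernel s h * min 1 ((norm h)\<^sup>2))" for h :: 'a
  have [measurable]: "f \<in> borel_measurable borel" unfolding f_def by measurable
  have pw: "(2 ^ j) powr x = 2 powr (real j * x)" for j :: nat and x :: real
    by (simp add: powr_powr flip: powr_realpow)
  have q: "(4 powr - x) ^ j = 2 powr (- 2 * real j * x)" for j :: nat and x :: real
  proof -
    have "(4::real) powr - x = (2 powr 2) powr - x" by simp
    then show ?thesis by (simp only: powr_powr flip: powr_realpow) (simp add: powr_power mult_ac)
  qed
  have "(\<integral>\<^sup>+h. f h * indicator {h. 1 \<le> norm h} h \<partial>lborel) \<le> ennreal (?v * 2 ^ ?n / (1 - 4 powr (-s)))"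
  proof (rule nn_integral_dyadic_bound)
    show "0 \<le> 4 powr - s" "4 powr - s < 1" using powr_4_bounds[OF s] by auto
    show "(2 ^ Suc j) ^ ?n * 2 powr (- (real j * p)) = 2 ^ ?n * (4 powr - s) ^ j" for j :: nat
    proof -
      have "(2 ^ Suc j) ^ ?n * 2 powr (- (real j * p)) = 2 ^ ?n * (2 powr (real (j * ?n)) * 2 powr (- (real j * p)))"
        by (subst powr_realpow) (auto simp: power_mult power_mult_distrib)
      also have "2 powr (real (j * ?n)) * 2 powr (- (real j * p)) = 2 powr (- 2 * real j * s)"
        unfolding powr_add[symmetric] by (simp add: p_def algebra_simps)
      finally show ?thesis by (simp add: q)
    qed
    fix h :: 'a
    show "f h * indicator {h. 1 \<le> norm h} h = 0 \<or>
      (\<exists>j. norm h \<le> 2 ^ Suc j \<and> f h * indicator {h. 1 \<le> norm h} h \<le> ennreal (2 powr (- (real j * p))))"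
    proof (cases "1 \<le> norm h")
      case True
      then obtain j :: nat where j: "2 ^ j \<le> norm h" "norm h < 2 ^ Suc j" using ex_dyadic_scale by blast
      have "riesz_kernel s h \<le> (2 ^ j) powr (- p)"
        unfolding p_def by (rule riesz_kernel_antimono) (use j s in auto)
      then have "riesz_kernel s h * min 1 ((norm h)\<^sup>2) \<le> 2 powr (- (real j * p))"
        unfolding pw by (intro order_trans[OF mult_left_le]) auto
      then have "f h \<le> ennreal (2 powr (- (real j * p)))" unfolding f_def by (rule ennreal_leI)
      then show ?thesis using j True by (intro disjI2 exI[of _ j]) auto
    qed auto
  qed auto
  also have "\<dots> \<le> ennreal (?v * 2 ^ (?n + 4) / s)"
  proof (rule ennreal_leI)
    have "?v * 2 ^ ?n / (1 - 4 powr (-s)) \<le> ?v * 2 ^ ?n / (s / 2)"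
      using powr_4_bounds[OF s] s by (intro divide_left_mono) auto
    also have "\<dots> = (?v * 2 ^ ?n * 2) / s" by simp
    also have "\<dots> \<le> ?v * 2 ^ (?n + 4) / s"
      using s by (intro divide_right_mono) (auto simp: power_add)
    finally show "?v * 2 ^ ?n / (1 - 4 powr (-s)) \<le> ?v * 2 ^ (?n + 4) / s" .
  qed
  finally have far: "(\<integral>\<^sup>+h. f h * indicator {h. 1 \<le> norm h} h \<partial>lborel) \<le> ennreal (?v * 2 ^ (?n + 4) / s)" .
  have "(\<integral>\<^sup>+h. f h * indicator {h. norm h < 1} h \<partial>lborel) \<le> ennreal (?v * 2 powr p / (1 - 4 powr (-(1-s))))"
  proof (rule nn_integral_dyadic_bound)
    show "0 \<le> 4 powr - (1-s)" "4 powr - (1-s) < 1" using powr_4_bounds[of "1-s"] s by auto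
    show "((1/2) ^ j) ^ ?n * (2 powr (real j * (p - 2)) * 2 powr p) = 2 powr p * (4 powr - (1-s)) ^ j" for j :: nat
    proof -
      have "((1/2) ^ j) ^ ?n = (2::real) powr (- real (j * ?n))"
        by (simp only: powr_minus powr_realpow zero_less_numeral) (simp add: power_mult field_simps)
      then have "((1/2) ^ j) ^ ?n * (2 powr (real j * (p - 2)) * 2 powr p) =
          2 powr p * (2 powr (- real (j * ?n)) * 2 powr (real j * (p - 2)))" by (simp only: mult_ac)
      also have "2 powr (- real (j * ?n)) * 2 powr (real j * (p - 2)) = 2 powr (- 2 * real j * (1 - s))"
        unfolding powr_add[symmetric] by (simp add: p_def algebra_simps)
      finally show ?thesis unfolding q .
    qed
    fix h :: 'a
    show "f h * indicator {h. norm h < 1} h = 0 \<or>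
      (\<exists>j. norm h \<le> (1/2) ^ j \<and> f h * indicator {h. norm h < 1} h \<le> ennreal (2 powr (real j * (p - 2)) * 2 powr p))"
    proof (cases "h \<noteq> 0 \<and> norm h < 1")
      case True
      then have "1 \<le> 1 / norm h" by simp
      then obtain j :: nat where j: "2 ^ j \<le> 1 / norm h" "1 / norm h < 2 ^ Suc j" using ex_dyadic_scale by blast
      have j1: "norm h \<le> (1/2) ^ j" using j(1) True by (simp add: field_simps)
      have j2: "(1/2) ^ Suc j \<le> norm h" using j(2) True by (simp add: field_simps)
      have "riesz_kernel s h \<le> ((1/2) ^ Suc j) powr (- p)"
        unfolding p_def by (rule riesz_kernel_antimono) (use j2 s in auto)
      also have "((1/2) ^ Suc j) powr (- p) = 2 powr (real (Suc j) * p)"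
        by (simp add: powr_minus_divide power_one_over powr_divide pw powr_mult powr_add algebra_simps)
      finally have k: "riesz_kernel s h \<le> 2 powr (real (Suc j) * p)" .
      have "(norm h)\<^sup>2 \<le> ((1/2) ^ j)\<^sup>2" using j1 by (intro power_mono) auto
      also have "((1/2) ^ j)\<^sup>2 = 2 powr (- (real j * 2))"
        by (simp add: powr_minus powr_realpow[symmetric] power_one_over power_mult[symmetric] powr_powr field_simps flip: powr_numeral)
      finally have "riesz_kernel s h * min 1 ((norm h)\<^sup>2) \<le> 2 powr (real (Suc j) * p) * 2 powr (- (real j * 2))"
        using k by (intro mult_mono) auto
      also have "\<dots> = 2 powr (real j * (p - 2)) * 2 powr p"
        unfolding powr_add[symmetric] by (simp add: algebra_simps)
      finally have "f h \<le> ennreal (2 powr (real j * (p - 2)) * 2 powr p)" unfolding f_def by (rule ennreal_leI)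
      then show ?thesis using j1 True by (intro disjI2 exI[of _ j]) auto
    qed (auto simp: f_def)
  qed auto
  also have "\<dots> \<le> ennreal (?v * 2 ^ (?n + 4) / (1 - s))"
  proof (rule ennreal_leI)
    have "?v * 2 powr p / (1 - 4 powr (-(1-s))) \<le> ?v * 2 powr p / ((1-s) / 2)"
      using powr_4_bounds[of "1-s"] s by (intro divide_left_mono) auto
    also have "\<dots> = (?v * 2 powr p * 2) / (1-s)" by simp
    also have "\<dots> \<le> (?v * 2 powr (real (?n + 2)) * 2) / (1-s)"
      using s by (intro divide_right_mono mult_right_mono mult_left_mono powr_mono) (auto simp: p_def)
    also have "2 powr (real (?n + 2)) = (2::real) ^ (?n + 2)" by (rule powr_realpow) simp
    also have "?v * 2 ^ (?n + 2) * 2 / (1 - s) \<le> ?v * 2 ^ (?n + 4) / (1-s)"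
      using s by (intro divide_right_mono) (auto simp: power_add)
    finally show "?v * 2 powr p / (1 - 4 powr (-(1-s))) \<le> ?v * 2 ^ (?n + 4) / (1-s)" .
  qed
  finally have near: "(\<integral>\<^sup>+h. f h * indicator {h. norm h < 1} h \<partial>lborel) \<le> ennreal (?v * 2 ^ (?n + 4) / (1-s))" .
  have "(\<integral>\<^sup>+h. f h \<partial>lborel) = (\<integral>\<^sup>+h. f h * indicator {h. 1 \<le> norm h} h + f h * indicator {h. norm h < 1} h \<partial>lborel)"
    by (intro nn_integral_cong) (auto split: split_indicator)
  also have "\<dots> = (\<integral>\<^sup>+h. f h * indicator {h. 1 \<le> norm h} h \<partial>lborel) + (\<integral>\<^sup>+h. f h * indicator {h. norm h < 1} h \<partial>lborel)"
    by (intro nn_integral_add) auto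
  also have "\<dots> \<le> ennreal (?v * 2 ^ (?n + 4) / s) + ennreal (?v * 2 ^ (?n + 4) / (1-s))"
    by (intro add_mono far near)
  also have "\<dots> = ennreal (?v * 2 ^ (?n + 4) / s + ?v * 2 ^ (?n + 4) / (1-s))"
    using s by (intro ennreal_plus[symmetric]) auto
  also have "?v * 2 ^ (?n + 4) / s + ?v * 2 ^ (?n + 4) / (1-s) = ?v * 2 ^ (?n + 4) / (s * (1 - s))"
    using s by (simp add: field_simps)
  finally show ?thesis unfolding f_def .
qed

text \<open>By homogeneity the integral over norms at least 2R is \<open>4 powr (-s)\<close> times
  the one over norms at least R. The annulus in between contributes at least \<open>A\<close>, and
  solving the self-similar inequality gives the factor 1/s.\<close>

lemma riesz_kernel_tail_ge:
  fixes s R :: real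
  assumes s: "0 < s" "s < 1" and R: "0 < R"
  shows "ennreal (unit_ball_vol DIM('a) / 2 ^ (DIM('a) + 3) * R powr (- 2 * s) / s) \<le>
    (\<integral>\<^sup>+h. ennreal (riesz_kernel s h) * indicator {h. R \<le> norm h} h \<partial>(lborel::'a::euclidean_space measure))"
proof -
  let ?n = "DIM('a)" let ?v = "unit_ball_vol (real DIM('a))"
  define p where "p = real ?n + 2 * s"
  define I where "I = (\<integral>\<^sup>+h. ennreal (riesz_kernel s h) * indicator {h. R \<le> norm h} h \<partial>(lborel::'a measure))"
  define q where "q = 4 powr (- s)"
  have q: "0 < q" "q < 1" "1 - q \<le> 2 * s" using powr_4_bounds[OF s] by (auto simp: q_def)
  define A where "A = ?v / 2 ^ (?n + 2) * R powr (- 2 * s)"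
  have scale: "(\<integral>\<^sup>+h. ennreal (riesz_kernel s h) * indicator {h. 2 * R \<le> norm h} h \<partial>(lborel::'a measure)) = ennreal q * I"
  proof -
    have "(\<integral>\<^sup>+h. ennreal (riesz_kernel s h) * indicator {h. 2 * R \<le> norm h} h \<partial>(lborel::'a measure)) =
      ennreal (\<bar>2\<bar> ^ ?n) * (\<integral>\<^sup>+h. ennreal (riesz_kernel s (0 + 2 *\<^sub>R h)) * indicator {h. 2 * R \<le> norm h} (0 + 2 *\<^sub>R h) \<partial>(lborel::'a measure))"
      by (rule nn_integral_lborel_affine) auto
    also have "(\<lambda>h. ennreal (riesz_kernel s (0 + 2 *\<^sub>R h)) * indicator {h. 2 * R \<le> norm h} (0 + 2 *\<^sub>R h)) =
       (\<lambda>h::'a. ennreal (1 / (2 ^ ?n * 2 powr (2 * s))) * (ennreal (riesz_kernel s h) * indicator {h. R \<le> norm h} h))"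
      by (auto simp: fun_eq_iff riesz_kernel_scale ennreal_mult[symmetric] mult.assoc[symmetric] split: split_indicator)
    also have "(\<integral>\<^sup>+h. ennreal (1 / (2 ^ ?n * 2 powr (2 * s))) * (ennreal (riesz_kernel s h) * indicator {h. R \<le> norm h} h) \<partial>(lborel::'a measure))
       = ennreal (1 / (2 ^ ?n * 2 powr (2 * s))) * I"
      unfolding I_def by (rule nn_integral_cmult) auto
    also have "ennreal (\<bar>2\<bar> ^ ?n) * (ennreal (1 / (2 ^ ?n * 2 powr (2 * s))) * I) = ennreal (\<bar>2\<bar> ^ ?n * (1 / (2 ^ ?n * 2 powr (2 * s)))) * I"
      by (subst ennreal_mult) (simp_all only: mult.assoc abs_ge_zero zero_le_power zero_le_divide_1_iff mult_nonneg_nonneg powr_ge_zero zero_le_numeral)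
    also have "\<bar>2\<bar> ^ ?n * (1 / (2 ^ ?n * 2 powr (2 * s))) = q"
    proof -
      have "(4::real) powr - s = (2 powr 2) powr - s" by simp
      then show ?thesis by (simp only: q_def powr_powr) (simp add: powr_minus divide_simps)
    qed
    finally show ?thesis .
  qed
  have ann: "ennreal A \<le> (\<integral>\<^sup>+h. ennreal (riesz_kernel s h) * indicator {h. R \<le> norm h \<and> norm h < 2 * R} h \<partial>(lborel::'a measure))"
  proof -
    have sub: "{h::'a. R \<le> norm h \<and> norm h < 2 * R} = ball 0 (2 * R) - ball 0 R"
      by (auto simp: not_less)
    \<comment> \<open>The annulus is at least as large as its inner ball because
      \<open>2 ^ DIM('a)\<close> is at least 2.\<close>
    have "?v * R ^ ?n \<le> ?v * (2 * R) ^ ?n - ?v * R ^ ?n"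
    proof -
      have "2 \<le> (2::real) ^ ?n" using power_increasing[of 1 ?n "2::real"] by (simp add: DIM_positive Suc_le_eq)
      then have "2 * R ^ ?n \<le> 2 ^ ?n * R ^ ?n" using R by (intro mult_right_mono) auto
      then have "?v * (2 * R ^ ?n) \<le> ?v * (2 ^ ?n * R ^ ?n)" by (intro mult_left_mono) auto
      then show ?thesis by (simp add: power_mult_distrib algebra_simps)
    qed
    moreover have "emeasure lborel {h::'a. R \<le> norm h \<and> norm h < 2 * R} = ennreal (?v * (2 * R) ^ ?n - ?v * R ^ ?n)"
      unfolding sub using R by (subst emeasure_Diff) (auto simp: emeasure_ball ennreal_minus)
    ultimately have m: "ennreal (?v * R ^ ?n) \<le> emeasure lborel {h::'a. R \<le> norm h \<and> norm h < 2 * R}"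
      by (simp add: ennreal_leI)
    have "A \<le> (2 * R) powr (- p) * (?v * R ^ ?n)"
    proof -
      have "(2 * R) powr (- p) * (?v * R ^ ?n) = ?v * 2 powr (- p) * (R powr (- p) * R powr real ?n)"
        using R by (simp add: powr_mult powr_realpow)
      also have "R powr (- p) * R powr real ?n = R powr (- 2 * s)"
        unfolding powr_add[symmetric] by (simp add: p_def)
      finally have 1: "(2 * R) powr (- p) * (?v * R ^ ?n) = ?v * 2 powr (- p) * R powr (- 2 * s)" .
      have "1 / 2 ^ (?n + 2) = (2::real) powr (- real (?n + 2))"
        by (simp only: powr_minus powr_realpow zero_less_numeral) (simp add: field_simps)
      also have "\<dots> \<le> 2 powr (- p)" using s by (intro powr_mono) (auto simp: p_def)
      finally have "?v * (1 / 2 ^ (?n + 2)) * R powr (- 2 * s) \<le> ?v * 2 powr (- p) * R powr (- 2 * s)"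
        by (intro mult_right_mono mult_left_mono) auto
      then show ?thesis unfolding 1 A_def by simp
    qed
    then have "ennreal A \<le> ennreal ((2 * R) powr (- p)) * ennreal (?v * R ^ ?n)"
      using R by (simp add: ennreal_mult[symmetric] ennreal_leI)
    also have "\<dots> \<le> ennreal ((2 * R) powr (- p)) * emeasure lborel {h::'a. R \<le> norm h \<and> norm h < 2 * R}"
      by (intro mult_left_mono m) auto
    also have "\<dots> = (\<integral>\<^sup>+h. ennreal ((2 * R) powr (- p)) * indicator {h. R \<le> norm h \<and> norm h < 2 * R} h \<partial>(lborel::'a measure))"
      by (subst nn_integral_cmult_indicator) auto
    also have "\<dots> \<le> (\<integral>\<^sup>+h. ennreal (riesz_kernel s h) * indicator {h. R \<le> norm h \<and> norm h < 2 * R} h \<partial>(lborel::'a measure))"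
    proof (intro nn_integral_mono)
      fix h :: 'a
      have "ennreal ((2 * R) powr (- p)) \<le> ennreal (riesz_kernel s h)" if "R \<le> norm h" "norm h < 2 * R"
        unfolding p_def by (intro ennreal_leI riesz_kernel_lower) (use that R s in auto)
      then show "ennreal ((2 * R) powr (- p)) * indicator {h. R \<le> norm h \<and> norm h < 2 * R} h \<le>
          ennreal (riesz_kernel s h) * indicator {h. R \<le> norm h \<and> norm h < 2 * R} h"
        by (auto split: split_indicator)
    qed
    finally show ?thesis .
  qed
  have "I = (\<integral>\<^sup>+h. ennreal (riesz_kernel s h) * indicator {h. R \<le> norm h \<and> norm h < 2 * R} h
      + ennreal (riesz_kernel s h) * indicator {h. 2 * R \<le> norm h} h \<partial>(lborel::'a measure))"
    unfolding I_def using R by (intro nn_integral_cong) (auto split: split_indicator)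
  also have "\<dots> = (\<integral>\<^sup>+h. ennreal (riesz_kernel s h) * indicator {h. R \<le> norm h \<and> norm h < 2 * R} h \<partial>(lborel::'a measure)) + ennreal q * I"
    unfolding scale[symmetric] by (rule nn_integral_add) auto
  finally have I_eq: "I = (\<integral>\<^sup>+h. ennreal (riesz_kernel s h) * indicator {h. R \<le> norm h \<and> norm h < 2 * R} h \<partial>(lborel::'a measure)) + ennreal q * I" .
  have "ennreal A + ennreal q * I \<le> I" by (subst (2) I_eq) (rule add_right_mono[OF ann])
  then have "ennreal (A / (1 - q)) \<le> I"
    using R q by (intro ennreal_geometric_lower_bound) (auto simp: A_def)
  moreover have "?v / 2 ^ (?n + 3) * R powr (- 2 * s) / s \<le> A / (1 - q)"
  proof -
    have "?v / 2 ^ (?n + 3) * R powr (- 2 * s) / s = A / (2 * s)" by (simp add: A_def power_add)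
    also have "\<dots> \<le> A / (1 - q)" using q s by (intro divide_left_mono) (auto simp: A_def)
    finally show ?thesis .
  qed
  ultimately show ?thesis unfolding I_def using ennreal_leI order_trans by blast
qed

section \<open>First differences are controlled by the energy, uniformly in \<open>s\<close>\<close>

lemma modulus_sq_le:
  assumes "u \<in> L2_space lborel"
  shows "(modulus u k)\<^sup>2 \<le> 2 * (modulus u h)\<^sup>2 + 2 * (modulus u (k - h))\<^sup>2"
proof -
  have "modulus u k \<le> modulus u h + modulus u (k - h)"
    using modulus_add_le[OF assms, of h "k - h"] by simp
  then have "(modulus u k)\<^sup>2 \<le> (modulus u h + modulus u (k - h))\<^sup>2"
    by (intro power_mono) auto
  also have "\<dots> \<le> 2 * (modulus u h)\<^sup>2 + 2 * (modulus u (k - h))\<^sup>2"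
    using zero_le_power2[of "modulus u h - modulus u (k - h)"] by (simp add: power2_sum power2_diff)
  finally show ?thesis .
qed

text \<open>Write k as h + (k - h) with h at least twice as long as k. There the kernel at
  \<open>h\<close> is bounded by a constant times the kernel at \<open>k - h\<close>, so integrating
  the squared triangle inequality gives two energies on the right, and the kernel tail on the left
  supplies 1/s.\<close>

lemma energy_far_bound:
  fixes u :: "'a::euclidean_space \<Rightarrow> real"
  assumes u: "u \<in> L2_space lborel" and s: "0 < s" "s < 1" and k: "k \<noteq> 0"
  shows "ennreal (unit_ball_vol DIM('a) / 2 ^ (2 * DIM('a) + 10) * norm k powr (- 2 * s) / s * (modulus u k)\<^sup>2) \<le> energy s u"
proof -
  let ?n = "DIM('a)" let ?v = "unit_ball_vol (real DIM('a))"
  note [measurable] = borel_measurable_modulus[OF u]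
  define p where "p = real ?n + 2 * s"
  define c where "c = (2::real) ^ (?n + 2)"
  have cp: "(3/2) powr p \<le> c"
  proof -
    have "(3/2) powr p \<le> 2 powr p" using s by (intro powr_mono2) (auto simp: p_def)
    also have "\<dots> \<le> 2 powr (real (?n + 2))" using s by (intro powr_mono) (auto simp: p_def)
    also have "\<dots> = c" unfolding c_def by (rule powr_realpow) simp
    finally show ?thesis .
  qed
  have c1: "1 \<le> c" unfolding c_def by (rule one_le_power) simp
  let ?I = "(\<integral>\<^sup>+h. ennreal (riesz_kernel s h) * indicator {h. 2 * norm k \<le> norm h} h \<partial>(lborel::'a measure))"
  have J': "(\<integral>\<^sup>+h. ennreal (riesz_kernel s (k - h) * (modulus u (k - h))\<^sup>2) \<partial>lborel) = energy s u"
    unfolding energy_eq_modulus[OF u]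
    by (rule nn_integral_lborel_reflect[where f = "\<lambda>h. ennreal (riesz_kernel s h * (modulus u h)\<^sup>2)"]) measurable
  have "ennreal ((modulus u k)\<^sup>2) * ?I = (\<integral>\<^sup>+h. ennreal ((modulus u k)\<^sup>2) * (ennreal (riesz_kernel s h) * indicator {h. 2 * norm k \<le> norm h} h) \<partial>(lborel::'a measure))"
    by (rule nn_integral_cmult[symmetric]) auto
  also have "\<dots> \<le> (\<integral>\<^sup>+h. ennreal (2 * c) * ennreal (riesz_kernel s h * (modulus u h)\<^sup>2)
      + ennreal (2 * c) * ennreal (riesz_kernel s (k - h) * (modulus u (k - h))\<^sup>2) \<partial>lborel)"
  proof (rule nn_integral_mono)
    fix h :: 'a
    show "ennreal ((modulus u k)\<^sup>2) * (ennreal (riesz_kernel s h) * indicator {h. 2 * norm k \<le> norm h} h) \<le>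
      ennreal (2 * c) * ennreal (riesz_kernel s h * (modulus u h)\<^sup>2)
      + ennreal (2 * c) * ennreal (riesz_kernel s (k - h) * (modulus u (k - h))\<^sup>2)"
    proof (cases "2 * norm k \<le> norm h")
      case True
      have nk: "0 < norm k" using k by simp
      have n1: "norm (k - h) \<le> 3/2 * norm h" using norm_triangle_ineq4[of k h] True by simp
      have n2: "k - h \<noteq> 0" using True nk by auto
      have "norm h powr (- p) = (3/2) powr p * (3/2 * norm h) powr (- p)"
        unfolding powr_mult by (simp flip: powr_add mult.assoc)
      also have "\<dots> \<le> c * riesz_kernel s (k - h)"
        using cp c1 riesz_kernel_lower[OF n2 n1 s(1)] by (intro mult_mono) (auto simp: p_def)
      finally have rk: "riesz_kernel s h \<le> c * riesz_kernel s (k - h)"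
        by (simp add: riesz_kernel_def powr_minus_divide flip: p_def)
      have rk1: "riesz_kernel s h \<le> c * riesz_kernel s h" using mult_right_mono[OF c1, of "riesz_kernel s h"] by simp
      have "(modulus u k)\<^sup>2 * riesz_kernel s h \<le> (2 * (modulus u h)\<^sup>2 + 2 * (modulus u (k - h))\<^sup>2) * riesz_kernel s h"
        by (intro mult_right_mono modulus_sq_le u) auto
      also have "\<dots> = 2 * (modulus u h)\<^sup>2 * riesz_kernel s h + 2 * (modulus u (k - h))\<^sup>2 * riesz_kernel s h"
        by (simp add: algebra_simps)
      also have "\<dots> \<le> 2 * (modulus u h)\<^sup>2 * (c * riesz_kernel s h) + 2 * (modulus u (k - h))\<^sup>2 * (c * riesz_kernel s (k - h))"
        by (intro add_mono mult_left_mono rk rk1) auto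
      finally have "ennreal ((modulus u k)\<^sup>2 * riesz_kernel s h) \<le>
         ennreal (2 * c * (riesz_kernel s h * (modulus u h)\<^sup>2) + 2 * c * (riesz_kernel s (k - h) * (modulus u (k - h))\<^sup>2))"
        by (intro ennreal_leI) (simp add: mult_ac)
      then show ?thesis using True c1 by (simp add: ennreal_mult ennreal_plus)
    qed simp
  qed
  also have "\<dots> = ennreal (2 * c) * (\<integral>\<^sup>+h. ennreal (riesz_kernel s h * (modulus u h)\<^sup>2) \<partial>lborel)
      + ennreal (2 * c) * (\<integral>\<^sup>+h. ennreal (riesz_kernel s (k - h) * (modulus u (k - h))\<^sup>2) \<partial>lborel)"
    by (simp add: nn_integral_add nn_integral_cmult)
  also have "\<dots> = ennreal (2 * c) * energy s u + ennreal (2 * c) * energy s u"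
    by (simp only: J' energy_eq_modulus[OF u])
  also have "\<dots> = ennreal (4 * c) * energy s u"
    using c1 by (simp add: distrib_right[symmetric] ennreal_plus[symmetric] del: ennreal_plus)
  finally have 1: "ennreal ((modulus u k)\<^sup>2) * ?I \<le> ennreal (4 * c) * energy s u" .
  define a where "a = ?v / 2 ^ (?n + 3) * (2 * norm k) powr (- 2 * s) / s"
  have "ennreal (a * (modulus u k)\<^sup>2) \<le> ennreal ((modulus u k)\<^sup>2) * ?I"
    using riesz_kernel_tail_ge[where 'a='a, OF s, of "2 * norm k"] k s
    unfolding a_def[symmetric] by (subst mult.commute, subst ennreal_mult) (auto intro!: mult_left_mono simp: a_def)
  also note 1
  finally have "ennreal (1 / (4 * c)) * ennreal (a * (modulus u k)\<^sup>2) \<le> ennreal (1 / (4 * c)) * (ennreal (4 * c) * energy s u)"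
    by (intro mult_left_mono) auto
  also have "\<dots> = energy s u" using c1 by (simp add: mult.assoc[symmetric] ennreal_mult[symmetric])
  also have "ennreal (1 / (4 * c)) * ennreal (a * (modulus u k)\<^sup>2) = ennreal (1 / (4 * c) * (a * (modulus u k)\<^sup>2))"
    using c1 s by (subst ennreal_mult) (auto simp: a_def)
  finally have 2: "ennreal (1 / (4 * c) * (a * (modulus u k)\<^sup>2)) \<le> energy s u" .
  have "?v / 2 ^ (2 * ?n + 10) * norm k powr (- 2 * s) / s * (modulus u k)\<^sup>2 \<le> 1 / (4 * c) * (a * (modulus u k)\<^sup>2)"
  proof -
    have "1 / 4 = (2::real) powr (- 2)" by (simp add: powr_minus)
    also have "\<dots> \<le> 2 powr (- 2 * s)" using s by (intro powr_mono) auto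
    finally have "1 / 4 \<le> (2::real) powr (- 2 * s)" .
    then have "1/4 * norm k powr (- 2 * s) \<le> (2 * norm k) powr (- 2 * s)"
      unfolding powr_mult by (rule mult_right_mono) simp
    then have "?v / 2 ^ (2 * ?n + 7) * (1/4 * norm k powr (- 2 * s)) \<le> ?v / 2 ^ (2 * ?n + 7) * (2 * norm k) powr (- 2 * s)"
      by (intro mult_left_mono) auto
    also have "?v / 2 ^ (2 * ?n + 7) * (2 * norm k) powr (- 2 * s) = 1 / (4 * c) * (a * s)"
    proof -
      have "(2::real) ^ (2 * ?n + 7) = 2 ^ (2 + (?n + 2) + (?n + 3))" by (rule arg_cong) simp
      also have "\<dots> = 2 ^ 2 * 2 ^ (?n + 2) * 2 ^ (?n + 3)" by (simp only: power_add mult.assoc)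
      finally have "(2::real) ^ (2 * ?n + 7) = 4 * c * 2 ^ (?n + 3)" by (simp add: c_def)
      then show ?thesis using s by (simp add: a_def)
    qed
    finally have "?v / 2 ^ (2 * ?n + 7) * (1/4 * norm k powr (- 2 * s)) \<le> 1 / (4 * c) * (a * s)" .
    moreover have "?v / 2 ^ (2 * ?n + 10) * norm k powr (- 2 * s) \<le> ?v / 2 ^ (2 * ?n + 7) * (1/4 * norm k powr (- 2 * s))"
    proof -
      have "?v / 2 ^ (2 * ?n + 10) \<le> ?v / (2 ^ (2 * ?n + 7) * 4)"
        by (intro divide_left_mono) (auto simp: power_add)
      then have "?v / 2 ^ (2 * ?n + 10) * norm k powr (- 2 * s) \<le> ?v / (2 ^ (2 * ?n + 7) * 4) * norm k powr (- 2 * s)"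
        by (intro mult_right_mono) auto
      then show ?thesis by simp
    qed
    ultimately have "?v / 2 ^ (2 * ?n + 10) * norm k powr (- 2 * s) \<le> 1 / (4 * c) * (a * s)" by linarith
    then have "?v / 2 ^ (2 * ?n + 10) * norm k powr (- 2 * s) / s \<le> 1 / (4 * c) * a" using s by (simp add: field_simps)
    from mult_right_mono[OF this, of "(modulus u k)\<^sup>2"] show ?thesis by (simp add: mult.assoc)
  qed
  then show ?thesis using 2 ennreal_leI order_trans by blast
qed

text \<open>Splitting k into two parts of comparable length bounds the energy of one annulus from
  below. Subadditivity passes this to scales shorter by powers of 4 with ratio \<open>q\<close>, and
  1 - q is of order 1 - s, so the sum over the short scales gives 1/(1 - s).\<close>

lemma energy_near_bound:
  fixes u :: "'a::euclidean_space \<Rightarrow> real"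
  assumes u: "u \<in> L2_space lborel" and s: "0 < s" "s < 1" and k: "k \<noteq> 0"
  shows "ennreal (unit_ball_vol DIM('a) / 4 ^ (DIM('a) + 2) * norm k powr (- 2 * s) / (1 - s) * (modulus u k)\<^sup>2) \<le> energy s u"
proof -
  let ?n = "DIM('a)" let ?v = "unit_ball_vol (real DIM('a))"
  note [measurable] = borel_measurable_modulus[OF u]
  define p where "p = real ?n + 2 * s"
  define r where "r = norm k"
  have r: "0 < r" using k by (simp add: r_def)
  define F where "F h = ennreal (riesz_kernel s h * (modulus u h)\<^sup>2)" for h
  have [measurable]: "F \<in> borel_measurable borel" unfolding F_def by measurable
  define J where "J = (\<integral>\<^sup>+h. F h * indicator {h. norm h < r} h \<partial>lborel)"
  define q where "q = 4 powr (2 * s - 2)"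
  have q: "0 < q" "q < 1" "1 - q \<le> 4 * (1 - s)"
  proof -
    define x where "x = 4 powr (- (1 - s))"
    have x: "0 < x" "x < 1" "1 - x \<le> 2 * (1 - s)" using powr_4_bounds[of "1 - s"] s by (auto simp: x_def)
    have qx: "q = x * x" unfolding q_def x_def powr_add[symmetric] by (rule arg_cong) simp
    show "0 < q" "q < 1" using x qx by (auto simp: mult_less_cancel_left1 intro: mult_strict_mono[of x 1 x 1, simplified])
    have "1 - q = (1 + x) * (1 - x)" by (simp add: qx algebra_simps)
    also have "\<dots> \<le> 2 * (2 * (1 - s))" using x by (intro mult_mono) auto
    finally show "1 - q \<le> 4 * (1 - s)" by simp
  qed
  \<comment> \<open>Subadditivity over four steps gives a factor 16 for the squares under h -> h/4.
    The kernel together with the volume element gains \<open>4 powr (2 * s)\<close>, and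
    \<open>q\<close> is the quotient of the two.\<close>
  have scale: "ennreal q * J \<le> (\<integral>\<^sup>+h. F h * indicator {h. norm h < r / 4} h \<partial>lborel)"
  proof -
    have "ennreal q * J = (\<integral>\<^sup>+h. ennreal q * (F h * indicator {h. norm h < r} h) \<partial>lborel)"
      unfolding J_def by (rule nn_integral_cmult[symmetric]) auto
    also have "\<dots> \<le> (\<integral>\<^sup>+h. ennreal (\<bar>1/4\<bar> ^ ?n) * (F (0 + (1/4) *\<^sub>R h) * indicator {h. norm h < r / 4} (0 + (1/4) *\<^sub>R h)) \<partial>lborel)"
    proof (intro nn_integral_mono)
      fix h :: 'a
      have "modulus u h \<le> 4 * modulus u ((1/4) *\<^sub>R h)"
        using modulus_scale_le[OF u, of 4 "(1/4) *\<^sub>R h"] by simp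
      then have "(modulus u h)\<^sup>2 \<le> (4 * modulus u ((1/4) *\<^sub>R h))\<^sup>2" by (intro power_mono) auto
      then have m: "(modulus u h)\<^sup>2 \<le> 16 * (modulus u ((1/4) *\<^sub>R h))\<^sup>2" by (simp add: power_mult_distrib)
      have rk: "riesz_kernel s ((1/4) *\<^sub>R h) = riesz_kernel s h * (4 ^ ?n * 4 powr (2 * s))"
        by (subst riesz_kernel_scale) (auto simp: powr_divide power_one_over field_simps)
      have q16: "q * 16 = 4 powr (2 * s)"
      proof -
        have "(16::real) = 4 powr 2" by simp
        then have "q * 16 = 4 powr (2 * s - 2 + 2)" unfolding q_def powr_add by simp
        then show ?thesis by simp
      qed
      have "q * (riesz_kernel s h * (modulus u h)\<^sup>2) \<le> q * (riesz_kernel s h * (16 * (modulus u ((1/4) *\<^sub>R h))\<^sup>2))"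
        using q m by (intro mult_left_mono) auto
      also have "\<dots> = (1/4) ^ ?n * (riesz_kernel s ((1/4) *\<^sub>R h) * (modulus u ((1/4) *\<^sub>R h))\<^sup>2)"
        unfolding rk q16[symmetric] by (simp add: power_one_over field_simps)
      finally have "ennreal q * F h \<le> ennreal ((1/4) ^ ?n) * F ((1/4) *\<^sub>R h)"
        unfolding F_def using q by (simp add: ennreal_mult[symmetric] ennreal_leI)
      then show "ennreal q * (F h * indicator {h. norm h < r} h) \<le>
        ennreal (\<bar>1/4\<bar> ^ ?n) * (F (0 + (1/4) *\<^sub>R h) * indicator {h. norm h < r / 4} (0 + (1/4) *\<^sub>R h))"
        by (auto split: split_indicator)
    qed
    also have "\<dots> = ennreal (\<bar>1/4\<bar> ^ ?n) * (\<integral>\<^sup>+h. F (0 + (1/4) *\<^sub>R h) * indicator {h. norm h < r / 4} (0 + (1/4) *\<^sub>R h) \<partial>lborel)"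
      by (rule nn_integral_cmult) measurable
    also have "\<dots> = (\<integral>\<^sup>+h. F h * indicator {h. norm h < r / 4} h \<partial>lborel)"
      by (rule nn_integral_lborel_affine[symmetric]) auto
    finally show ?thesis .
  qed
  define A where "A = ?v / 4 ^ (?n + 1) * r powr (- 2 * s) * (modulus u k)\<^sup>2"
  \<comment> \<open>This ball is invariant under h -> k - h, so both terms of the triangle
    inequality integrate to the same value; its points have norms between r/4 and 3r/4.\<close>
  let ?B = "cball ((1/2) *\<^sub>R k) (r / 4)"
  have A: "ennreal A \<le> (\<integral>\<^sup>+h. F h * indicator {h. r / 4 \<le> norm h \<and> norm h < r} h \<partial>lborel)"
  proof -
    define M where "M h = ennreal ((modulus u h)\<^sup>2) * indicator ?B h" for h
    have [measurable]: "M \<in> borel_measurable borel" unfolding M_def by (intro borel_measurable_times_ennreal borel_measurable_indicator) auto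
    have sym: "k - h \<in> ?B \<longleftrightarrow> h \<in> ?B" for h
    proof -
      define a where "a = (1/2) *\<^sub>R k"
      have "k = a + a" unfolding a_def by (simp flip: scaleR_add_left)
      moreover have "a + a - h - a = - (h - a)" by simp
      ultimately have "k - h - (1/2) *\<^sub>R k = - (h - (1/2) *\<^sub>R k)" unfolding a_def[symmetric] by metis
      then show ?thesis by (metis dist_norm mem_cball norm_minus_cancel norm_minus_commute)
    qed
    have vol: "emeasure lborel ?B = ennreal (?v * (r / 4) ^ ?n)" using r by (simp add: emeasure_cball)
    have "ennreal ((modulus u k)\<^sup>2) * ennreal (?v * (r / 4) ^ ?n) = (\<integral>\<^sup>+h. ennreal ((modulus u k)\<^sup>2) * indicator ?B h \<partial>lborel)"
      by (subst nn_integral_cmult_indicator) (auto simp: vol)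
    also have "\<dots> \<le> (\<integral>\<^sup>+h. 2 * M h + 2 * M (k - h) \<partial>lborel)"
    proof (rule nn_integral_mono)
      fix h
      have "ennreal ((modulus u k)\<^sup>2) \<le> ennreal (2 * (modulus u h)\<^sup>2 + 2 * (modulus u (k - h))\<^sup>2)"
        by (intro ennreal_leI modulus_sq_le u)
      also have "\<dots> = 2 * ennreal ((modulus u h)\<^sup>2) + 2 * ennreal ((modulus u (k - h))\<^sup>2)"
        by (simp add: ennreal_plus ennreal_mult)
      finally show "ennreal ((modulus u k)\<^sup>2) * indicator ?B h \<le> 2 * M h + 2 * M (k - h)"
        using sym[of h] unfolding M_def by (auto split: split_indicator)
    qed
    also have "\<dots> = 2 * (\<integral>\<^sup>+h. M h \<partial>lborel) + 2 * (\<integral>\<^sup>+h. M (k - h) \<partial>lborel)"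
      by (simp add: nn_integral_add nn_integral_cmult)
    also have "(\<integral>\<^sup>+h. M (k - h) \<partial>lborel) = (\<integral>\<^sup>+h. M h \<partial>lborel)"
      by (rule nn_integral_lborel_reflect) measurable
    also have "2 * (\<integral>\<^sup>+h. M h \<partial>lborel) + 2 * (\<integral>\<^sup>+h. M h \<partial>lborel) = 4 * (\<integral>\<^sup>+h. M h \<partial>lborel)"
      by (simp add: distrib_right[symmetric])
    finally have 1: "ennreal ((modulus u k)\<^sup>2) * ennreal (?v * (r / 4) ^ ?n) \<le> 4 * (\<integral>\<^sup>+h. M h \<partial>lborel)" .
    have "4 * ennreal A = ennreal (r powr (- p)) * (ennreal ((modulus u k)\<^sup>2) * ennreal (?v * (r / 4) ^ ?n))"
    proof -
      have "4 * A = r powr (- p) * ((modulus u k)\<^sup>2 * (?v * (r / 4) ^ ?n))"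
      proof -
        have "r powr (- 2 * s) = r powr (- p) * r powr (real ?n)" unfolding powr_add[symmetric] by (simp add: p_def)
        then show ?thesis using r by (simp add: A_def powr_realpow power_divide)
      qed
      moreover have "4 * ennreal A = ennreal (4 * A)" by (subst ennreal_mult) (auto simp: A_def)
      ultimately show ?thesis using r by (simp add: ennreal_mult)
    qed
    also have "\<dots> \<le> ennreal (r powr (- p)) * (4 * (\<integral>\<^sup>+h. M h \<partial>lborel))" by (intro mult_left_mono 1) auto
    also have "\<dots> = 4 * (\<integral>\<^sup>+h. ennreal (r powr (- p)) * M h \<partial>lborel)"
      by (subst nn_integral_cmult) (auto simp: mult_ac)
    also have "4 * (\<integral>\<^sup>+h. ennreal (r powr (- p)) * M h \<partial>lborel) \<le> 4 * (\<integral>\<^sup>+h. F h * indicator {h. r / 4 \<le> norm h \<and> norm h < r} h \<partial>lborel)"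
    proof (intro mult_left_mono nn_integral_mono)
      fix h
      show "ennreal (r powr (- p)) * M h \<le> F h * indicator {h. r / 4 \<le> norm h \<and> norm h < r} h"
      proof (cases "h \<in> ?B")
        case True
        have nk: "norm ((1/2) *\<^sub>R k) = r / 2" by (simp add: r_def)
        have d: "norm ((1/2) *\<^sub>R k - h) \<le> r / 4" using True by (simp add: dist_norm)
        have 1: "norm h \<le> 3/4 * r" using norm_triangle_ineq4[of "(1/2) *\<^sub>R k" "(1/2) *\<^sub>R k - h"] nk d by simp
        have 2: "r / 4 \<le> norm h" using norm_triangle_ineq[of "(1/2) *\<^sub>R k - h" h] nk d by simp
        have "h \<noteq> 0" using 2 r by auto
        then have "r powr (- p) \<le> riesz_kernel s h" unfolding p_def using 1 r s by (intro riesz_kernel_lower) auto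
        then have "r powr (- p) * (modulus u h)\<^sup>2 \<le> riesz_kernel s h * (modulus u h)\<^sup>2" by (intro mult_right_mono) auto
        then have "ennreal (r powr (- p)) * ennreal ((modulus u h)\<^sup>2) \<le> F h" unfolding F_def
          by (simp add: ennreal_mult[symmetric] ennreal_leI)
        then show ?thesis using True 1 2 r by (auto simp: M_def)
      qed (simp add: M_def)
    qed simp
    finally have "4 * ennreal A \<le> 4 * (\<integral>\<^sup>+h. F h * indicator {h. r / 4 \<le> norm h \<and> norm h < r} h \<partial>lborel)" .
    then show ?thesis by (subst (asm) ennreal_mult_le_mult_iff) auto
  qed
  have "J = (\<integral>\<^sup>+h. F h * indicator {h. r / 4 \<le> norm h \<and> norm h < r} h + F h * indicator {h. norm h < r / 4} h \<partial>lborel)"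
    unfolding J_def using r by (intro nn_integral_cong) (auto split: split_indicator)
  also have "\<dots> = (\<integral>\<^sup>+h. F h * indicator {h. r / 4 \<le> norm h \<and> norm h < r} h \<partial>lborel) + (\<integral>\<^sup>+h. F h * indicator {h. norm h < r / 4} h \<partial>lborel)"
    by (rule nn_integral_add) auto
  finally have J_eq: "J = (\<integral>\<^sup>+h. F h * indicator {h. r / 4 \<le> norm h \<and> norm h < r} h \<partial>lborel) + (\<integral>\<^sup>+h. F h * indicator {h. norm h < r / 4} h \<partial>lborel)" .
  have "ennreal A + ennreal q * J \<le> J" by (subst (2) J_eq) (rule add_mono[OF A scale])
  then have "ennreal (A / (1 - q)) \<le> J"
    using q by (intro ennreal_geometric_lower_bound) (auto simp: A_def)
  also have "J \<le> energy s u"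
    unfolding J_def energy_eq_modulus[OF u] F_def by (intro nn_integral_mono) (auto split: split_indicator)
  finally have 1: "ennreal (A / (1 - q)) \<le> energy s u" .
  have "?v / 4 ^ (?n + 2) * norm k powr (- 2 * s) / (1 - s) * (modulus u k)\<^sup>2 = A / (4 * (1 - s))"
    by (simp add: A_def r_def)
  also have "\<dots> \<le> A / (1 - q)" using q s by (intro divide_left_mono) (auto simp: A_def)
  finally show ?thesis using 1 ennreal_leI order_trans by blast
qed

text \<open>
  The constant stays bounded as \<open>s\<close> tends to \<open>0\<close> or \<open>1\<close>: the factor \<open>s\<close> comes from
  translations much longer than \<open>k\<close>, the factor \<open>1 - s\<close> from those much shorter than \<open>k\<close>.
\<close>

lemma modulus_le_energy:
  "\<exists>C>0. \<forall>s (u::'a::euclidean_space \<Rightarrow> real) k. 0 < s \<longrightarrow> s < 1 \<longrightarrow> u \<in> L2_space lborel \<longrightarrow>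
     ennreal ((modulus u k)\<^sup>2) \<le> ennreal (C * norm k powr (2 * s) * (s * (1 - s))) * energy s u"
proof -
  let ?v = "unit_ball_vol (real DIM('a))"
  define c where "c = min (?v / 2 ^ (2 * DIM('a) + 10)) (?v / 4 ^ (DIM('a) + 2))"
  have c: "0 < c" by (simp add: c_def)
  show ?thesis
  proof (intro exI[of _ "2 / c"] conjI allI impI)
    show "0 < 2 / c" using c by simp
    fix s :: real and u :: "'a \<Rightarrow> real" and k :: 'a
    assume s: "0 < s" "s < 1" and u: "u \<in> L2_space lborel"
    show "ennreal ((modulus u k)\<^sup>2) \<le> ennreal (2 / c * norm k powr (2 * s) * (s * (1 - s))) * energy s u"
    proof (cases "k = 0")
      case True
      then show ?thesis by (simp add: modulus_def L2_norm_def)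
    next
      case False
      define m where "m = (modulus u k)\<^sup>2"
      define B where "B = norm k powr (2 * s)"
      have B: "0 < B" using False by (simp add: B_def)
      have nB: "norm k powr (- 2 * s) = 1 / B" by (simp add: B_def powr_minus_divide)
      have le: "ennreal (c * (1 / B) / min s (1 - s) * m) \<le> energy s u"
      proof (cases "s \<le> 1 - s")
        case True
        have "c * (1 / B) / min s (1 - s) * m \<le> ?v / 2 ^ (2 * DIM('a) + 10) * (1 / B) / s * m"
          unfolding min_absorb1[OF True]
          by (intro mult_right_mono divide_right_mono) (use s B in \<open>auto simp: c_def m_def\<close>)
        then show ?thesis using energy_far_bound[OF u s False] unfolding nB m_def[symmetric]
          using ennreal_leI order_trans by blast
      next
        case False': False
        have "c * (1 / B) / min s (1 - s) * m \<le> ?v / 4 ^ (DIM('a) + 2) * (1 / B) / (1 - s) * m"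
          unfolding min_absorb2[OF less_imp_le[OF not_le_imp_less[OF False']]]
          by (intro mult_right_mono divide_right_mono) (use s B in \<open>auto simp: c_def m_def\<close>)
        then show ?thesis using energy_near_bound[OF u s False] unfolding nB m_def[symmetric]
          using ennreal_leI order_trans by blast
      qed
      \<comment> \<open>The two bounds above give the smaller of \<open>s\<close> and
        \<open>1 - s\<close>. It is comparable to the product, because the larger of them is at
        least 1/2.\<close>
      have mn: "0 < min s (1 - s)" "min s (1 - s) \<le> 2 * (s * (1 - s))"
      proof -
        show "0 < min s (1 - s)" using s by simp
        show "min s (1 - s) \<le> 2 * (s * (1 - s))"
        proof (cases "s \<le> 1/2")
          case True
          then have "s * 1 \<le> s * (2 * (1 - s))" using s by (intro mult_left_mono) auto
          then show ?thesis by (intro order_trans[OF min.cobounded1]) (simp add: algebra_simps)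
        next
          case False
          then have "(1 - s) * 1 \<le> (1 - s) * (2 * s)" using s by (intro mult_left_mono) auto
          then show ?thesis by (intro order_trans[OF min.cobounded2]) (simp add: algebra_simps)
        qed
      qed
      let ?K = "min s (1 - s) * B / c"
      have "ennreal m = ennreal ?K * ennreal (c * (1 / B) / min s (1 - s) * m)"
      proof -
        have "m = x * B / c * (c * (1 / B) / x * m)" if "0 < x" for x
          using that B c by (simp add: field_simps)
        from this[OF mn(1)] have e: "?K * (c * (1 / B) / min s (1 - s) * m) = m" by (rule sym)
        have "0 \<le> ?K" "0 \<le> c * (1 / B) / min s (1 - s) * m"
          using mn(1) B c by (auto simp: m_def intro!: mult_nonneg_nonneg divide_nonneg_nonneg)
        from ennreal_mult[OF this] show ?thesis unfolding e .
      qed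
      also have "\<dots> \<le> ennreal ?K * energy s u" by (intro mult_left_mono le) auto
      also have "\<dots> \<le> ennreal (2 / c * B * (s * (1 - s))) * energy s u"
      proof (intro mult_right_mono ennreal_leI)
        have "?K \<le> (2 * (s * (1 - s))) * B / c" using mn c B by (intro divide_right_mono mult_right_mono) auto
        then show "?K \<le> 2 / c * B * (s * (1 - s))" by (simp add: mult_ac)
      qed simp
      finally show ?thesis unfolding m_def B_def .
    qed
  qed
qed

text \<open>The pole of \<open>Gamma (1 - s)\<close> at s = 1 is split off by
  \<open>Gamma (2 - s) = (1 - s) * Gamma (1 - s)\<close>. What remains, \<open>g\<close>, is
  continuous and positive on the closed interval from 0 to 1, so compactness bounds it from both
  sides.\<close>

lemma frac_const_bounds:
  assumes n: "0 < n"
  shows "\<exists>c>0. \<exists>C>0. \<forall>s. 0 < s \<longrightarrow> s < 1 \<longrightarrow>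
    c * (s * (1 - s)) \<le> frac_const n s / 2 \<and> frac_const n s / 2 \<le> C * (s * (1 - s))"
proof -
  define g where "g s = 2 powr (2 * s) * Gamma (s + real n / 2) / (2 * (pi powr (real n / 2) * Gamma (2 - s)))" for s
  have pos: "0 < g s" if "s \<in> {0..1}" for s :: real
    unfolding g_def using that n by (intro divide_pos_pos mult_pos_pos Gamma_real_pos) auto
  have cont: "continuous_on {0..1} g"
  proof -
    have "s + real n / 2 \<notin> \<int>\<^sub>\<le>\<^sub>0" "2 - s \<notin> \<int>\<^sub>\<le>\<^sub>0" if "s \<in> {0..1}" for s :: real
      using that n by (auto elim!: nonpos_Ints_cases')
    moreover have "Gamma (2 - s) \<noteq> 0" if "s \<in> {0..1}" for s :: real
      using Gamma_real_pos[of "2 - s"] that by fastforce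
    ultimately show ?thesis unfolding g_def
      by (intro continuous_at_imp_continuous_on ballI) (intro continuous_intros; auto)
  qed
  obtain a where a: "a \<in> {0..1}" "\<And>s. s \<in> {0..1} \<Longrightarrow> g a \<le> g s"
    using continuous_attains_inf[OF _ _ cont] by auto
  obtain b where b: "b \<in> {0..1}" "\<And>s. s \<in> {0..1} \<Longrightarrow> g s \<le> g b"
    using continuous_attains_sup[OF _ _ cont] by auto
  have eq: "frac_const n s / 2 = g s * (s * (1 - s))" if s: "0 < s" "s < 1" for s
  proof -
    have "1 - s \<notin> \<int>\<^sub>\<le>\<^sub>0" using s by (auto elim!: nonpos_Ints_cases')
    then have G2: "Gamma (2 - s) = (1 - s) * Gamma (1 - s)" using Gamma_plus1[of "1 - s"] by simp
    have "Gamma (1 - s) \<noteq> 0" "1 - s \<noteq> 0" using s Gamma_real_pos[of "1 - s"] by fastforce+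
    then show ?thesis unfolding frac_const_def g_def G2 by (simp add: divide_simps)
  qed
  show ?thesis
  proof (intro exI conjI allI impI)
    show "0 < g a" "0 < g b" by (rule pos[OF a(1)], rule pos[OF b(1)])
    fix s :: real assume s: "0 < s" "s < 1"
    show "g a * (s * (1 - s)) \<le> frac_const n s / 2" "frac_const n s / 2 \<le> g b * (s * (1 - s))"
      unfolding eq[OF s] using s a(2)[of s] b(2)[of s] by (auto intro!: mult_right_mono)
  qed
qed

text \<open>A translation by 2R + 1 moves the ball of radius \<open>R\<close> off itself, so at
  every point one of the two terms of the first difference vanishes and its norm dominates that of
  \<open>u\<close>.\<close>

lemma poincare_inequality:
  assumes R: "0 \<le> R"
  shows "\<exists>C>0. \<forall>s (u::'a::euclidean_space \<Rightarrow> real). 0 < s \<longrightarrow> s < 1 \<longrightarrow> u \<in> L2_space lborel \<longrightarrow>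
     (\<forall>x. R < norm x \<longrightarrow> u x = 0) \<longrightarrow>
     ennreal ((L2_norm lborel u)\<^sup>2) \<le> ennreal (C * (s * (1 - s))) * energy s u"
proof -
  obtain C0 where C0: "C0 > 0" and le: "\<And>s (u::'a \<Rightarrow> real) k. 0 < s \<Longrightarrow> s < 1 \<Longrightarrow> u \<in> L2_space lborel \<Longrightarrow>
     ennreal ((modulus u k)\<^sup>2) \<le> ennreal (C0 * norm k powr (2 * s) * (s * (1 - s))) * energy s u"
    using modulus_le_energy[where 'a='a] by blast
  obtain b :: 'a where b: "b \<in> Basis" by (meson nonempty_Basis equals0I)
  define \<rho> where "\<rho> = 2 * R + 1"
  have \<rho>: "1 \<le> \<rho>" using R by (simp add: \<rho>_def)
  define k where "k = \<rho> *\<^sub>R b"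
  have nk: "norm k = \<rho>" using \<rho> b by (simp add: k_def)
  show ?thesis
  proof (intro exI[of _ "C0 * \<rho>\<^sup>2"] conjI allI impI)
    show "0 < C0 * \<rho>\<^sup>2" using C0 \<rho> by simp
    fix s :: real and u :: "'a \<Rightarrow> real"
    assume s: "0 < s" "s < 1" and u: "u \<in> L2_space lborel" and z: "\<forall>x. R < norm x \<longrightarrow> u x = 0"
    have "L2_norm lborel u \<le> modulus u k"
      unfolding modulus_def
    proof (rule L2_norm_mono)
      show "(\<lambda>x. u (x + k) - u x) \<in> L2_space lborel" by (intro L2_space_diff L2_space_translate u)
      fix x :: 'a
      show "\<bar>u x\<bar> \<le> \<bar>u (x + k) - u x\<bar>"
      proof (cases "R < norm x")
        case False
        then have "R < norm (x + k)"
          using norm_triangle_ineq4[of "x + k" x] nk R by (simp add: \<rho>_def)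
        then show ?thesis using z by simp
      qed (use z in simp)
    qed
    then have "(L2_norm lborel u)\<^sup>2 \<le> (modulus u k)\<^sup>2" by (intro power_mono) auto
    then have "ennreal ((L2_norm lborel u)\<^sup>2) \<le> ennreal ((modulus u k)\<^sup>2)" by (rule ennreal_leI)
    also have "\<dots> \<le> ennreal (C0 * norm k powr (2 * s) * (s * (1 - s))) * energy s u" by (rule le[OF s u])
    also have "\<dots> \<le> ennreal (C0 * \<rho>\<^sup>2 * (s * (1 - s))) * energy s u"
    proof (intro mult_right_mono ennreal_leI mult_left_mono)
      have "norm k powr (2 * s) \<le> \<rho> powr 2" unfolding nk using \<rho> s by (intro powr_mono) auto
      then show "norm k powr (2 * s) \<le> \<rho>\<^sup>2" using \<rho> by simp
    qed (use C0 s in auto)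
    finally show "ennreal ((L2_norm lborel u)\<^sup>2) \<le> ennreal (C0 * \<rho>\<^sup>2 * (s * (1 - s))) * energy s u" .
  qed
qed

section \<open>Energies of multiples, differences and localized translates\<close>

lemma energy_cmult:
  fixes u :: "'a::euclidean_space \<Rightarrow> real"
  assumes u: "u \<in> L2_space lborel"
  shows "energy s (\<lambda>x. c * u x) = ennreal (c\<^sup>2) * energy s u"
proof -
  note [measurable] = borel_measurable_modulus[OF u]
  have "modulus (\<lambda>x. c * u x) h = \<bar>c\<bar> * modulus u h" for h
    unfolding modulus_def using L2_norm_cmult[of lborel c "\<lambda>x. u (x + h) - u x"]
    by (simp add: right_diff_distrib)
  then have "energy s (\<lambda>x. c * u x) = (\<integral>\<^sup>+h. ennreal (c\<^sup>2) * ennreal (riesz_kernel s h * (modulus u h)\<^sup>2) \<partial>lborel)"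
    unfolding energy_eq_modulus[OF L2_space_cmult[OF u]]
    by (intro nn_integral_cong) (simp add: power_mult_distrib mult_ac flip: ennreal_mult)
  then show ?thesis unfolding energy_eq_modulus[OF u] by (simp add: nn_integral_cmult)
qed

lemma energy_diff_le:
  fixes f g :: "'a::euclidean_space \<Rightarrow> real"
  assumes f: "f \<in> L2_space lborel" and g: "g \<in> L2_space lborel"
  shows "energy s (\<lambda>x. f x - g x) \<le> 2 * energy s f + 2 * energy s g"
proof -
  note [measurable] = borel_measurable_modulus[OF f] borel_measurable_modulus[OF g]
  have m: "(modulus (\<lambda>x. f x - g x) h)\<^sup>2 \<le> 2 * (modulus f h)\<^sup>2 + 2 * (modulus g h)\<^sup>2" for h
  proof -
    have "(\<lambda>x. f (x + h) - g (x + h) - (f x - g x)) = (\<lambda>x. (f (x + h) - f x) - (g (x + h) - g x))" by auto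
    then have "modulus (\<lambda>x. f x - g x) h \<le> modulus f h + modulus g h"
      unfolding modulus_def by (simp only:) (intro L2_norm_triangle_diff L2_space_diff L2_space_translate f g)
    then have "(modulus (\<lambda>x. f x - g x) h)\<^sup>2 \<le> (modulus f h + modulus g h)\<^sup>2" by (intro power_mono) auto
    also have "\<dots> \<le> 2 * (modulus f h)\<^sup>2 + 2 * (modulus g h)\<^sup>2"
      using zero_le_power2[of "modulus f h - modulus g h"] by (simp add: power2_sum power2_diff)
    finally show ?thesis .
  qed
  have "energy s (\<lambda>x. f x - g x) \<le> (\<integral>\<^sup>+h. 2 * ennreal (riesz_kernel s h * (modulus f h)\<^sup>2) + 2 * ennreal (riesz_kernel s h * (modulus g h)\<^sup>2) \<partial>lborel)"
    unfolding energy_eq_modulus[OF L2_space_diff[OF f g]]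
  proof (rule nn_integral_mono)
    fix h :: 'a
    have "riesz_kernel s h * (modulus (\<lambda>x. f x - g x) h)\<^sup>2 \<le> riesz_kernel s h * (2 * (modulus f h)\<^sup>2 + 2 * (modulus g h)\<^sup>2)"
      by (intro mult_left_mono m) auto
    then have "ennreal (riesz_kernel s h * (modulus (\<lambda>x. f x - g x) h)\<^sup>2) \<le>
        ennreal (2 * (riesz_kernel s h * (modulus f h)\<^sup>2) + 2 * (riesz_kernel s h * (modulus g h)\<^sup>2))"
      by (intro ennreal_leI) (simp add: algebra_simps)
    then show "ennreal (riesz_kernel s h * (modulus (\<lambda>x. f x - g x) h)\<^sup>2) \<le>
        2 * ennreal (riesz_kernel s h * (modulus f h)\<^sup>2) + 2 * ennreal (riesz_kernel s h * (modulus g h)\<^sup>2)"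
      by (simp add: ennreal_plus ennreal_mult)
  qed
  then show ?thesis unfolding energy_eq_modulus[OF f] energy_eq_modulus[OF g]
    by (simp add: nn_integral_add nn_integral_cmult)
qed

text \<open>With \<open>1 \<le> L\<close> the trivial bound 1 on the oscillation of
  \<open>\<phi>\<close> is also at most \<open>L\<close>, so both bounds combine to the single
  weight \<open>L\<^sup>2 * min 1 ((norm z)\<^sup>2)\<close>.\<close>

definition cutoff :: "real \<Rightarrow> ('a::euclidean_space \<Rightarrow> real) \<Rightarrow> bool" where
  "cutoff L \<phi> \<longleftrightarrow> 1 \<le> L \<and> (\<forall>x. 0 \<le> \<phi> x \<and> \<phi> x \<le> 1) \<and> (\<forall>x y. \<bar>\<phi> x - \<phi> y\<bar> \<le> L * norm (x - y))"

lemma cutoffD: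
  assumes "cutoff L \<phi>"
  shows "1 \<le> L" "0 \<le> \<phi> x" "\<phi> x \<le> 1" "\<bar>\<phi> x - \<phi> y\<bar> \<le> L * norm (x - y)"
  using assms by (auto simp: cutoff_def)

lemma cutoff_borel_measurable:
  assumes "cutoff L \<phi>"
  shows "\<phi> \<in> borel_measurable borel"
proof -
  have "L-lipschitz_on UNIV \<phi>"
    using cutoffD[OF assms] by (intro lipschitz_onI) (auto simp: dist_norm)
  then show ?thesis
    using lipschitz_on_continuous_on borel_measurable_continuous_onI by blast
qed

text \<open>Young's inequality with a free parameter: the coefficient of the first square can be
  brought close to 1, which matters because the two large energies must later cancel.\<close>

lemma power2_add_le_weighted:
  fixes a b t :: real
  assumes "0 < t"
  shows "(a + b)\<^sup>2 \<le> (1 + t) * a\<^sup>2 + (1 + 1 / t) * b\<^sup>2"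
proof -
  have "0 \<le> (t * a - b)\<^sup>2 / t" using assms by simp
  also have "\<dots> = t * a\<^sup>2 - 2 * a * b + b\<^sup>2 / t" using assms by (simp add: power2_diff field_simps power2_eq_square)
  finally show ?thesis by (simp add: power2_sum algebra_simps)
qed

lemma convex_power2_le:
  fixes a b t :: real
  assumes "0 \<le> t" "t \<le> 1"
  shows "(t * a + (1 - t) * b)\<^sup>2 \<le> t * a\<^sup>2 + (1 - t) * b\<^sup>2"
proof -
  have "t * a\<^sup>2 + (1 - t) * b\<^sup>2 - (t * a + (1 - t) * b)\<^sup>2 = t * (1 - t) * (a - b)\<^sup>2"
    by (simp add: power2_eq_square algebra_simps)
  then show ?thesis using assms by (smt (verit) mult_nonneg_nonneg zero_le_power2)
qed

lemma L2_space_localized_translate: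
  assumes u: "u \<in> L2_space lborel" and \<phi>: "cutoff L \<phi>"
  shows "(\<lambda>x. \<phi> x * (u (x + h) - u x)) \<in> L2_space lborel"
    and "(\<lambda>x. \<phi> x * u (x + h) + (1 - \<phi> x) * u x) \<in> L2_space lborel"
proof -
  note [measurable] = cutoff_borel_measurable[OF \<phi>]
  have [measurable]: "u \<in> borel_measurable borel" using u by (auto simp: L2_space_def)
  have d: "(\<lambda>x. u (x + h) - u x) \<in> L2_space lborel" by (intro L2_space_diff L2_space_translate u)
  show 1: "(\<lambda>x. \<phi> x * (u (x + h) - u x)) \<in> L2_space lborel"
    by (rule L2_space_mono[OF d]) (use cutoffD[OF \<phi>] in \<open>auto simp: abs_mult intro!: mult_left_le_one_le\<close>)
  show "(\<lambda>x. \<phi> x * u (x + h) + (1 - \<phi> x) * u x) \<in> L2_space lborel"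
    using L2_space_add[OF 1 u] by (simp add: algebra_simps)
qed

text \<open>The difference of the localized translate is a convex combination of differences of
  \<open>u\<close> at x + h and at x, plus the commutator (\<phi>(x + z) - \<phi>(x)) (u(x + z + h)
  - u(x + z)). Convexity of the square treats the first part without loss, the Lipschitz bound the
  second.\<close>

lemma modulus_localized_translate:
  fixes u \<phi> :: "'a::euclidean_space \<Rightarrow> real"
  assumes u: "u \<in> L2_space lborel" and \<phi>: "cutoff L \<phi>" and t: "0 < t"
  shows "(modulus (\<lambda>x. \<phi> x * u (x + h) + (1 - \<phi> x) * u x) z)\<^sup>2 \<le>
    (1 + t) * (1 + L * norm h) * (modulus u z)\<^sup>2 + (1 + 1 / t) * L\<^sup>2 * min 1 ((norm z)\<^sup>2) * (modulus u h)\<^sup>2"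
proof -
  note [measurable] = cutoff_borel_measurable[OF \<phi>]
  note c = cutoffD[OF \<phi>]
  have [measurable]: "u \<in> borel_measurable borel" using u by (auto simp: L2_space_def)
  define T where "T = (\<lambda>x. \<phi> x * u (x + h) + (1 - \<phi> x) * u x)"
  define B where "B x = u (x + z) - u x" for x
  define D where "D x = u (x + h) - u x" for x
  define m where "m = L\<^sup>2 * min 1 ((norm z)\<^sup>2)"
  have [measurable]: "B \<in> borel_measurable borel" unfolding B_def[abs_def] by measurable
  have B: "B \<in> L2_space lborel" and D: "D \<in> L2_space lborel"
    unfolding B_def[abs_def] D_def[abs_def] by (intro L2_space_diff L2_space_translate u)+
  have T: "T \<in> L2_space lborel" unfolding T_def by (rule L2_space_localized_translate[OF u \<phi>])
  have iB: "integrable lborel (\<lambda>x. (B x)\<^sup>2)" by (rule L2_spaceD(2)[OF B])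
  have iBh: "integrable lborel (\<lambda>x. (B (x + h))\<^sup>2)" by (rule integrable_lborel_translate[OF iB])
  have iDz: "integrable lborel (\<lambda>x. (D (x + z))\<^sup>2)" by (rule integrable_lborel_translate[OF L2_spaceD(2)[OF D]])
  have bnd: "integrable lborel (\<lambda>x. \<psi> x * g x)"
    if "\<psi> \<in> borel_measurable borel" "\<And>x. 0 \<le> \<psi> x \<and> \<psi> x \<le> 1" "integrable lborel g" for \<psi> g :: "'a \<Rightarrow> real"
    by (rule Bochner_Integration.integrable_bound[OF that(3)])
       (use that in \<open>auto simp: abs_mult intro!: mult_left_le_one_le\<close>)
  have i1: "integrable lborel (\<lambda>x. \<phi> x * (B (x + h))\<^sup>2)" using c by (intro bnd iBh) auto
  have i2: "integrable lborel (\<lambda>x. (1 - \<phi> x) * (B x)\<^sup>2)" using c by (intro bnd iB) auto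
  have i3: "integrable lborel (\<lambda>x. \<phi> (x - h) * (B x)\<^sup>2)" using c by (intro bnd iB) auto
  have pt: "(T (x + z) - T x)\<^sup>2 \<le> (1 + t) * (\<phi> x * (B (x + h))\<^sup>2 + (1 - \<phi> x) * (B x)\<^sup>2) + (1 + 1 / t) * m * (D (x + z))\<^sup>2" for x
  proof -
    have "T (x + z) - T x = (\<phi> x * B (x + h) + (1 - \<phi> x) * B x) + (\<phi> (x + z) - \<phi> x) * D (x + z)"
      by (simp add: T_def B_def D_def algebra_simps)
    then have "(T (x + z) - T x)\<^sup>2 \<le> (1 + t) * (\<phi> x * B (x + h) + (1 - \<phi> x) * B x)\<^sup>2 + (1 + 1 / t) * ((\<phi> (x + z) - \<phi> x) * D (x + z))\<^sup>2"
      using power2_add_le_weighted[OF t] by simp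
    also have "\<dots> \<le> (1 + t) * (\<phi> x * (B (x + h))\<^sup>2 + (1 - \<phi> x) * (B x)\<^sup>2) + (1 + 1 / t) * (m * (D (x + z))\<^sup>2)"
    proof (intro add_mono mult_left_mono convex_power2_le)
      have "\<bar>\<phi> (x + z) - \<phi> x\<bar> \<le> L * 1" "\<bar>\<phi> (x + z) - \<phi> x\<bar> \<le> L * norm z"
        using c(1) c(2,3)[of x] c(2,3)[of "x + z"] c(4)[of "x + z" x] by (auto simp: abs_if)
      then have "(\<phi> (x + z) - \<phi> x)\<^sup>2 \<le> (L * 1)\<^sup>2" "(\<phi> (x + z) - \<phi> x)\<^sup>2 \<le> (L * norm z)\<^sup>2"
        using c(1) by (simp_all only: abs_le_square_iff[symmetric])
      then have "(\<phi> (x + z) - \<phi> x)\<^sup>2 \<le> m" by (auto simp: m_def power_mult_distrib min_def)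
      then show "((\<phi> (x + z) - \<phi> x) * D (x + z))\<^sup>2 \<le> m * (D (x + z))\<^sup>2"
        unfolding power_mult_distrib by (intro mult_right_mono) auto
    qed (use c t in auto)
    finally show ?thesis by (simp add: mult.assoc)
  qed
  have "(modulus T z)\<^sup>2 = (LINT x|lborel. (T (x + z) - T x)\<^sup>2)" by (simp add: modulus_def L2_norm_sq)
  also have "\<dots> \<le> (LINT x|lborel. (1 + t) * (\<phi> x * (B (x + h))\<^sup>2 + (1 - \<phi> x) * (B x)\<^sup>2) + (1 + 1 / t) * m * (D (x + z))\<^sup>2)"
  proof (rule integral_mono[OF _ _ pt])
    show "integrable lborel (\<lambda>x. (T (x + z) - T x)\<^sup>2)"
      by (intro L2_spaceD(2) L2_space_diff L2_space_translate T)
  qed (use i1 i2 iDz in auto)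
  also have "\<dots> = (1 + t) * ((LINT x|lborel. \<phi> x * (B (x + h))\<^sup>2) + (LINT x|lborel. (1 - \<phi> x) * (B x)\<^sup>2)) + (1 + 1 / t) * m * (LINT x|lborel. (D (x + z))\<^sup>2)"
    using i1 i2 iDz by simp
  also have "(LINT x|lborel. (D (x + z))\<^sup>2) = (modulus u h)\<^sup>2"
    using integral_lborel_translate[of "\<lambda>x. (D x)\<^sup>2" z] L2_spaceD(1)[OF D] by (simp add: modulus_def L2_norm_sq D_def)
  \<comment> \<open>The translation is moved from \<open>B\<close> onto the cutoff. The total weight
    \<phi>(x - h) + 1 - \<phi>(x) then exceeds 1 by at most \<open>L * norm h\<close>, so the
    leading coefficient stays 1 up to an error of first order in \<open>h\<close>.\<close>
  also have "(LINT x|lborel. \<phi> x * (B (x + h))\<^sup>2) = (LINT x|lborel. \<phi> (x - h) * (B x)\<^sup>2)"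
    using integral_lborel_translate[of "\<lambda>x. \<phi> (x - h) * (B x)\<^sup>2" h] by simp
  also have "(LINT x|lborel. \<phi> (x - h) * (B x)\<^sup>2) + (LINT x|lborel. (1 - \<phi> x) * (B x)\<^sup>2) = (LINT x|lborel. \<phi> (x - h) * (B x)\<^sup>2 + (1 - \<phi> x) * (B x)\<^sup>2)"
    using i2 i3 by simp
  also have "\<dots> \<le> (LINT x|lborel. (1 + L * norm h) * (B x)\<^sup>2)"
  proof (rule integral_mono)
    fix x
    have "\<phi> (x - h) - \<phi> x \<le> L * norm h" using c(4)[of "x - h" x] by simp
    then have "(\<phi> (x - h) + (1 - \<phi> x)) * (B x)\<^sup>2 \<le> (1 + L * norm h) * (B x)\<^sup>2" by (intro mult_right_mono) auto
    then show "\<phi> (x - h) * (B x)\<^sup>2 + (1 - \<phi> x) * (B x)\<^sup>2 \<le> (1 + L * norm h) * (B x)\<^sup>2" by (simp add: algebra_simps)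
  qed (use i2 i3 iB in auto)
  also have "\<dots> = (1 + L * norm h) * (modulus u z)\<^sup>2" by (simp add: modulus_def L2_norm_sq B_def)
  finally have "(modulus T z)\<^sup>2 \<le> (1 + t) * ((1 + L * norm h) * (modulus u z)\<^sup>2) + (1 + 1 / t) * m * (modulus u h)\<^sup>2"
    using t by (simp add: mult_left_mono)
  then show ?thesis unfolding T_def m_def by (simp add: mult.assoc)
qed

text \<open>Integrate the pointwise bound in z against the kernel. The weight
  \<open>min 1 ((norm z)\<^sup>2)\<close> makes the commutator term integrable, at the price 1/(s (1
  - s)), which the normalization cancels later.\<close>

lemma energy_localized_translate:
  fixes u \<phi> :: "'a::euclidean_space \<Rightarrow> real"
  assumes u: "u \<in> L2_space lborel" and \<phi>: "cutoff L \<phi>" and t: "0 < t" and s: "0 < s" "s < 1"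
  shows "energy s (\<lambda>x. \<phi> x * u (x + h) + (1 - \<phi> x) * u x) \<le>
    ennreal ((1 + t) * (1 + L * norm h)) * energy s u +
    ennreal ((1 + 1 / t) * L\<^sup>2 * (unit_ball_vol DIM('a) * 2 ^ (DIM('a) + 4) / (s * (1 - s))) * (modulus u h)\<^sup>2)"
proof -
  note [measurable] = borel_measurable_modulus[OF u]
  define T where "T = (\<lambda>x. \<phi> x * u (x + h) + (1 - \<phi> x) * u x)"
  have T: "T \<in> L2_space lborel" unfolding T_def by (rule L2_space_localized_translate[OF u \<phi>])
  define a where "a = (1 + t) * (1 + L * norm h)"
  define b where "b = (1 + 1 / t) * L\<^sup>2 * (modulus u h)\<^sup>2"
  have L: "1 \<le> L" by (rule cutoffD[OF \<phi>])
  have a: "0 \<le> a" and b: "0 \<le> b" using t L by (auto simp: a_def b_def)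
  have "energy s T \<le> (\<integral>\<^sup>+z. ennreal a * ennreal (riesz_kernel s z * (modulus u z)\<^sup>2) + ennreal b * ennreal (riesz_kernel s z * min 1 ((norm z)\<^sup>2)) \<partial>lborel)"
    unfolding energy_eq_modulus[OF T]
  proof (rule nn_integral_mono)
    fix z :: 'a
    have "riesz_kernel s z * (modulus T z)\<^sup>2 \<le> riesz_kernel s z * (a * (modulus u z)\<^sup>2 + b * min 1 ((norm z)\<^sup>2))"
      using modulus_localized_translate[OF u \<phi> t, of h z] unfolding T_def a_def b_def
      by (intro mult_left_mono) (auto simp: mult_ac)
    then have "ennreal (riesz_kernel s z * (modulus T z)\<^sup>2) \<le> ennreal (a * (riesz_kernel s z * (modulus u z)\<^sup>2) + b * (riesz_kernel s z * min 1 ((norm z)\<^sup>2)))"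
      by (intro ennreal_leI) (simp add: algebra_simps)
    then show "ennreal (riesz_kernel s z * (modulus T z)\<^sup>2) \<le> ennreal a * ennreal (riesz_kernel s z * (modulus u z)\<^sup>2) + ennreal b * ennreal (riesz_kernel s z * min 1 ((norm z)\<^sup>2))"
      using a b by (simp add: ennreal_plus ennreal_mult)
  qed
  also have "\<dots> = ennreal a * energy s u + ennreal b * (\<integral>\<^sup>+z. ennreal (riesz_kernel s z * min 1 ((norm z)\<^sup>2)) \<partial>(lborel::'a measure))"
    unfolding energy_eq_modulus[OF u] by (simp add: nn_integral_add nn_integral_cmult)
  also have "\<dots> \<le> ennreal a * energy s u + ennreal b * ennreal (unit_ball_vol DIM('a) * 2 ^ (DIM('a) + 4) / (s * (1 - s)))"
    by (intro add_left_mono mult_left_mono riesz_kernel_tail_le s) auto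
  also have "ennreal b * ennreal (unit_ball_vol DIM('a) * 2 ^ (DIM('a) + 4) / (s * (1 - s))) =
      ennreal (b * (unit_ball_vol DIM('a) * 2 ^ (DIM('a) + 4) / (s * (1 - s))))"
    using b s by (intro ennreal_mult[symmetric]) auto
  finally show ?thesis unfolding T_def a_def b_def by (simp only: mult_ac)
qed

section \<open>Localized translations of weak solutions\<close>

text \<open>
  A weak solution with right-hand side of norm at most \<open>N\<close> satisfies this with
  \<open>K = closure \<Omega>\<close>, because the left-hand side is then \<open>2 \<bar>(u, v)\<bar> = 2 \<bar>\<langle>f, v\<rangle>\<bar>\<close>.
\<close>

definition near_solution :: "real \<Rightarrow> 'a::euclidean_space set \<Rightarrow> real \<Rightarrow> ('a \<Rightarrow> real) \<Rightarrow> bool" where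
  "near_solution s K N u \<longleftrightarrow> u \<in> L2_space lborel \<and> (\<forall>x. x \<notin> K \<longrightarrow> u x = 0) \<and> energy s u < \<infinity> \<and>
     (\<forall>v\<in>L2_space lborel. (\<forall>x. x \<notin> K \<longrightarrow> v x = 0) \<longrightarrow> energy s v < \<infinity> \<longrightarrow>
        frac_const DIM('a) s / 2 *
          \<bar>enn2real (energy s (\<lambda>x. u x + v x)) - enn2real (energy s u) - enn2real (energy s v)\<bar>
        \<le> 2 * N * L2_norm lborel v)"

lemma near_solutionD:
  assumes "near_solution s K N u"
  shows "u \<in> L2_space lborel" "x \<notin> K \<Longrightarrow> u x = 0" "energy s u < \<infinity>"
  using assms by (auto simp: near_solution_def)

lemma near_solutionD_energy:
  fixes u :: "'a::euclidean_space \<Rightarrow> real"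
  assumes "near_solution s K N u" "v \<in> L2_space lborel" "\<And>x. x \<notin> K \<Longrightarrow> v x = 0" "energy s v < \<infinity>"
  shows "frac_const DIM('a) s / 2 *
     \<bar>enn2real (energy s (\<lambda>x. u x + v x)) - enn2real (energy s u) - enn2real (energy s v)\<bar>
    \<le> 2 * N * L2_norm lborel v"
  using assms by (auto simp: near_solution_def)

text \<open>Test with v = u: the energy of 2u is four times that of \<open>u\<close>, so the
  normalized energy is at most N times the norm of \<open>u\<close>. The Poincare inequality bounds
  the squared norm by the normalized energy, and one power of the norm cancels.\<close>

lemma near_solution_apriori:
  assumes K: "bounded (K :: 'a::euclidean_space set)"
  shows "\<exists>C>0. \<forall>s u N. 0 < s \<longrightarrow> s < 1 \<longrightarrow> 0 < N \<longrightarrow> near_solution s K N u \<longrightarrow>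
     L2_norm lborel u \<le> C * N \<and> frac_const DIM('a) s / 2 * enn2real (energy s u) \<le> C * N\<^sup>2"
proof -
  obtain R where R: "0 \<le> R" "\<And>x. x \<in> K \<Longrightarrow> norm x \<le> R"
    using K by (meson bounded_pos less_imp_le)
  obtain Cp where Cp: "Cp > 0" "\<And>s (u::'a \<Rightarrow> real). 0 < s \<Longrightarrow> s < 1 \<Longrightarrow> u \<in> L2_space lborel \<Longrightarrow>
     (\<And>x. R < norm x \<Longrightarrow> u x = 0) \<Longrightarrow> ennreal ((L2_norm lborel u)\<^sup>2) \<le> ennreal (Cp * (s * (1 - s))) * energy s u"
    using poincare_inequality[OF R(1), where 'a='a] by blast
  obtain c C where c: "0 < c" "\<And>s. 0 < s \<Longrightarrow> s < 1 \<Longrightarrow> c * (s * (1 - s)) \<le> frac_const DIM('a) s / 2"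
    using frac_const_bounds[OF DIM_positive[where 'a='a]] by blast
  show ?thesis
  proof (intro exI[of _ "Cp / c"] conjI allI impI)
    show "0 < Cp / c" using Cp c by simp
    fix s N :: real and u :: "'a \<Rightarrow> real"
    assume s: "0 < s" "s < 1" and N: "0 < N" and u: "near_solution s K N u"
    note uD = near_solutionD[OF u]
    define a where "a = frac_const DIM('a) s / 2"
    define e where "e = enn2real (energy s u)"
    have e: "energy s u = ennreal e" "0 \<le> e" using uD(3) by (auto simp: e_def less_top)
    have ca: "c * (s * (1 - s)) \<le> a" unfolding a_def using c s by simp
    have "0 < c * (s * (1 - s))" using c s by simp
    then have a: "0 < a" using ca by linarith
    have "energy s (\<lambda>x. u x + u x) = ennreal (4 * e)"
      using energy_cmult[OF uD(1), of s 2] e by (simp add: ennreal_mult flip: mult_2)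
    then have e2: "enn2real (energy s (\<lambda>x. u x + u x)) = 4 * e" using e by simp
    have "a * \<bar>4 * e - e - e\<bar> \<le> 2 * N * L2_norm lborel u"
      using near_solutionD_energy[OF u uD(1) uD(2) uD(3)] unfolding e2 e_def[symmetric] a_def[symmetric] by simp
    then have ae: "a * e \<le> N * L2_norm lborel u" using e by (simp add: algebra_simps)
    have "ennreal ((L2_norm lborel u)\<^sup>2) \<le> ennreal (Cp * (s * (1 - s))) * energy s u"
      using Cp(2)[OF s uD(1)] uD(2) R(2) by (meson not_le)
    then have "ennreal ((L2_norm lborel u)\<^sup>2) \<le> ennreal (Cp * (s * (1 - s)) * e)"
      using Cp s e by (simp add: ennreal_mult)
    then have "(L2_norm lborel u)\<^sup>2 \<le> Cp * (s * (1 - s)) * e"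
      using Cp s e by (subst (asm) ennreal_le_iff) auto
    also have "\<dots> = Cp / c * (c * (s * (1 - s)) * e)" using c by simp
    also have "\<dots> \<le> Cp / c * (a * e)" using Cp c ca e by (intro mult_left_mono mult_right_mono) auto
    also have "\<dots> \<le> Cp / c * (N * L2_norm lborel u)" using Cp c ae by (intro mult_left_mono) auto
    finally have sq: "L2_norm lborel u * L2_norm lborel u \<le> (Cp / c * N) * L2_norm lborel u"
      by (simp add: power2_eq_square)
    show n: "L2_norm lborel u \<le> Cp / c * N"
    proof (cases "L2_norm lborel u = 0")
      case True
      then show ?thesis using Cp c N by simp
    next
      case False
      then have "0 < L2_norm lborel u" using L2_norm_nonneg[of lborel u] by linarith
      then show ?thesis by (rule mult_right_le_imp_le[OF sq])
    qed
    have "a * e \<le> N * (Cp / c * N)" using ae mult_left_mono[OF n, of N] N by linarith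
    then show "frac_const DIM('a) s / 2 * enn2real (energy s u) \<le> Cp / c * N\<^sup>2"
      unfolding a_def e_def by (simp add: power2_eq_square mult_ac)
  qed
qed

text \<open>With T = u + v the defining inequality bounds the normalized energy of \<open>v\<close>
  by that of \<open>T\<close> minus that of \<open>u\<close>, plus 2 N W. The leading energies
  cancel because the coefficient in the energy bound for \<open>T\<close> is close to 1; the apriori
  bound handles the rest.\<close>

lemma near_solution_translate:
  assumes K: "bounded (K :: 'a::euclidean_space set)" and L: "1 \<le> L" and b: "0 \<le> b"
  shows "\<exists>C>0. \<forall>s u N \<phi> h W. 0 < s \<longrightarrow> s < 1 \<longrightarrow> 0 < N \<longrightarrow> near_solution s K N u \<longrightarrow>
     cutoff L \<phi> \<longrightarrow> (\<forall>x. x \<notin> K \<longrightarrow> \<phi> x * u (x + h) = 0) \<longrightarrow>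
     modulus u h \<le> W \<longrightarrow> 0 < W \<longrightarrow> W \<le> b * N \<longrightarrow>
     energy s (\<lambda>x. \<phi> x * (u (x + h) - u x)) < \<infinity> \<and>
     frac_const DIM('a) s / 2 * enn2real (energy s (\<lambda>x. \<phi> x * (u (x + h) - u x))) \<le> C * N * (N * norm h + W)"
proof -
  obtain C1 where C1: "C1 > 0" "\<And>s u N. 0 < s \<Longrightarrow> s < 1 \<Longrightarrow> 0 < N \<Longrightarrow> near_solution s K N u \<Longrightarrow>
     frac_const DIM('a) s / 2 * enn2real (energy s u) \<le> C1 * N\<^sup>2"
    using near_solution_apriori[OF K] by blast
  obtain c C where c: "0 < c" "0 < C" "\<And>s. 0 < s \<Longrightarrow> s < 1 \<Longrightarrow> c * (s * (1 - s)) \<le> frac_const DIM('a) s / 2"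
    "\<And>s. 0 < s \<Longrightarrow> s < 1 \<Longrightarrow> frac_const DIM('a) s / 2 \<le> C * (s * (1 - s))"
    using frac_const_bounds[OF DIM_positive[where 'a='a]] by blast
  define V where "V = unit_ball_vol (real DIM('a)) * 2 ^ (DIM('a) + 4)"
  have V: "0 < V" by (simp add: V_def)
  define D where "D = C1 * (1 + b) * L + C1 + (1 + b) * L\<^sup>2 * V * C + 2"
  have D: "0 < D" unfolding D_def using C1(1) b L V c(2) by (intro add_nonneg_pos add_nonneg_nonneg mult_nonneg_nonneg) auto
  show ?thesis
  proof (intro exI[of _ D] conjI allI impI)
    show "0 < D" by (rule D)
    fix s N W :: real and u \<phi> :: "'a \<Rightarrow> real" and h :: 'a
    assume s: "0 < s" "s < 1" and N: "0 < N" and u: "near_solution s K N u"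
      and \<phi>: "cutoff L \<phi>" and van: "\<forall>x. x \<notin> K \<longrightarrow> \<phi> x * u (x + h) = 0"
      and W: "modulus u h \<le> W" "0 < W" "W \<le> b * N"
    note uD = near_solutionD[OF u]
    define a where "a = frac_const DIM('a) s / 2"
    define e where "e = enn2real (energy s u)"
    have e: "energy s u = ennreal e" "0 \<le> e" using uD(3) by (auto simp: e_def less_top)
    have "0 < c * (s * (1 - s))" using c s by simp
    then have a: "0 < a" "a \<le> C * (s * (1 - s))" unfolding a_def using c(3,4)[OF s] by linarith+
    define v where "v = (\<lambda>x. \<phi> x * (u (x + h) - u x))"
    define T where "T = (\<lambda>x. \<phi> x * u (x + h) + (1 - \<phi> x) * u x)"
    have Teq: "(\<lambda>x. u x + v x) = T" unfolding T_def v_def by (auto simp: algebra_simps)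
    have Teq': "v = (\<lambda>x. T x - u x)" unfolding T_def v_def by (auto simp: algebra_simps)
    have v: "v \<in> L2_space lborel" and T: "T \<in> L2_space lborel"
      unfolding v_def T_def by (rule L2_space_localized_translate[OF uD(1) \<phi>])+
    \<comment> \<open>The errors are of order t N^2 from the energy of \<open>u\<close> and W^2 / t
      from the commutator; this choice makes both of order N W. The assumption
      \<open>W \<le> b * N\<close> keeps \<open>t\<close> bounded.\<close>
    define t where "t = W / N"
    have t: "0 < t" "t \<le> b" using W N by (auto simp: t_def field_simps)
    define P where "P = (1 + t) * (1 + L * norm h) * e + (1 + 1 / t) * L\<^sup>2 * (V / (s * (1 - s))) * (modulus u h)\<^sup>2"
    have P: "energy s T \<le> ennreal P" "0 \<le> P"
    proof -
      have "0 \<le> (1 + 1 / t) * L\<^sup>2 * (V / (s * (1 - s))) * (modulus u h)\<^sup>2" "0 \<le> (1 + t) * (1 + L * norm h)"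
        using t s V L by auto
      moreover have "energy s T \<le> ennreal ((1 + t) * (1 + L * norm h)) * energy s u +
        ennreal ((1 + 1 / t) * L\<^sup>2 * (V / (s * (1 - s))) * (modulus u h)\<^sup>2)"
        unfolding T_def V_def by (rule energy_localized_translate[OF uD(1) \<phi> t(1) s])
      ultimately show "energy s T \<le> ennreal P" "0 \<le> P"
        unfolding e(1) P_def using e(2) by (auto simp: ennreal_plus ennreal_mult)
    qed
    have Tfin: "energy s T < \<infinity>" using P(1) by (metis ennreal_less_top infinity_ennreal_def le_less_trans)
    have "energy s v \<le> 2 * energy s T + 2 * energy s u" unfolding Teq' by (rule energy_diff_le[OF T uD(1)])
    also have "\<dots> < \<infinity>" using Tfin uD(3) by (simp add: ennreal_mult_less_top)
    finally have vfin: "energy s v < \<infinity>" .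
    then show "energy s (\<lambda>x. \<phi> x * (u (x + h) - u x)) < \<infinity>" by (simp add: v_def)
    have eT: "enn2real (energy s T) \<le> P" using P by (metis enn2real_leI)
    have v0: "v x = 0" if "x \<notin> K" for x
      using van that uD(2)[OF that] by (simp add: v_def)
    have nv: "L2_norm lborel v \<le> W"
    proof -
      have "L2_norm lborel v \<le> modulus u h" unfolding modulus_def v_def
        by (rule L2_norm_mono)
           (use cutoffD[OF \<phi>] uD(1) in \<open>auto simp: abs_mult intro!: mult_left_le_one_le L2_space_diff L2_space_translate\<close>)
      then show ?thesis using W by simp
    qed
    have "a * \<bar>enn2real (energy s T) - e - enn2real (energy s v)\<bar> \<le> 2 * N * L2_norm lborel v"
      using near_solutionD_energy[OF u v v0 vfin] unfolding Teq a_def e_def by simp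
    also have "\<dots> \<le> 2 * N * W" using N nv by simp
    finally have "a * \<bar>enn2real (energy s T) - e - enn2real (energy s v)\<bar> \<le> 2 * N * W" .
    moreover have "a * (e + enn2real (energy s v) - enn2real (energy s T)) \<le> a * \<bar>enn2real (energy s T) - e - enn2real (energy s v)\<bar>"
      using a by (intro mult_left_mono) auto
    ultimately have "a * enn2real (energy s v) \<le> a * enn2real (energy s T) - a * e + 2 * N * W"
      by (simp add: algebra_simps)
    also have "\<dots> \<le> a * P - a * e + 2 * N * W" using a eT by simp
    also have "a * P - a * e = (t + L * norm h * (1 + t)) * (a * e) + (1 + 1 / t) * L\<^sup>2 * V * (a / (s * (1 - s))) * (modulus u h)\<^sup>2"
      by (simp add: P_def algebra_simps)
    also have "\<dots> \<le> (t + L * norm h * (1 + b)) * (C1 * N\<^sup>2) + (1 + 1 / t) * L\<^sup>2 * V * C * W\<^sup>2"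
    proof (rule add_mono)
      have ae: "a * e \<le> C1 * N\<^sup>2" "0 \<le> a * e"
        unfolding a_def e_def by (rule C1(2)[OF s N u]) (use a e in \<open>simp add: a_def e_def\<close>)
      have t': "t + L * norm h * (1 + t) \<le> t + L * norm h * (1 + b)"
        using t L by (intro add_left_mono mult_left_mono) auto
      show "(t + L * norm h * (1 + t)) * (a * e) \<le> (t + L * norm h * (1 + b)) * (C1 * N\<^sup>2)"
        by (rule mult_mono[OF t' ae(1) _ ae(2)]) (use t L b in simp)
      have "a / (s * (1 - s)) \<le> C" using a s by (simp add: field_simps)
      moreover have "(modulus u h)\<^sup>2 \<le> W\<^sup>2" using W by (intro power_mono) auto
      moreover have "0 \<le> (1 + 1 / t) * L\<^sup>2 * V" using t V by simp
      ultimately show "(1 + 1 / t) * L\<^sup>2 * V * (a / (s * (1 - s))) * (modulus u h)\<^sup>2 \<le> (1 + 1 / t) * L\<^sup>2 * V * C * W\<^sup>2"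
        using c(2) t V a(1) s by (intro mult_mono mult_left_mono mult_nonneg_nonneg) auto
    qed
    also have "(t + L * norm h * (1 + b)) * (C1 * N\<^sup>2) = C1 * (N * W) + C1 * (1 + b) * L * (N * (N * norm h))"
      using N by (simp add: t_def field_simps power2_eq_square)
    also have "(1 + 1 / t) * L\<^sup>2 * V * C * W\<^sup>2 = L\<^sup>2 * V * C * ((1 + 1 / t) * W\<^sup>2)" by (simp add: mult_ac)
    also have "\<dots> \<le> L\<^sup>2 * V * C * ((1 + b) * (N * W))"
    proof (intro mult_left_mono)
      have "(1 + 1 / t) * W\<^sup>2 = W * W + N * W" using W N by (simp add: t_def field_simps power2_eq_square)
      also have "\<dots> \<le> (b * N) * W + N * W" using W by (intro add_right_mono mult_right_mono) auto
      finally show "(1 + 1 / t) * W\<^sup>2 \<le> (1 + b) * (N * W)" by (simp add: algebra_simps)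
    qed (use V c in auto)
    finally have "a * enn2real (energy s v) \<le> C1 * (N * W) + C1 * (1 + b) * L * (N * (N * norm h)) + L\<^sup>2 * V * C * ((1 + b) * (N * W)) + 2 * N * W"
      by simp
    also have "\<dots> \<le> D * (N * W) + D * (N * (N * norm h))"
    proof -
      have "C1 * (1 + b) * L * (N * (N * norm h)) \<le> D * (N * (N * norm h))"
        using C1(1) b L V c(2) N unfolding D_def by (intro mult_right_mono) auto
      moreover have "(C1 + (1 + b) * L\<^sup>2 * V * C + 2) * (N * W) \<le> D * (N * W)"
        using C1(1) b L N W unfolding D_def by (intro mult_right_mono) auto
      ultimately show ?thesis by (simp add: algebra_simps)
    qed
    finally show "frac_const DIM('a) s / 2 * enn2real (energy s (\<lambda>x. \<phi> x * (u (x + h) - u x))) \<le> D * N * (N * norm h + W)"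
      unfolding a_def v_def by (simp add: algebra_simps)
  qed
qed

section \<open>Second differences of weak solutions in Lipschitz domains\<close>

text \<open>Formulated for \<open>y - h\<close> because the localized translate evaluates
  \<open>u\<close> at \<open>x + h\<close>: read backwards, a point of the chart ball outside
  \<open>\<Omega>\<close> is sent by adding \<open>h\<close> to a point outside
  \<open>\<Omega>\<close>, as long as it stays in the ball.\<close>

definition admissible :: "'a::euclidean_space set \<Rightarrow> 'a \<Rightarrow> real \<Rightarrow> 'a \<Rightarrow> bool" where
  "admissible \<Omega> p r h \<longleftrightarrow> (\<forall>y. y \<in> \<Omega> \<longrightarrow> y \<in> ball p r \<longrightarrow> y - h \<in> ball p r \<longrightarrow> y - h \<in> \<Omega>)"

text \<open>
  Every vector \<open>k\<close> is a difference of two vectors of comparable length in the cone of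
  admissible directions of a Lipschitz chart.
\<close>

lemma ex_admissible:
  fixes \<Omega> :: "'a::euclidean_space set"
  assumes \<Omega>: "bounded_lipschitz_domain \<Omega>" and p: "p \<in> closure \<Omega>"
  shows "\<exists>r>0. \<exists>M\<ge>0. \<forall>k. \<exists>h. norm h \<le> M * norm k \<and> admissible \<Omega> p r h \<and> admissible \<Omega> p r (k + h)"
proof (cases "p \<in> \<Omega>")
  case True
  then obtain r where "r > 0" "ball p r \<subseteq> \<Omega>"
    using \<Omega> by (meson bounded_lipschitz_domain_def openE)
  then show ?thesis by (intro exI[of _ r] conjI exI[of _ 0] allI) (auto simp: admissible_def)
next
  case False
  then have "p \<in> frontier \<Omega>" using p \<Omega> by (simp add: frontier_def bounded_lipschitz_domain_def interior_open)
  then obtain r e L \<gamma> where r: "r > 0" and e: "norm e = 1" and L: "L-lipschitz_on {y. y \<bullet> e = 0} \<gamma>"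
    and eq: "\<Omega> \<inter> ball p r = {x \<in> ball p r. \<gamma> (x - (x \<bullet> e) *\<^sub>R e) < x \<bullet> e}"
    using \<Omega> unfolding bounded_lipschitz_domain_def lipschitz_boundary_def by blast
  define \<pi> where "\<pi> x = x - (x \<bullet> e) *\<^sub>R e" for x :: 'a
  have ee: "e \<bullet> e = 1" using e by (simp add: dot_square_norm)
  have \<pi>0: "\<pi> x \<bullet> e = 0" for x by (simp add: \<pi>_def inner_diff_left ee)
  have \<pi>d: "\<pi> x - \<pi> y = \<pi> (x - y)" for x y by (simp add: \<pi>_def algebra_simps)
  have L0: "0 \<le> L" by (rule lipschitz_on_nonneg[OF L])
  have mem: "x \<in> \<Omega> \<longleftrightarrow> \<gamma> (\<pi> x) < x \<bullet> e" if "x \<in> ball p r" for x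
    using eq that unfolding \<pi>_def by blast
  have adm: "admissible \<Omega> p r h" if h: "h \<bullet> e \<le> - L * norm (\<pi> h)" for h
    unfolding admissible_def
  proof (intro allI impI)
    fix y assume y: "y \<in> \<Omega>" "y \<in> ball p r" "y - h \<in> ball p r"
    have 1: "\<gamma> (\<pi> y) < y \<bullet> e" using mem y by blast
    have "dist (\<gamma> (\<pi> (y - h))) (\<gamma> (\<pi> y)) \<le> L * dist (\<pi> (y - h)) (\<pi> y)"
      by (rule lipschitz_onD[OF L]) (auto simp: \<pi>0)
    also have "dist (\<pi> (y - h)) (\<pi> y) = norm (\<pi> h)"
      by (simp add: \<pi>_def dist_norm algebra_simps norm_minus_commute)
    finally have "\<gamma> (\<pi> (y - h)) \<le> \<gamma> (\<pi> y) + L * norm (\<pi> h)" by (simp add: dist_real_def)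
    then have "\<gamma> (\<pi> (y - h)) < (y - h) \<bullet> e" using 1 h by (simp add: inner_diff_left)
    then show "y - h \<in> \<Omega>" using mem y by blast
  qed
  have \<pi>n: "norm (\<pi> k) \<le> norm k" for k
  proof -
    have "(norm (\<pi> k))\<^sup>2 = (norm k)\<^sup>2 - (k \<bullet> e)\<^sup>2"
      unfolding power2_norm_eq_inner \<pi>_def
      by (simp only: inner_diff_left inner_diff_right inner_scaleR_left inner_scaleR_right ee inner_commute[of e k])
         (simp add: power2_eq_square)
    then have "(norm (\<pi> k))\<^sup>2 \<le> (norm k)\<^sup>2" by simp
    then show ?thesis by (rule power2_le_imp_le) simp
  qed
  show ?thesis
  proof (rule exI[of _ r], intro conjI r, rule exI[of _ "L + 1"], intro conjI allI)
    fix k :: 'a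
    \<comment> \<open>A vertical shift, so that subtracting it moves deeper into the epigraph. Of
      its length, one \<open>norm k\<close> outweighs the height of \<open>k\<close> and L times
      \<open>norm k\<close> outweighs the variation of the graph along the horizontal part of
      \<open>k\<close>.\<close>
    define h where "h = (- ((L + 1) * norm k)) *\<^sub>R e"
    have he: "h \<bullet> e = - ((L + 1) * norm k)" by (simp add: h_def ee)
    have \<pi>h: "\<pi> h = 0" unfolding \<pi>_def he by (simp add: h_def)
    have \<pi>kh: "\<pi> (k + h) = \<pi> k" using \<pi>d[of "k + h" h] \<pi>h by simp
    show "\<exists>h. norm h \<le> (L + 1) * norm k \<and> admissible \<Omega> p r h \<and> admissible \<Omega> p r (k + h)"
    proof (intro exI[of _ h] conjI adm)
      show "norm h \<le> (L + 1) * norm k" using L0 e by (simp add: h_def)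
      show "h \<bullet> e \<le> - L * norm (\<pi> h)" unfolding \<pi>h he using L0 by simp
      have "k \<bullet> e \<le> norm k" using norm_cauchy_schwarz[of k e] e by simp
      moreover have "L * norm (\<pi> k) \<le> L * norm k" using L0 \<pi>n by (intro mult_left_mono) auto
      ultimately show "(k + h) \<bullet> e \<le> - L * norm (\<pi> (k + h))"
        unfolding \<pi>kh inner_add_left he by (simp add: algebra_simps)
    qed
  qed (use r L0 in auto)
qed

text \<open>Passes from \<open>\<Omega>\<close> to its closure: the translated exterior points
  within the chart form an open set disjoint from \<open>\<Omega>\<close>, hence disjoint from the
  closure.\<close>

lemma admissible_outside:
  assumes adm: "admissible \<Omega> p r h" and x: "x \<notin> closure \<Omega>" "x \<in> ball p r" "x + h \<in> ball p r"
  shows "x + h \<notin> closure \<Omega>"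
proof -
  define S where "S = ball p r \<inter> (\<lambda>y. y - h) -` (ball p r - closure \<Omega>)"
  have "open S" unfolding S_def
    by (intro open_Int open_vimage open_ball open_Diff closed_closure continuous_intros)
  moreover have "S \<inter> \<Omega> = {}"
    using adm closure_subset[of \<Omega>] by (auto simp: S_def admissible_def)
  ultimately have "S \<inter> closure \<Omega> = {}" by (simp add: open_Int_closure_eq_empty)
  moreover have "x + h \<in> S" using x by (simp add: S_def)
  ultimately show ?thesis by blast
qed

lemma ex_cutoff:
  fixes p :: "'a::euclidean_space"
  assumes r: "0 < r"
  shows "\<exists>L \<phi>. cutoff L \<phi> \<and> (\<forall>x\<in>ball p (r / 4). \<phi> x = 1) \<and> (\<forall>x. x \<notin> ball p (r / 2) \<longrightarrow> \<phi> x = 0)"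
proof -
  define \<phi> where "\<phi> x = max 0 (min 1 (2 - 4 / r * dist p x))" for x
  define L where "L = max 1 (4 / r)"
  have "\<bar>\<phi> x - \<phi> y\<bar> \<le> L * norm (x - y)" for x y
  proof -
    have "\<bar>\<phi> x - \<phi> y\<bar> \<le> \<bar>(2 - 4 / r * dist p x) - (2 - 4 / r * dist p y)\<bar>"
      unfolding \<phi>_def by (auto simp: max_def min_def)
    also have "\<dots> = 4 / r * \<bar>dist p x - dist p y\<bar>"
    proof -
      have "(2 - 4 / r * dist p x) - (2 - 4 / r * dist p y) = 4 / r * (dist p y - dist p x)"
        by (simp add: algebra_simps)
      then have "\<bar>(2 - 4 / r * dist p x) - (2 - 4 / r * dist p y)\<bar> = \<bar>4 / r\<bar> * \<bar>dist p y - dist p x\<bar>"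
        by (simp only: abs_mult)
      then show ?thesis using r by (simp only: abs_minus_commute[of "dist p y"]) simp
    qed
    also have "\<dots> \<le> 4 / r * norm (x - y)"
      using r norm_triangle_ineq3[of "p - x" "p - y"]
      by (intro mult_left_mono) (auto simp: dist_norm norm_minus_commute)
    also have "\<dots> \<le> L * norm (x - y)" unfolding L_def by (intro mult_right_mono) auto
    finally show ?thesis .
  qed
  then have "cutoff L \<phi>" by (auto simp: cutoff_def L_def \<phi>_def)
  moreover have "\<phi> x = 1" if "x \<in> ball p (r / 4)" for x
    using that r by (auto simp: \<phi>_def field_simps max_def min_def)
  moreover have "\<phi> x = 0" if "x \<notin> ball p (r / 2)" for x
    using that r by (auto simp: \<phi>_def field_simps max_def min_def)
  ultimately show ?thesis by blast
qed

lemma modulus_le_sup: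
  fixes u :: "'a::euclidean_space \<Rightarrow> real"
  assumes u: "u \<in> L2_space lborel" and G: "\<And>k. norm k \<le> \<delta> \<Longrightarrow> modulus u k \<le> G"
    and m: "0 < m" and h: "norm h \<le> real m * \<delta>"
  shows "modulus u h \<le> real m * G"
proof -
  have "norm ((1 / real m) *\<^sub>R h) \<le> \<delta>" using m h by (simp add: field_simps)
  then have "real m * modulus u ((1 / real m) *\<^sub>R h) \<le> real m * G" by (intro mult_left_mono G) auto
  moreover have "modulus u h \<le> real m * modulus u ((1 / real m) *\<^sub>R h)"
    using modulus_scale_le[OF u, of m "(1 / real m) *\<^sub>R h"] m by simp
  ultimately show ?thesis by (rule order_trans[rotated])
qed

text \<open>For admissible h1 = k + h2 the function w = v h1 - v h2 equals \<phi> (u(\<cdot> + h1) -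
  u(\<cdot> + h2)). Where the cutoff is 1, its difference w(x - h2 + k) - w(x - h2) is u(x + 2k) - 2
  u(x + k) + u(x). Both localized translates have small energy, and bounding first differences of
  \<open>w\<close> by its energy gains \<open>\<delta> powr (2 * s)\<close>.\<close>

lemma second_difference_local:
  fixes \<Omega> :: "'a::euclidean_space set"
  assumes \<Omega>: "bounded_lipschitz_domain \<Omega>" and p: "p \<in> closure \<Omega>" and B: "0 \<le> B"
  shows "\<exists>r>0. \<exists>A>0. \<exists>\<delta>0>0. \<forall>s u N \<delta> k G. 0 < s \<longrightarrow> s < 1 \<longrightarrow> 0 < N \<longrightarrow>
     near_solution s (closure \<Omega>) N u \<longrightarrow> norm k \<le> \<delta> \<longrightarrow> 0 < \<delta> \<longrightarrow> \<delta> \<le> \<delta>0 \<longrightarrow>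
     (\<forall>k'. norm k' \<le> \<delta> \<longrightarrow> modulus u k' \<le> G) \<longrightarrow> G \<le> B * N \<longrightarrow>
     (LINT x|lborel. indicator (ball p r) x * (u (x + 2 *\<^sub>R k) - 2 * u (x + k) + u x)\<^sup>2)
       \<le> A * \<delta> powr (2 * s) * N * (N * \<delta> + G)"
proof -
  obtain r M where r: "r > 0" and M: "M \<ge> 0"
    and adm: "\<And>k. \<exists>h. norm h \<le> M * norm k \<and> admissible \<Omega> p r h \<and> admissible \<Omega> p r (k + h)"
    using ex_admissible[OF \<Omega> p] by blast
  obtain L \<phi> where \<phi>: "cutoff L \<phi>" "\<And>x. x \<in> ball p (r / 4) \<Longrightarrow> \<phi> x = 1" "\<And>x. x \<notin> ball p (r / 2) \<Longrightarrow> \<phi> x = 0"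
    using ex_cutoff[OF r, of p] by blast
  \<comment> \<open>Both shifts have length at most (M + 1) \<delta>, so \<open>m\<close> steps of
    length at most \<open>\<delta>\<close> reach them and subadditivity bounds their first
    differences by \<open>m * G\<close>.\<close>
  define m where "m = Suc (nat \<lceil>M + 1\<rceil>)"
  have m: "M + 1 \<le> real m" "0 < m" by (auto simp: m_def) linarith
  define K where "K = closure \<Omega>"
  have K: "bounded K" using \<Omega> by (simp add: K_def bounded_lipschitz_domain_def bounded_closure)
  define b where "b = real m * B + 1"
  have b: "0 \<le> b" using B by (simp add: b_def)
  obtain C1 where C1: "C1 > 0" "\<And>s u N h W. 0 < s \<Longrightarrow> s < 1 \<Longrightarrow> 0 < N \<Longrightarrow> near_solution s K N u \<Longrightarrow>
     (\<And>x. x \<notin> K \<Longrightarrow> \<phi> x * u (x + h) = 0) \<Longrightarrow> modulus u h \<le> W \<Longrightarrow> 0 < W \<Longrightarrow> W \<le> b * N \<Longrightarrow>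
     energy s (\<lambda>x. \<phi> x * (u (x + h) - u x)) < \<infinity> \<and>
     frac_const DIM('a) s / 2 * enn2real (energy s (\<lambda>x. \<phi> x * (u (x + h) - u x))) \<le> C1 * N * (N * norm h + W)"
    using near_solution_translate[OF K cutoffD(1)[OF \<phi>(1)] b] \<phi>(1) by blast
  obtain C0 where C0: "C0 > 0" "\<And>s (u::'a \<Rightarrow> real) k. 0 < s \<Longrightarrow> s < 1 \<Longrightarrow> u \<in> L2_space lborel \<Longrightarrow>
     ennreal ((modulus u k)\<^sup>2) \<le> ennreal (C0 * norm k powr (2 * s) * (s * (1 - s))) * energy s u"
    using modulus_le_energy[where 'a='a] by blast
  obtain c where c: "0 < c" "\<And>s. 0 < s \<Longrightarrow> s < 1 \<Longrightarrow> c * (s * (1 - s)) \<le> frac_const DIM('a) s / 2"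
    using frac_const_bounds[OF DIM_positive[where 'a='a]] by blast
  define A where "A = C0 / c * (4 * C1 * (2 * real m + 1))"
  \<comment> \<open>Makes every shift at most r/16. Starting in the ball of radius r/8, the points x
    - h2 and x - h2 + k stay in the ball of radius r/4, where the cutoff is 1; starting in the ball
    of radius r/2, which contains all points where the cutoff is nonzero, x + h stays in the
    chart.\<close>
  define \<delta>0 where "\<delta>0 = min 1 (r / (16 * real m))"
  have A: "0 < A" using C0(1) C1(1) c(1) m by (simp add: A_def)
  have \<delta>0: "0 < \<delta>0" using r m by (simp add: \<delta>0_def)
  show ?thesis
  proof (rule exI[of _ "r / 8"], intro conjI, use r in simp, rule exI[of _ A], intro conjI A,
      rule exI[of _ \<delta>0], intro conjI \<delta>0 allI impI)
    fix s N \<delta> G :: real and u :: "'a \<Rightarrow> real" and k :: 'a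
    assume s: "0 < s" "s < 1" and N: "0 < N" and u: "near_solution s (closure \<Omega>) N u"
      and k: "norm k \<le> \<delta>" and \<delta>: "0 < \<delta>" "\<delta> \<le> \<delta>0"
      and G: "\<forall>k'. norm k' \<le> \<delta> \<longrightarrow> modulus u k' \<le> G" "G \<le> B * N"
    note u = u[folded K_def]
    note uD = near_solutionD[OF u]
    have [measurable]: "u \<in> borel_measurable borel" using uD(1) by (auto simp: L2_space_def)
    have G0: "0 \<le> G" using G(1)[rule_format, of 0] \<delta> order_trans[OF modulus_nonneg(1)[of u 0]] by simp
    obtain h2 where h2: "norm h2 \<le> M * norm k" "admissible \<Omega> p r h2" "admissible \<Omega> p r (k + h2)"
      using adm by blast
    define h1 where "h1 = k + h2"
    have hn: "norm h2 \<le> real m * \<delta>" "norm h1 \<le> real m * \<delta>"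
    proof -
      have "M * norm k \<le> M * \<delta>" using M k by (intro mult_left_mono) auto
      moreover have "(M + 1) * \<delta> \<le> real m * \<delta>" using m \<delta> by (intro mult_right_mono) auto
      moreover have "norm h1 \<le> norm k + norm h2" unfolding h1_def by (rule norm_triangle_ineq)
      ultimately have "norm h2 \<le> M * \<delta>" "norm h1 \<le> M * \<delta> + \<delta>" "M * \<delta> + \<delta> \<le> real m * \<delta>"
        using h2(1) k by (auto simp: algebra_simps)
      then show "norm h2 \<le> real m * \<delta>" "norm h1 \<le> real m * \<delta>" using \<delta> by linarith+
    qed
    have m\<delta>: "real m * \<delta> \<le> r / 16"
    proof -
      have "real m * \<delta> \<le> real m * (r / (16 * real m))" using \<delta> m by (intro mult_left_mono) (auto simp: \<delta>0_def)
      then show ?thesis using m by simp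
    qed
    have \<delta>1: "\<delta> \<le> 1" using \<delta> by (simp add: \<delta>0_def)
    have kr: "norm k \<le> r / 16"
    proof -
      have "1 * \<delta> \<le> real m * \<delta>" using m \<delta> by (intro mult_right_mono) auto
      then show ?thesis using k m\<delta> by simp
    qed
    \<comment> \<open>The summand \<open>N * \<delta>\<close> guarantees a positive bound even if
      \<open>G\<close> is 0, and has the size of an error that is present anyway.\<close>
    define W where "W = real m * G + N * \<delta>"
    have W: "0 < W" "W \<le> b * N"
    proof -
      show "0 < W" unfolding W_def using N \<delta> G0 by (intro add_nonneg_pos) auto
      have "real m * G \<le> real m * (B * N)" using G(2) by (intro mult_left_mono) auto
      moreover have "N * \<delta> \<le> N * 1" using N \<delta>1 by (intro mult_left_mono) auto
      ultimately show "W \<le> b * N" by (simp add: W_def b_def algebra_simps)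
    qed
    define Q where "Q = C1 * ((2 * real m + 1) * (N * (N * \<delta> + G)))"
    define v where "v h = (\<lambda>x. \<phi> x * (u (x + h) - u x))" for h
    define a where "a = frac_const DIM('a) s / 2"
    have "0 < c * (s * (1 - s))" using c s by simp
    then have a: "0 < a" "c * (s * (1 - s)) \<le> a" unfolding a_def using c(2)[OF s] by linarith+
    have v: "v h \<in> L2_space lborel" for h
      unfolding v_def by (rule L2_space_localized_translate[OF uD(1) \<phi>(1)])
    have est: "energy s (v h) < \<infinity> \<and> a * enn2real (energy s (v h)) \<le> Q"
      if h: "norm h \<le> real m * \<delta>" "admissible \<Omega> p r h" for h
    proof -
      have van: "\<phi> x * u (x + h) = 0" if x: "x \<notin> K" for x
      proof (cases "x \<in> ball p (r / 2)")
        case True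
        have "dist p (x + h) \<le> dist p x + norm h" using norm_triangle_ineq4[of "p - x" h] by (simp add: dist_norm algebra_simps)
        also have "\<dots> < r" using True h(1) m\<delta> r by simp
        finally have "x + h \<in> ball p r" by simp
        moreover have "x \<in> ball p r" using True r by simp
        ultimately have "x + h \<notin> K" using admissible_outside[OF h(2)] x by (simp add: K_def)
        then show ?thesis using uD(2) by simp
      qed (simp add: \<phi>(3))
      have "modulus u h \<le> real m * G" using modulus_le_sup[OF uD(1) _ m(2) h(1)] G(1) by blast
      also have "\<dots> \<le> W" using N \<delta> by (simp add: W_def)
      finally have "energy s (v h) < \<infinity> \<and> a * enn2real (energy s (v h)) \<le> C1 * N * (N * norm h + W)"
        unfolding v_def a_def using C1(2)[OF s N u van _ W] by blast
      moreover have "C1 * N * (N * norm h + W) \<le> Q"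
      proof -
        have "N * norm h \<le> N * (real m * \<delta>)" using N h by (intro mult_left_mono) auto
        then have "N * norm h + W \<le> (real m + 1) * (N * \<delta>) + real m * G" by (simp add: W_def algebra_simps)
        also have "\<dots> \<le> (2 * real m + 1) * (N * \<delta>) + (2 * real m + 1) * G"
          using N \<delta> G0 by (intro add_mono mult_right_mono) auto
        finally have "N * norm h + W \<le> (2 * real m + 1) * (N * \<delta> + G)" by (simp add: algebra_simps)
        then have "C1 * N * (N * norm h + W) \<le> C1 * N * ((2 * real m + 1) * (N * \<delta> + G))"
          using C1(1) N by (intro mult_left_mono) auto
        then show ?thesis by (simp add: Q_def mult_ac)
      qed
      ultimately show ?thesis by linarith
    qed
    define w where "w = (\<lambda>x. v h1 x - v h2 x)"
    have w: "w \<in> L2_space lborel" unfolding w_def by (intro L2_space_diff v)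
    obtain e1 e2 where e: "energy s (v h1) = ennreal e1" "0 \<le> e1" "energy s (v h2) = ennreal e2" "0 \<le> e2"
      using est[OF hn(1) h2(2)] est[OF hn(2)] h2(3) unfolding h1_def[symmetric]
      by (metis enn2real_nonneg ennreal_enn2real infinity_ennreal_def)
    have ae: "a * e1 \<le> Q" "a * e2 \<le> Q"
      using est[OF hn(1) h2(2)] est[OF hn(2)] h2(3) e unfolding h1_def[symmetric] by auto
    have "energy s w \<le> 2 * energy s (v h1) + 2 * energy s (v h2)"
      unfolding w_def by (rule energy_diff_le[OF v v])
    also have "\<dots> = ennreal (2 * e1 + 2 * e2)" using e by (simp add: ennreal_plus ennreal_mult)
    finally have ew: "energy s w \<le> ennreal (2 * e1 + 2 * e2)" .
    have "ennreal ((modulus w k)\<^sup>2) \<le> ennreal (C0 * norm k powr (2 * s) * (s * (1 - s))) * ennreal (2 * e1 + 2 * e2)"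
      using C0(2)[OF s w, of k] ew by (meson mult_left_mono order_trans zero_le)
    also have "\<dots> = ennreal (C0 * norm k powr (2 * s) * (s * (1 - s)) * (2 * e1 + 2 * e2))"
      using C0 s e by (intro ennreal_mult[symmetric]) auto
    finally have "(modulus w k)\<^sup>2 \<le> C0 * norm k powr (2 * s) * (s * (1 - s)) * (2 * e1 + 2 * e2)"
      using C0 s e by (subst (asm) ennreal_le_iff) auto
    \<comment> \<open>The factor s (1 - s) is absorbed by the normalization \<open>a\<close>; after
      this line no constant depends on \<open>s\<close>.\<close>
    also have "\<dots> = C0 / c * norm k powr (2 * s) * ((c * (s * (1 - s))) * (2 * e1 + 2 * e2))"
      using c by simp
    also have "\<dots> \<le> C0 / c * \<delta> powr (2 * s) * (a * (2 * e1 + 2 * e2))"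
      using C0 c a e k s \<delta> by (intro mult_mono mult_right_mono powr_mono2 mult_left_mono mult_nonneg_nonneg) auto
    also have "\<dots> \<le> C0 / c * \<delta> powr (2 * s) * (4 * Q)"
      using ae C0 c by (intro mult_left_mono) (auto simp: algebra_simps)
    also have "\<dots> = A * \<delta> powr (2 * s) * N * (N * \<delta> + G)" by (simp add: A_def Q_def mult_ac)
    finally have mw: "(modulus w k)\<^sup>2 \<le> A * \<delta> powr (2 * s) * N * (N * \<delta> + G)" .
    have ws: "w x = \<phi> x * (u (x + h1) - u (x + h2))" for x by (simp add: w_def v_def algebra_simps)
    have w': "(\<lambda>x. w (x + k) - w x) \<in> L2_space lborel" by (intro L2_space_diff L2_space_translate w)
    have iw: "integrable lborel (\<lambda>x. (w (x - h2 + k) - w (x - h2))\<^sup>2)"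
      using L2_spaceD(2)[OF L2_space_translate[OF w', of "- h2"]] by simp
    have "(LINT x|lborel. indicator (ball p (r / 8)) x * (u (x + 2 *\<^sub>R k) - 2 * u (x + k) + u x)\<^sup>2)
      \<le> (LINT x|lborel. (w (x - h2 + k) - w (x - h2))\<^sup>2)"
    proof (rule integral_mono_AE')
      show "AE x in lborel. indicator (ball p (r / 8)) x * (u (x + 2 *\<^sub>R k) - 2 * u (x + k) + u x)\<^sup>2 \<le> (w (x - h2 + k) - w (x - h2))\<^sup>2"
      proof (intro AE_I2)
        fix x :: 'a
        show "indicator (ball p (r / 8)) x * (u (x + 2 *\<^sub>R k) - 2 * u (x + k) + u x)\<^sup>2 \<le> (w (x - h2 + k) - w (x - h2))\<^sup>2"
        proof (cases "x \<in> ball p (r / 8)")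
          case True
          have h2r: "norm h2 \<le> r / 16" using hn(1) m\<delta> by linarith
          have "dist p (x - h2) \<le> dist p x + norm h2" using norm_triangle_ineq[of "p - x" h2] by (simp add: dist_norm algebra_simps)
          then have d1: "x - h2 \<in> ball p (r / 4)" using True h2r r by simp
          have "dist p (x - h2 + k) \<le> dist p (x - h2) + norm k"
            using norm_triangle_ineq4[of "p - (x - h2)" k] by (simp add: dist_norm algebra_simps)
          then have d2: "x - h2 + k \<in> ball p (r / 4)"
            using True h2r kr r \<open>dist p (x - h2) \<le> dist p x + norm h2\<close> by simp
          have "w (x - h2 + k) - w (x - h2) = u (x + 2 *\<^sub>R k) - 2 * u (x + k) + u x"
            unfolding ws \<phi>(2)[OF d1] \<phi>(2)[OF d2] h1_def by (simp add: algebra_simps scaleR_2)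
          then show ?thesis using True by simp
        qed simp
      qed
    qed (use iw in auto)
    also have "\<dots> = (modulus w k)\<^sup>2"
    proof -
      have [measurable]: "w \<in> borel_measurable borel" using w by (auto simp: L2_space_def)
      show ?thesis
        using integral_lborel_translate[of "\<lambda>x. (w (x + k) - w x)\<^sup>2" "- h2"] by (simp add: modulus_def L2_norm_sq)
    qed
    also note mw
    finally show "(LINT x|lborel. indicator (ball p (r / 8)) x * (u (x + 2 *\<^sub>R k) - 2 * u (x + k) + u x)\<^sup>2)
       \<le> A * \<delta> powr (2 * s) * N * (N * \<delta> + G)" .
  qed
qed

text \<open>Compactness of the closure gives finitely many of the local balls, and they also cover
  an \<epsilon>-neighbourhood. At a point outside the cover, x, x + k and x + 2k all lie off the
  closure when 2k is shorter than \<epsilon>, so the second difference vanishes there.\<close>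

lemma second_difference_bound:
  fixes \<Omega> :: "'a::euclidean_space set"
  assumes \<Omega>: "bounded_lipschitz_domain \<Omega>" and B: "0 \<le> B"
  shows "\<exists>A>0. \<exists>\<delta>0>0. \<delta>0 \<le> 1 / 2 \<and> (\<forall>s u N \<delta> k G. 0 < s \<longrightarrow> s < 1 \<longrightarrow> 0 < N \<longrightarrow>
     near_solution s (closure \<Omega>) N u \<longrightarrow> norm k \<le> \<delta> \<longrightarrow> 0 < \<delta> \<longrightarrow> \<delta> \<le> \<delta>0 \<longrightarrow>
     (\<forall>k'. norm k' \<le> \<delta> \<longrightarrow> modulus u k' \<le> G) \<longrightarrow> G \<le> B * N \<longrightarrow>
     (modulus2 u k)\<^sup>2 \<le> A * \<delta> powr (2 * s) * N * (N * \<delta> + G))"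
proof -
  define K where "K = closure \<Omega>"
  have K: "compact K" using \<Omega> by (simp add: K_def bounded_lipschitz_domain_def compact_closure)
  define P where "P p r A \<delta>0 \<longleftrightarrow> r > 0 \<and> A > 0 \<and> \<delta>0 > 0 \<and> (\<forall>s u N \<delta> k G. 0 < s \<longrightarrow> s < 1 \<longrightarrow> 0 < N \<longrightarrow>
     near_solution s K N u \<longrightarrow> norm k \<le> \<delta> \<longrightarrow> 0 < \<delta> \<longrightarrow> \<delta> \<le> \<delta>0 \<longrightarrow>
     (\<forall>k'. norm k' \<le> \<delta> \<longrightarrow> modulus u k' \<le> G) \<longrightarrow> G \<le> B * N \<longrightarrow>
     (LINT x|lborel. indicator (ball p r) x * (u (x + 2 *\<^sub>R k) - 2 * u (x + k) + u x)\<^sup>2)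
       \<le> A * \<delta> powr (2 * s) * N * (N * \<delta> + G))" for p r A \<delta>0
  have "\<exists>r A \<delta>0. P p r A \<delta>0" if "p \<in> K" for p
    using second_difference_local[OF \<Omega> that[unfolded K_def] B] unfolding P_def K_def
    by (elim exE conjE) (intro exI conjI)
  then obtain r A d where P: "\<And>p. p \<in> K \<Longrightarrow> P p (r p) (A p) (d p)" by metis
  have rAd: "r p > 0" "A p > 0" "d p > 0" if "p \<in> K" for p
    using P[OF that] unfolding P_def by auto
  have loc: "(LINT x|lborel. indicator (ball p (r p)) x * (u (x + 2 *\<^sub>R k) - 2 * u (x + k) + u x)\<^sup>2)
       \<le> A p * \<delta> powr (2 * s) * N * (N * \<delta> + G)"
    if "p \<in> K" "0 < s" "s < 1" "0 < N" "near_solution s K N u" "norm k \<le> \<delta>" "0 < \<delta>" "\<delta> \<le> d p"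
      "\<forall>k'. norm k' \<le> \<delta> \<longrightarrow> modulus u k' \<le> G" "G \<le> B * N" for p s u N \<delta> k G
    by (rule P[OF that(1), unfolded P_def, THEN conjunct2, THEN conjunct2, THEN conjunct2,
      rule_format (no_asm), OF that(2-10)])
  obtain F where F: "F \<subseteq> K" "finite F" "K \<subseteq> (\<Union>p\<in>F. ball p (r p))"
    by (rule compactE_image[OF K, of K "\<lambda>p. ball p (r p)"]) (use rAd in auto)
  define U where "U = (\<Union>p\<in>F. ball p (r p))"
  have "open U" by (auto simp: U_def)
  then obtain \<epsilon> where \<epsilon>: "\<epsilon> > 0" "(\<Union>x\<in>K. ball x \<epsilon>) \<subseteq> U"
    using compact_subset_open_imp_ball_epsilon_subset[OF K] F(3) unfolding U_def by metis
  define \<delta>0 where "\<delta>0 = Min (insert (min (1 / 2) (\<epsilon> / 4)) (d ` F))"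
  have \<delta>0: "0 < \<delta>0" "\<delta>0 \<le> 1 / 2" "\<delta>0 \<le> \<epsilon> / 4" "\<And>p. p \<in> F \<Longrightarrow> \<delta>0 \<le> d p"
  proof -
    show "0 < \<delta>0" unfolding \<delta>0_def using F rAd \<epsilon> by (subst Min_gr_iff) auto
    have "\<delta>0 \<le> min (1 / 2) (\<epsilon> / 4)" unfolding \<delta>0_def using F by (intro Min_le) auto
    then show "\<delta>0 \<le> 1 / 2" "\<delta>0 \<le> \<epsilon> / 4" by auto
    show "\<delta>0 \<le> d p" if "p \<in> F" for p unfolding \<delta>0_def using F that by (intro Min_le) auto
  qed
  define AA where "AA = 1 + (\<Sum>p\<in>F. A p)"
  have AA: "0 < AA" unfolding AA_def
    by (intro add_pos_nonneg sum_nonneg less_imp_le[OF rAd(2)]) (use F(1) in auto)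
  show ?thesis
  proof (rule exI[of _ AA], intro conjI AA, rule exI[of _ \<delta>0], intro conjI \<delta>0(1,2) allI impI)
    fix s N \<delta> G :: real and u :: "'a \<Rightarrow> real" and k :: 'a
    assume s: "0 < s" "s < 1" and N: "0 < N" and u: "near_solution s (closure \<Omega>) N u"
      and k: "norm k \<le> \<delta>" and \<delta>: "0 < \<delta>" "\<delta> \<le> \<delta>0"
      and G: "\<forall>k'. norm k' \<le> \<delta> \<longrightarrow> modulus u k' \<le> G" "G \<le> B * N"
    note u = u[folded K_def]
    note uD = near_solutionD[OF u]
    have G0: "0 \<le> G" using G(1)[rule_format, of 0] \<delta> order_trans[OF modulus_nonneg(1)[of u 0]] by simp
    define S where "S x = (u (x + 2 *\<^sub>R k) - 2 * u (x + k) + u x)\<^sup>2" for x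
    have iS: "integrable lborel S"
      unfolding S_def by (intro L2_spaceD(2) L2_space_add L2_space_diff L2_space_cmult L2_space_translate uD(1))
    have iSp: "integrable lborel (\<lambda>x. indicator (ball p (r p)) x * S x)" for p
      using integrable_mult_indicator[OF _ iS, of "ball p (r p)"] by simp
    have "(modulus2 u k)\<^sup>2 = (LINT x|lborel. S x)" by (simp add: modulus2_def L2_norm_sq S_def)
    also have "\<dots> \<le> (LINT x|lborel. (\<Sum>p\<in>F. indicator (ball p (r p)) x * S x))"
    proof (rule integral_mono[OF iS])
      show "integrable lborel (\<lambda>x. (\<Sum>p\<in>F. indicator (ball p (r p)) x * S x))" using iSp by auto
      fix x :: 'a
      show "S x \<le> (\<Sum>p\<in>F. indicator (ball p (r p)) x * S x)"
      proof (cases "x \<in> U")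
        case True
        then obtain q where q: "q \<in> F" "x \<in> ball q (r q)" by (auto simp: U_def)
        have "S x = indicator (ball q (r q)) x * S x" using q by simp
        also have "\<dots> \<le> (\<Sum>p\<in>F. indicator (ball p (r p)) x * S x)"
          using q(1) F(2) by (intro member_le_sum) (auto simp: S_def)
        finally show ?thesis .
      next
        case False
        have out: "x + y \<notin> K" if "norm y < \<epsilon>" for y
        proof
          assume "x + y \<in> K"
          moreover have "x \<in> ball (x + y) \<epsilon>" using that by (simp add: dist_norm)
          ultimately show False using \<epsilon>(2) False by blast
        qed
        have "norm k \<le> \<epsilon> / 4" using k \<delta> \<delta>0 by linarith
        then have "u (x + 2 *\<^sub>R k) = 0" "u (x + k) = 0" "u (x + 0) = 0"
          using \<epsilon>(1) by (intro uD(2) out; simp)+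
        then have "S x = 0" by (simp add: S_def)
        then show ?thesis by simp
      qed
    qed
    also have "\<dots> = (\<Sum>p\<in>F. LINT x|lborel. indicator (ball p (r p)) x * S x)" using iSp by (intro Bochner_Integration.integral_sum) auto
    also have "\<dots> \<le> (\<Sum>p\<in>F. A p * \<delta> powr (2 * s) * N * (N * \<delta> + G))"
      unfolding S_def
    proof (intro sum_mono loc s N u k \<delta> G)
    qed (use F \<delta> \<delta>0 in \<open>auto intro: order_trans\<close>)
    also have "\<dots> = (\<Sum>p\<in>F. A p) * (\<delta> powr (2 * s) * N * (N * \<delta> + G))"
      by (simp add: sum_distrib_right mult.assoc)
    also have "\<dots> \<le> AA * (\<delta> powr (2 * s) * N * (N * \<delta> + G))"
      using N \<delta> G0 by (intro mult_right_mono) (auto simp: AA_def)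
    finally show "(modulus2 u k)\<^sup>2 \<le> AA * \<delta> powr (2 * s) * N * (N * \<delta> + G)" by (simp add: mult.assoc)
  qed
qed

section \<open>Regularity in terms of second differences\<close>

definition sup_modulus :: "('a::euclidean_space \<Rightarrow> real) \<Rightarrow> real \<Rightarrow> real" where
  "sup_modulus u \<delta> = (SUP k\<in>cball 0 \<delta>. modulus u k)"

lemma modulus_bdd_above:
  fixes u :: "'a::euclidean_space \<Rightarrow> real"
  assumes "u \<in> L2_space lborel"
  shows "bdd_above (modulus u ` S)"
  using modulus_le_norm[OF assms] by (intro bdd_aboveI2)

lemma modulus_le_sup_modulus:
  fixes u :: "'a::euclidean_space \<Rightarrow> real"
  assumes "u \<in> L2_space lborel" "norm k \<le> \<delta>"
  shows "modulus u k \<le> sup_modulus u \<delta>"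
  unfolding sup_modulus_def using assms by (intro cSUP_upper modulus_bdd_above) auto

lemma sup_modulus_least:
  fixes u :: "'a::euclidean_space \<Rightarrow> real"
  assumes "0 \<le> \<delta>" "\<And>k. norm k \<le> \<delta> \<Longrightarrow> modulus u k \<le> c"
  shows "sup_modulus u \<delta> \<le> c"
  unfolding sup_modulus_def using assms by (intro cSUP_least) auto

lemma sup_modulus_nonneg:
  fixes u :: "'a::euclidean_space \<Rightarrow> real"
  assumes "u \<in> L2_space lborel" "0 \<le> \<delta>"
  shows "0 \<le> sup_modulus u \<delta>"
  using modulus_le_sup_modulus[OF assms(1), of 0 \<delta>] assms(2) order_trans[OF modulus_nonneg(1)[of u 0]] by simp

lemma sup_modulus_mono:
  fixes u :: "'a::euclidean_space \<Rightarrow> real"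
  assumes "u \<in> L2_space lborel" "0 \<le> \<delta>" "\<delta> \<le> \<delta>'"
  shows "sup_modulus u \<delta> \<le> sup_modulus u \<delta>'"
  using assms by (intro sup_modulus_least modulus_le_sup_modulus) auto

lemma sup_modulus_le_norm:
  fixes u :: "'a::euclidean_space \<Rightarrow> real"
  assumes "u \<in> L2_space lborel" "0 \<le> \<delta>"
  shows "sup_modulus u \<delta> \<le> 2 * L2_norm lborel u"
  using assms by (intro sup_modulus_least modulus_le_norm)

text \<open>
  The parallelogram law is used here instead of the triangle inequality: the squares make the
  constant in the theorem depend on the square root of the distance to the critical exponent.
\<close>

lemma sup_modulus_recursion:
  fixes u :: "'a::euclidean_space \<Rightarrow> real"
  assumes u: "u \<in> L2_space lborel" and \<delta>: "0 \<le> \<delta>"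
    and le: "\<And>k. norm k \<le> \<delta> \<Longrightarrow> (modulus2 u k)\<^sup>2 \<le> Y"
  shows "(sup_modulus u \<delta>)\<^sup>2 \<le> (sup_modulus u (2 * \<delta>))\<^sup>2 / 4 + Y / 4"
proof -
  have Y: "0 \<le> Y" using order_trans[OF zero_le_power2 le[of 0]] \<delta> by simp
  have "sup_modulus u \<delta> \<le> sqrt ((sup_modulus u (2 * \<delta>))\<^sup>2 / 4 + Y / 4)"
  proof (rule sup_modulus_least[OF \<delta>])
    fix k :: 'a assume k: "norm k \<le> \<delta>"
    have "modulus u (2 *\<^sub>R k) \<le> sup_modulus u (2 * \<delta>)" using k by (intro modulus_le_sup_modulus u) simp
    then have "(modulus u (2 *\<^sub>R k))\<^sup>2 \<le> (sup_modulus u (2 * \<delta>))\<^sup>2" by (intro power_mono) auto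
    then have "(modulus u k)\<^sup>2 \<le> (sup_modulus u (2 * \<delta>))\<^sup>2 / 4 + Y / 4"
      using modulus_parallelogram[OF u, of k] le[OF k] by simp
    then show "modulus u k \<le> sqrt ((sup_modulus u (2 * \<delta>))\<^sup>2 / 4 + Y / 4)"
      by (rule real_le_rsqrt)
  qed
  then have "(sup_modulus u \<delta>)\<^sup>2 \<le> (sqrt ((sup_modulus u (2 * \<delta>))\<^sup>2 / 4 + Y / 4))\<^sup>2"
    using sup_modulus_nonneg[OF u \<delta>] by (intro power_mono)
  then show ?thesis using Y by simp
qed

text \<open>Induction on the number of doublings that lift \<delta> above \<open>\<delta>0\<close>.
  The bound \<open>\<delta>0 \<le> 1 / 2\<close> ensures that a doubled step still lies in the range
  up to 1.\<close>

lemma dyadic_downward_induct: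
  fixes \<delta>0 :: real
  assumes \<delta>0: "0 < \<delta>0" "\<delta>0 \<le> 1 / 2"
    and base: "\<And>\<delta>. \<delta>0 < \<delta> \<Longrightarrow> \<delta> \<le> 1 \<Longrightarrow> Q \<delta>"
    and step: "\<And>\<delta>. 0 < \<delta> \<Longrightarrow> \<delta> \<le> \<delta>0 \<Longrightarrow> Q (2 * \<delta>) \<Longrightarrow> Q \<delta>"
    and \<delta>: "0 < \<delta>" "\<delta> \<le> 1"
  shows "Q \<delta>"
proof -
  have *: "\<forall>\<delta>. \<delta>0 / 2 ^ n < \<delta> \<longrightarrow> \<delta> \<le> 1 \<longrightarrow> Q \<delta>" for n
  proof (induction n)
    case 0 then show ?case using base by simp
  next
    case (Suc n)
    show ?case
    proof (intro allI impI)
      fix \<delta> assume d: "\<delta>0 / 2 ^ Suc n < \<delta>" "\<delta> \<le> 1"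
      show "Q \<delta>"
      proof (cases "\<delta> \<le> \<delta>0")
        case True
        have "0 < \<delta>0 / 2 ^ Suc n" using \<delta>0 by simp
        then have "0 < \<delta>" using d by linarith
        moreover have "\<delta>0 / 2 ^ n < 2 * \<delta>" using d(1) by simp
        ultimately show ?thesis using Suc True \<delta>0 by (auto intro!: step[of \<delta>])
      qed (use base d in auto)
    qed
  qed
  obtain n where "(1 / 2) ^ n < \<delta> / \<delta>0"
    using real_arch_pow_inv[of "\<delta> / \<delta>0" "1 / 2"] \<delta> \<delta>0 by auto
  then have "\<delta>0 / 2 ^ n < \<delta>" using \<delta>0 by (simp add: field_simps power_one_over)
  with * \<delta> show ?thesis by blast
qed

text \<open>For the ansatz G \<delta> \<le> X \<delta>^\<tau>, one dyadic step contracts the square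
  by \<open>4 powr (\<tau> - 1)\<close>. The remaining room, of order (1 - \<tau>) X^2, must hold
  the error A N (N + 2X). That error is linear in X, so X of order N/(1 - \<tau>) suffices.\<close>

lemma modulus_decay_subcritical:
  fixes G :: "real \<Rightarrow> real"
  assumes \<delta>0: "0 < \<delta>0" "\<delta>0 \<le> 1 / 2" and N: "0 < N" and A: "0 < A" and B: "0 < B"
    and G0: "\<And>\<delta>. 0 < \<delta> \<Longrightarrow> 0 \<le> G \<delta>" and mono: "\<And>\<delta> \<delta>'. 0 < \<delta> \<Longrightarrow> \<delta> \<le> \<delta>' \<Longrightarrow> G \<delta> \<le> G \<delta>'"
    and bound: "\<And>\<delta>. 0 < \<delta> \<Longrightarrow> G \<delta> \<le> B * N"
    and rec: "\<And>\<delta>. 0 < \<delta> \<Longrightarrow> \<delta> \<le> \<delta>0 \<Longrightarrow> (G \<delta>)\<^sup>2 \<le> (G (2 * \<delta>))\<^sup>2 / 4 + A * \<delta> powr (2 * s) * N * (N * \<delta> + G \<delta>)"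
    and \<tau>: "0 < \<tau>" "\<tau> < 1" "\<tau> \<le> 2 * s" and \<delta>: "0 < \<delta>" "\<delta> \<le> 1"
  shows "G \<delta> \<le> (1 + 6 * A + B / \<delta>0) * N / (1 - \<tau>) * \<delta> powr \<tau>"
proof -
  \<comment> \<open>The three summands serve the inequality N \<le> X, the absorption of the error
    in \<open>key\<close>, and the base case, in this order.\<close>
  define D where "D = 1 + 6 * A + B / \<delta>0"
  define X where "X = D * N / (1 - \<tau>)"
  have D: "1 \<le> D" "6 * A \<le> D" "B / \<delta>0 \<le> D" using A B \<delta>0 by (auto simp: D_def)
  have X: "D * N \<le> X"
  proof -
    have "D * N * (1 - \<tau>) \<le> D * N * 1" using D N \<tau> by (intro mult_left_mono) auto
    then show ?thesis using \<tau> by (simp add: X_def field_simps)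
  qed
  have DN: "0 < D * N" using D N by simp
  have XN: "N \<le> X" using X mult_right_mono[OF D(1), of N] N by linarith
  have X0: "0 < X" using XN N by simp
  have key: "A * N * (N + 2 * X) \<le> (1 - 4 powr (\<tau> - 1)) * X\<^sup>2"
  proof -
    have "A * N * (N + 2 * X) \<le> A * N * (3 * X)" using XN A N by (intro mult_left_mono) auto
    also have "\<dots> = (6 * A) * N / 2 * X" by simp
    also have "\<dots> \<le> D * N / 2 * X" using D N X0 by (intro mult_right_mono divide_right_mono) auto
    also have "\<dots> = (1 - \<tau>) / 2 * X * X" using \<tau> by (simp add: X_def)
    also have "\<dots> \<le> (1 - 4 powr (- (1 - \<tau>))) * X * X"
      using powr_4_bounds(3)[of "1 - \<tau>"] \<tau> X0 by (intro mult_right_mono) auto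
    finally show ?thesis by (simp add: power2_eq_square mult.assoc)
  qed
  have "G \<delta> \<le> X * \<delta> powr \<tau>"
  proof (rule dyadic_downward_induct[OF \<delta>0, where Q = "\<lambda>\<delta>. G \<delta> \<le> X * \<delta> powr \<tau>"])
    fix \<delta> :: real assume d: "\<delta>0 < \<delta>" "\<delta> \<le> 1"
    have "G \<delta> \<le> B * N" using bound d \<delta>0 by simp
    also have "\<dots> = (B / \<delta>0) * N * \<delta>0" using \<delta>0 by simp
    also have "\<dots> \<le> D * N * \<delta>0" using D N \<delta>0 by (intro mult_right_mono) auto
    also have "\<dots> \<le> X * \<delta> powr \<tau>"
    proof (intro mult_mono X)
      have "\<delta> powr 1 \<le> \<delta> powr \<tau>" using d \<delta>0 \<tau> by (intro powr_mono') auto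
      then show "\<delta>0 \<le> \<delta> powr \<tau>" using d \<delta>0 by simp
    qed (use X0 \<delta>0 in auto)
    finally show "G \<delta> \<le> X * \<delta> powr \<tau>" .
  next
    fix \<delta> :: real assume d: "0 < \<delta>" "\<delta> \<le> \<delta>0" and IH: "G (2 * \<delta>) \<le> X * (2 * \<delta>) powr \<tau>"
    define q where "q = \<delta> powr \<tau>"
    have q: "0 < q" using d by (simp add: q_def)
    have d1: "\<delta> \<le> 1" using d \<delta>0 by simp
    have dq: "\<delta> \<le> q" "\<delta> powr (2 * s) \<le> q"
    proof -
      have "\<delta> powr 1 \<le> \<delta> powr \<tau>" using d d1 \<tau> by (intro powr_mono') auto
      then show "\<delta> \<le> q" using d by (simp add: q_def)
      show "\<delta> powr (2 * s) \<le> q" unfolding q_def using d d1 \<tau> by (intro powr_mono') auto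
    qed
    have p2: "(2 * \<delta>) powr \<tau> = 2 powr \<tau> * q" by (simp add: powr_mult q_def)
    have "2 powr \<tau> \<le> (2::real) powr 1" using \<tau> by (intro powr_mono) auto
    then have t2: "2 powr \<tau> \<le> (2::real)" by simp
    \<comment> \<open>The recursion contains G \<delta> on its right-hand side too. There it is
      replaced by G (2\<delta>) through monotonicity, so that the induction hypothesis
      applies.\<close>
    have "G \<delta> \<le> G (2 * \<delta>)" using d by (intro mono) auto
    also have "\<dots> \<le> X * (2 powr \<tau> * q)" using IH by (simp only: p2)
    also have "\<dots> \<le> X * (2 * q)" using X0 q t2 by (intro mult_left_mono mult_right_mono) auto
    finally have G2: "G \<delta> \<le> 2 * X * q" by simp
    have "(G (2 * \<delta>))\<^sup>2 \<le> (X * (2 powr \<tau> * q))\<^sup>2" using IH G0[of "2 * \<delta>"] d by (intro power_mono) (auto simp: p2)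
    also have "\<dots> = 4 * (4 powr (\<tau> - 1) * X\<^sup>2 * q\<^sup>2)"
    proof -
      have "(4::real) powr \<tau> = (2 * 2) powr \<tau>" by simp
      also have "\<dots> = 2 powr \<tau> * 2 powr \<tau>" by (rule powr_mult)
      finally have "((2::real) powr \<tau>)\<^sup>2 = 4 powr \<tau>" by (simp only: power2_eq_square)
      moreover have "4 powr \<tau> = 4 * 4 powr (\<tau> - 1)" by (simp add: powr_diff)
      ultimately show ?thesis by (simp add: power_mult_distrib)
    qed
    finally have G4: "(G (2 * \<delta>))\<^sup>2 / 4 \<le> 4 powr (\<tau> - 1) * X\<^sup>2 * q\<^sup>2" by simp
    have "A * \<delta> powr (2 * s) * N * (N * \<delta> + G \<delta>) \<le> A * q * N * (N * q + 2 * X * q)"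
      using dq G2 A N q G0[OF d(1)] d by (intro mult_mono add_mono mult_left_mono mult_right_mono) auto
    also have "\<dots> = A * N * (N + 2 * X) * q\<^sup>2" by (simp add: power2_eq_square algebra_simps)
    also have "\<dots> \<le> (1 - 4 powr (\<tau> - 1)) * X\<^sup>2 * q\<^sup>2" using key by (intro mult_right_mono) auto
    finally have "(G \<delta>)\<^sup>2 \<le> 4 powr (\<tau> - 1) * X\<^sup>2 * q\<^sup>2 + (1 - 4 powr (\<tau> - 1)) * X\<^sup>2 * q\<^sup>2"
      using rec[OF d] G4 by linarith
    also have "\<dots> = (X * q)\<^sup>2" by (simp add: power_mult_distrib algebra_simps)
    finally show "G \<delta> \<le> X * \<delta> powr \<tau>"
      unfolding q_def[symmetric] using X0 q by (auto intro: power2_le_imp_le)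
  qed (use \<delta> in auto)
  then show ?thesis unfolding X_def D_def .
qed

text \<open>
  The negative term in the induction hypothesis
  \<open>(G \<delta>)\<^sup>2 \<le> \<delta>\<^sup>2 (X\<^sup>2 - Q \<delta> powr (2 s - 1))\<close> absorbs the summable error of the recursion.
\<close>

lemma modulus_decay_supercritical:
  fixes G :: "real \<Rightarrow> real"
  assumes \<delta>0: "0 < \<delta>0" "\<delta>0 \<le> 1 / 2" and N: "0 < N" and A: "0 < A" and B: "0 < B"
    and G0: "\<And>\<delta>. 0 < \<delta> \<Longrightarrow> 0 \<le> G \<delta>" and mono: "\<And>\<delta> \<delta>'. 0 < \<delta> \<Longrightarrow> \<delta> \<le> \<delta>' \<Longrightarrow> G \<delta> \<le> G \<delta>'"
    and bound: "\<And>\<delta>. 0 < \<delta> \<Longrightarrow> G \<delta> \<le> B * N"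
    and rec: "\<And>\<delta>. 0 < \<delta> \<Longrightarrow> \<delta> \<le> \<delta>0 \<Longrightarrow> (G \<delta>)\<^sup>2 \<le> (G (2 * \<delta>))\<^sup>2 / 4 + A * \<delta> powr (2 * s) * N * (N * \<delta> + G \<delta>)"
    and s: "1 / 2 < s" "s < 1" and \<delta>: "0 < \<delta>" "\<delta> \<le> 1"
  shows "G \<delta> \<le> (1 + 12 * A + 2 * B / \<delta>0) * N / (2 * s - 1) * \<delta>"
proof -
  define y where "y = 2 * s - 1"
  have y: "0 < y" "y < 1" using s by (auto simp: y_def)
  define D where "D = 1 + 12 * A + 2 * B / \<delta>0"
  define X where "X = D * N / y"
  have D: "1 \<le> D" "12 * A \<le> D" "2 * B / \<delta>0 \<le> D" using A B \<delta>0 by (auto simp: D_def)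
  have X: "D * N \<le> X"
  proof -
    have "D * N * y \<le> D * N * 1" using D N y by (intro mult_left_mono) auto
    then show ?thesis using y by (simp add: X_def field_simps)
  qed
  have XN: "N \<le> X" using X mult_right_mono[OF D(1), of N] N by linarith
  have X0: "0 < X" using XN N by simp
  \<comment> \<open>Since \<open>2 powr y - 1\<close> is at least y/2, this \<open>Q\<close> makes
    the gain \<open>Q * (2 powr y - 1)\<close> of one doubling cover the error. The size of
    \<open>D\<close> keeps \<open>Q\<close> below half of X^2, which leaves room for the base
    case.\<close>
  define Q where "Q = 2 * A * N * (N + 2 * X) / y"
  have Q0: "0 \<le> Q" using A N X0 y by (simp add: Q_def)
  have Qy: "A * N * (N + 2 * X) \<le> Q * (2 powr y - 1)"
  proof -
    have l1: "1/2 \<le> ln (2::real)"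
      using ln_add_one_self_le_self2[of "-1/2"] by (simp add: ln_div)
    have "y / 2 \<le> y * ln 2" using l1 y mult_left_mono[OF l1, of y] by simp
    also have "\<dots> \<le> 2 powr y - 1"
    proof -
      have "2 powr y = exp (y * ln 2)" by (simp add: powr_def)
      then show ?thesis using exp_ge_add_one_self[of "y * ln 2"] by linarith
    qed
    finally have "Q * (y / 2) \<le> Q * (2 powr y - 1)" using Q0 by (intro mult_left_mono)
    then show ?thesis using y by (simp add: Q_def)
  qed
  have Q2: "Q \<le> X\<^sup>2 / 2"
  proof -
    have "Q \<le> 2 * A * N * (3 * X) / y" unfolding Q_def using XN A N y by (intro divide_right_mono mult_left_mono) auto
    also have "\<dots> = (12 * A) * N / y * X / 2" by simp
    also have "\<dots> \<le> D * N / y * X / 2" using D N y X0 by (intro divide_right_mono mult_right_mono) auto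
    finally show ?thesis by (simp add: X_def power2_eq_square)
  qed
  have *: "(G \<delta>)\<^sup>2 \<le> \<delta>\<^sup>2 * (X\<^sup>2 - Q * \<delta> powr y)"
  proof (rule dyadic_downward_induct[OF \<delta>0, where Q = "\<lambda>\<delta>. (G \<delta>)\<^sup>2 \<le> \<delta>\<^sup>2 * (X\<^sup>2 - Q * \<delta> powr y)"])
    fix \<delta> :: real assume d: "\<delta>0 < \<delta>" "\<delta> \<le> 1"
    have "2 * B / \<delta>0 * N \<le> X" using X mult_right_mono[OF D(3), of N] N by simp
    then have BX: "2 * (B * N) \<le> \<delta>0 * X" using \<delta>0 by (simp add: field_simps)
    have "(G \<delta>)\<^sup>2 \<le> (B * N)\<^sup>2" using bound[of \<delta>] G0[of \<delta>] d \<delta>0 by (intro power_mono) auto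
    moreover have "(2 * (B * N))\<^sup>2 \<le> (\<delta>0 * X)\<^sup>2" using BX B N by (intro power_mono) auto
    ultimately have "(G \<delta>)\<^sup>2 \<le> \<delta>0\<^sup>2 * (X\<^sup>2 / 4)" by (simp add: power_mult_distrib)
    also have "\<dots> \<le> \<delta>\<^sup>2 * (X\<^sup>2 - Q * \<delta> powr y)"
    proof (intro mult_mono power_mono)
      have "\<delta> powr y \<le> 1" using d \<delta>0 y by (intro powr_le1) auto
      then have "Q * \<delta> powr y \<le> Q * 1" using Q0 by (intro mult_left_mono)
      then have QX: "Q * \<delta> powr y \<le> X\<^sup>2 / 2" using Q2 by simp
      have gen: "x / 4 \<le> x - q" if "q \<le> x / 2" "0 \<le> x" for x q :: real using that by simp
      show "X\<^sup>2 / 4 \<le> X\<^sup>2 - Q * \<delta> powr y" by (rule gen[OF QX zero_le_power2])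
    qed (use d \<delta>0 in auto)
    finally show "(G \<delta>)\<^sup>2 \<le> \<delta>\<^sup>2 * (X\<^sup>2 - Q * \<delta> powr y)" .
  next
    fix \<delta> :: real assume d: "0 < \<delta>" "\<delta> \<le> \<delta>0" and IH: "(G (2 * \<delta>))\<^sup>2 \<le> (2 * \<delta>)\<^sup>2 * (X\<^sup>2 - Q * (2 * \<delta>) powr y)"
    define q where "q = \<delta> powr y"
    define t where "t = (2::real) powr y"
    have q: "0 < q" and t: "0 < t" using d by (auto simp: q_def t_def)
    have tq: "(2 * \<delta>) powr y = t * q" unfolding q_def t_def by (rule powr_mult)
    have IH4: "(G (2 * \<delta>))\<^sup>2 / 4 \<le> \<delta>\<^sup>2 * (X\<^sup>2 - Q * (t * q))"
      using IH unfolding tq power_mult_distrib by simp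
    \<comment> \<open>Dropping the negative term gives the linear bound on \<open>G\<close> that the
      right-hand side of the recursion needs.\<close>
    have "0 \<le> Q * (t * q)" using Q0 q t by simp
    then have "\<delta>\<^sup>2 * (X\<^sup>2 - Q * (t * q)) \<le> \<delta>\<^sup>2 * X\<^sup>2" by (intro mult_left_mono) auto
    also have "\<dots> = (2 * \<delta> * X)\<^sup>2 / 4" by (simp add: power_mult_distrib)
    finally have "(G (2 * \<delta>))\<^sup>2 \<le> (2 * \<delta> * X)\<^sup>2" using IH4 by simp
    then have "G (2 * \<delta>) \<le> 2 * \<delta> * X" by (rule power2_le_imp_le) (use d X0 in simp)
    then have G2: "G \<delta> \<le> 2 * X * \<delta>" using mono[of \<delta> "2 * \<delta>"] d by (simp add: mult_ac)
    have "\<delta> powr (1 + y) = \<delta> powr 1 * \<delta> powr y" by (rule powr_add)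
    then have ds: "\<delta> powr (2 * s) = \<delta> * q" using d by (simp add: y_def q_def)
    have "A * \<delta> powr (2 * s) * N * (N * \<delta> + G \<delta>) \<le> A * \<delta> powr (2 * s) * N * (N * \<delta> + 2 * X * \<delta>)"
      using G2 A N by (intro mult_left_mono) auto
    also have "\<dots> = \<delta>\<^sup>2 * ((A * N * (N + 2 * X)) * q)" unfolding ds by (simp add: power2_eq_square distrib_left mult_ac)
    also have "\<dots> \<le> \<delta>\<^sup>2 * ((Q * (t - 1)) * q)"
      using Qy[folded t_def] q by (intro mult_left_mono mult_right_mono) auto
    finally have e1: "A * \<delta> powr (2 * s) * N * (N * \<delta> + G \<delta>) \<le> \<delta>\<^sup>2 * ((Q * (t - 1)) * q)" .
    have e2: "(G \<delta>)\<^sup>2 \<le> \<delta>\<^sup>2 * (X\<^sup>2 - Q * (t * q)) + \<delta>\<^sup>2 * ((Q * (t - 1)) * q)"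
      by (rule order_trans[OF rec[OF d]]) (rule add_mono[OF IH4 e1])
    \<comment> \<open>The telescoping: - Q t q + Q (t - 1) q = - Q q, so the correction reproduces
      itself at the smaller scale.\<close>
    have e3: "\<delta>\<^sup>2 * (X\<^sup>2 - Q * (t * q)) + \<delta>\<^sup>2 * ((Q * (t - 1)) * q) = \<delta>\<^sup>2 * (X\<^sup>2 - Q * q)"
      unfolding distrib_left[symmetric] by (rule arg_cong) (simp add: right_diff_distrib left_diff_distrib)
    show "(G \<delta>)\<^sup>2 \<le> \<delta>\<^sup>2 * (X\<^sup>2 - Q * \<delta> powr y)" using e2 unfolding e3 q_def[symmetric] .
  qed (use \<delta> in auto)
  have "\<delta>\<^sup>2 * (X\<^sup>2 - Q * \<delta> powr y) \<le> \<delta>\<^sup>2 * X\<^sup>2" using Q0 by (intro mult_left_mono) auto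
  then have "(G \<delta>)\<^sup>2 \<le> (X * \<delta>)\<^sup>2" using * by (simp add: power_mult_distrib mult.commute)
  then have "G \<delta> \<le> X * \<delta>" by (rule power2_le_imp_le) (use X0 \<delta> in simp)
  then show ?thesis unfolding X_def D_def y_def .
qed

text \<open>Insert the decay of first differences into the second difference bound with \<delta>
  equal to the norm of \<open>k\<close>. The full loss in the first differences is linear in the
  bound of the squared second difference, so taking the root leaves only its square root.\<close>

lemma near_solution_modulus2:
  fixes \<Omega> :: "'a::euclidean_space set"
  assumes \<Omega>: "bounded_lipschitz_domain \<Omega>"
  shows "\<exists>C>0. \<exists>\<delta>0>0. \<delta>0 \<le> 1 / 2 \<and> (\<forall>s u N. 0 < s \<longrightarrow> s < 1 \<longrightarrow> 0 < N \<longrightarrow>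
     near_solution s (closure \<Omega>) N u \<longrightarrow>
     L2_norm lborel u \<le> C * N \<and>
     (\<forall>\<tau> k. 0 < \<tau> \<longrightarrow> \<tau> < 1 \<longrightarrow> \<tau> \<le> 2 * s \<longrightarrow> norm k \<le> \<delta>0 \<longrightarrow>
        modulus2 u k \<le> C * N / sqrt (1 - \<tau>) * norm k powr \<tau>) \<and>
     (1 / 2 < s \<longrightarrow> (\<forall>k. norm k \<le> \<delta>0 \<longrightarrow>
        modulus2 u k \<le> C * N / sqrt (2 * s - 1) * norm k powr (s + 1 / 2))))"
proof -
  have K: "bounded (closure \<Omega>)" using \<Omega> by (simp add: bounded_lipschitz_domain_def bounded_closure)
  obtain C1 where C1: "C1 > 0" "\<And>s u N. 0 < s \<Longrightarrow> s < 1 \<Longrightarrow> 0 < N \<Longrightarrow> near_solution s (closure \<Omega>) N u \<Longrightarrow>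
     L2_norm lborel u \<le> C1 * N"
    using near_solution_apriori[OF K] by blast
  \<comment> \<open>A first difference has at most twice the norm of \<open>u\<close>, and that norm
    is at most \<open>C1 * N\<close>.\<close>
  define B where "B = 2 * C1"
  have B: "0 < B" using C1 by (simp add: B_def)
  obtain A \<delta>0 where A: "A > 0" and \<delta>0: "\<delta>0 > 0" "\<delta>0 \<le> 1 / 2"
    and "\<forall>s u N \<delta> k G. 0 < s \<longrightarrow> s < 1 \<longrightarrow> 0 < N \<longrightarrow>
     near_solution s (closure \<Omega>) N u \<longrightarrow> norm k \<le> \<delta> \<longrightarrow> 0 < \<delta> \<longrightarrow> \<delta> \<le> \<delta>0 \<longrightarrow>
     (\<forall>k'. norm k' \<le> \<delta> \<longrightarrow> modulus u k' \<le> G) \<longrightarrow> G \<le> B * N \<longrightarrow>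
     (modulus2 u k)\<^sup>2 \<le> A * \<delta> powr (2 * s) * N * (N * \<delta> + G)"
    using second_difference_bound[OF \<Omega> less_imp_le[OF B]] by (elim exE conjE) (rule that)
  note est = this(4)[rule_format (no_asm)]
  define D where "D = 1 + 12 * A + 2 * B / \<delta>0"
  have D: "1 \<le> D" using A B \<delta>0 by (simp add: D_def)
  define C where "C = max C1 (sqrt (2 * A * D))"
  have C: "0 < C" using C1 by (simp add: C_def)
  have CC: "2 * A * D \<le> C\<^sup>2"
  proof -
    have "(sqrt (2 * A * D))\<^sup>2 \<le> C\<^sup>2" using A D by (intro power_mono) (auto simp: C_def)
    then show ?thesis using A D by simp
  qed
  have main: "L2_norm lborel u \<le> C * N \<and>
     (\<forall>\<tau> k. 0 < \<tau> \<longrightarrow> \<tau> < 1 \<longrightarrow> \<tau> \<le> 2 * s \<longrightarrow> norm k \<le> \<delta>0 \<longrightarrow>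
        modulus2 u k \<le> C * N / sqrt (1 - \<tau>) * norm k powr \<tau>) \<and>
     (1 / 2 < s \<longrightarrow> (\<forall>k. norm k \<le> \<delta>0 \<longrightarrow>
        modulus2 u k \<le> C * N / sqrt (2 * s - 1) * norm k powr (s + 1 / 2)))"
    if s: "0 < s" "s < 1" and N: "0 < N" and u: "near_solution s (closure \<Omega>) N u" for s N u
  proof -
    note uD = near_solutionD(1)[OF u]
    have nu: "L2_norm lborel u \<le> C1 * N" by (rule C1(2)[OF s N u])
    also have "\<dots> \<le> C * N" using N by (intro mult_right_mono) (auto simp: C_def)
    finally have n: "L2_norm lborel u \<le> C * N" .
    define G where "G = sup_modulus u"
    have G: "0 \<le> G \<delta>" "G \<delta> \<le> B * N" if "0 < \<delta>" for \<delta>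
      using that sup_modulus_nonneg[OF uD, of \<delta>] sup_modulus_le_norm[OF uD, of \<delta>] nu by (auto simp: G_def B_def)
    have Gmono: "G \<delta> \<le> G \<delta>'" if "0 < \<delta>" "\<delta> \<le> \<delta>'" for \<delta> \<delta>'
      using that sup_modulus_mono[OF uD, of \<delta> \<delta>'] by (auto simp: G_def)
    have m2: "(modulus2 u k)\<^sup>2 \<le> A * \<delta> powr (2 * s) * N * (N * \<delta> + G \<delta>)"
      if "norm k \<le> \<delta>" "0 < \<delta>" "\<delta> \<le> \<delta>0" for k \<delta>
      using modulus_le_sup_modulus[OF uD] by (intro est[OF s N u that] G that) (auto simp: G_def)
    have rec: "(G \<delta>)\<^sup>2 \<le> (G (2 * \<delta>))\<^sup>2 / 4 + A * \<delta> powr (2 * s) * N * (N * \<delta> + G \<delta>)"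
      if d: "0 < \<delta>" "\<delta> \<le> \<delta>0" for \<delta>
    proof -
      have "(G \<delta>)\<^sup>2 \<le> (G (2 * \<delta>))\<^sup>2 / 4 + A * \<delta> powr (2 * s) * N * (N * \<delta> + G \<delta>) / 4"
        unfolding G_def using d m2[unfolded G_def] by (intro sup_modulus_recursion uD) auto
      moreover have "0 \<le> A * \<delta> powr (2 * s) * N * (N * \<delta> + G \<delta>)" using A N G d by simp
      ultimately show ?thesis by linarith
    qed
    \<comment> \<open>Common end of both regimes: \<open>z\<close> is the distance to the critical
      exponent, \<open>1 - \<tau>\<close> or \<open>2 * s - 1\<close>, and \<open>q\<close> is the
      power of the norm of \<open>k\<close> in question.\<close>
    have fin: "modulus2 u k \<le> C * N / sqrt z * q"
      if z: "0 < z" "z \<le> 1" and q: "0 \<le> q" and le: "(modulus2 u k)\<^sup>2 \<le> A * N * (N + D * N / z) * q\<^sup>2" for k z q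
    proof (rule power2_le_imp_le)
      have "1 \<le> D / z" using D z by (simp add: field_simps)
      then have "N * 1 \<le> N * (D / z)" using N by (intro mult_left_mono) auto
      then have "N \<le> D * N / z" by (simp add: mult_ac)
      then have "N + D * N / z \<le> 2 * (D * N / z)" by linarith
      then have "A * N * (N + D * N / z) * q\<^sup>2 \<le> A * N * (2 * (D * N / z)) * q\<^sup>2"
        using A N by (intro mult_right_mono mult_left_mono) auto
      also have "\<dots> = (2 * A * D) * (N\<^sup>2 / z * q\<^sup>2)" by (simp add: power2_eq_square)
      also have "\<dots> \<le> C\<^sup>2 * (N\<^sup>2 / z * q\<^sup>2)" using CC z by (intro mult_right_mono) auto
      also have "\<dots> = (C * N / sqrt z * q)\<^sup>2" using z by (simp add: power_mult_distrib power_divide)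
      finally show "(modulus2 u k)\<^sup>2 \<le> (C * N / sqrt z * q)\<^sup>2" using le by linarith
      show "0 \<le> C * N / sqrt z * q" using C N z q by simp
    qed
    have m20: "modulus2 u 0 = 0" by (simp add: modulus2_def L2_norm_def)
    have sub: "modulus2 u k \<le> C * N / sqrt (1 - \<tau>) * norm k powr \<tau>"
      if \<tau>: "0 < \<tau>" "\<tau> < 1" "\<tau> \<le> 2 * s" and k: "norm k \<le> \<delta>0" for \<tau> k
    proof (cases "k = 0")
      case False
      define \<delta> where "\<delta> = norm k"
      have d: "0 < \<delta>" "\<delta> \<le> \<delta>0" "\<delta> \<le> 1" using False k \<delta>0 by (auto simp: \<delta>_def)
      have "G \<delta> \<le> (1 + 6 * A + B / \<delta>0) * N / (1 - \<tau>) * \<delta> powr \<tau>"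
        by (rule modulus_decay_subcritical[where G = G and s = s]) (fact \<delta>0 N A B G Gmono rec \<tau> d)+
      also have "\<dots> \<le> D * N / (1 - \<tau>) * \<delta> powr \<tau>"
      proof (intro mult_right_mono divide_right_mono)
        have "0 \<le> B / \<delta>0" "D = 1 + 12 * A + 2 * (B / \<delta>0)" using B \<delta>0 by (auto simp: D_def)
        then show "1 + 6 * A + B / \<delta>0 \<le> D" using A by linarith
      qed (use N \<tau> in auto)
      finally have GX: "G \<delta> \<le> D * N / (1 - \<tau>) * \<delta> powr \<tau>" .
      show ?thesis
      proof (rule fin)
        define q where "q = \<delta> powr \<tau>"
        have "\<delta> powr 1 \<le> \<delta> powr \<tau>" using d \<tau> by (intro powr_mono') auto
        then have dq: "\<delta> \<le> q" using d by (simp add: q_def)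
        have sq: "\<delta> powr (2 * s) \<le> q" unfolding q_def using d \<tau> by (intro powr_mono') auto
        have 1: "N * \<delta> + G \<delta> \<le> (N + D * N / (1 - \<tau>)) * q"
          using GX mult_left_mono[OF dq, of N] N unfolding q_def[symmetric] distrib_right by linarith
        have 2: "A * N * \<delta> powr (2 * s) \<le> A * N * q" using A N sq by (intro mult_left_mono) auto
        have "A * \<delta> powr (2 * s) * N * (N * \<delta> + G \<delta>) = A * N * \<delta> powr (2 * s) * (N * \<delta> + G \<delta>)" by (simp add: mult_ac)
        also have "\<dots> \<le> A * N * q * ((N + D * N / (1 - \<tau>)) * q)"
          by (rule mult_mono[OF 2 1]) (use A N G[OF d(1)] d in \<open>auto simp: q_def\<close>)
        also have "\<dots> = A * N * (N + D * N / (1 - \<tau>)) * (\<delta> powr \<tau>)\<^sup>2"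
          by (simp add: power2_eq_square q_def mult_ac)
        finally show "(modulus2 u k)\<^sup>2 \<le> A * N * (N + D * N / (1 - \<tau>)) * (norm k powr \<tau>)\<^sup>2"
          using m2[of k \<delta>] d by (simp add: \<delta>_def)
      qed (use \<tau> in auto)
    qed (simp add: m20)
    have super: "modulus2 u k \<le> C * N / sqrt (2 * s - 1) * norm k powr (s + 1 / 2)"
      if s2: "1 / 2 < s" and k: "norm k \<le> \<delta>0" for k
    proof (cases "k = 0")
      case False
      define \<delta> where "\<delta> = norm k"
      have d: "0 < \<delta>" "\<delta> \<le> \<delta>0" "\<delta> \<le> 1" using False k \<delta>0 by (auto simp: \<delta>_def)
      have GX: "G \<delta> \<le> D * N / (2 * s - 1) * \<delta>"
        unfolding D_def by (rule modulus_decay_supercritical[where G = G and s = s]) (fact \<delta>0 N A B G Gmono rec s2 s d)+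
      show ?thesis
      proof (rule fin)
        have p: "(\<delta> powr (s + 1 / 2))\<^sup>2 = \<delta> powr (2 * s) * \<delta>"
          using d by (simp add: power2_eq_square powr_add[symmetric]) (simp add: powr_add)
        have "A * \<delta> powr (2 * s) * N * (N * \<delta> + G \<delta>) \<le> A * \<delta> powr (2 * s) * N * (N * \<delta> + D * N / (2 * s - 1) * \<delta>)"
          using A N GX by (intro mult_left_mono) auto
        also have "\<dots> = A * N * (N + D * N / (2 * s - 1)) * (\<delta> powr (s + 1 / 2))\<^sup>2"
          unfolding p by (simp add: algebra_simps)
        finally show "(modulus2 u k)\<^sup>2 \<le> A * N * (N + D * N / (2 * s - 1)) * (norm k powr (s + 1 / 2))\<^sup>2"
          using m2[of k \<delta>] d by (simp add: \<delta>_def)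
      qed (use s s2 in auto)
    qed (simp add: m20)
    show ?thesis using n sub super by simp
  qed
  show ?thesis
    by (rule exI[of _ C], intro conjI C, rule exI[of _ \<delta>0], intro conjI \<delta>0) (use main in simp)
qed

section \<open>Uniqueness of weak derivatives\<close>

lemma has_real_derivative_zero_quadratic:
  fixes f :: "real \<Rightarrow> real"
  assumes "\<And>y. \<bar>y - t\<bar> \<le> 1 \<Longrightarrow> \<bar>f y\<bar> \<le> K * (y - t)\<^sup>2"
  shows "(f has_real_derivative 0) (at t)"
proof -
  have ft: "f t = 0" using assms[of t] by simp
  have "((\<lambda>h. (f (t + h) - f t) / h) \<longlongrightarrow> 0) (at 0)"
  proof (rule Lim_null_comparison)
    show "((\<lambda>h. K * \<bar>h\<bar>) \<longlongrightarrow> 0) (at 0)"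
      by (rule tendsto_eq_intros | simp)+
    have "\<forall>\<^sub>F h in at 0. dist h (0::real) < 1" by (auto simp: eventually_at intro!: exI[of _ 1])
    then show "\<forall>\<^sub>F h in at 0. norm ((f (t + h) - f t) / h) \<le> K * \<bar>h\<bar>"
    proof (rule eventually_mono)
      fix h :: real assume "dist h 0 < 1"
      then have "\<bar>f (t + h)\<bar> \<le> K * \<bar>h\<bar>\<^sup>2" using assms[of "t + h"] by simp
      then show "norm ((f (t + h) - f t) / h) \<le> K * \<bar>h\<bar>"
        using ft by (cases "h = 0") (auto simp: field_simps power2_eq_square)
    qed
  qed
  then show ?thesis by (simp add: DERIV_def)
qed

text \<open>The polynomial and the power of the denominator are carried along so that the family is
  closed under differentiation; smoothness then needs only one derivative computation and an
  induction. The member with p = 1, m = 0 is the usual bump.\<close>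

definition bump :: "real \<Rightarrow> real \<Rightarrow> real \<Rightarrow> real poly \<Rightarrow> nat \<Rightarrow> real \<Rightarrow> real" where
  "bump c a b p m t = (if a < t \<and> t < b
     then poly p t / ((t - a) * (b - t)) ^ m * exp (- c / ((t - a) * (b - t))) else 0)"

lemma exp_minus_le_power:
  fixes y :: real
  assumes "0 < y"
  shows "exp (- y) \<le> fact k / y ^ k"
proof -
  have "y ^ k /\<^sub>R fact k \<le> exp y"
  proof -
    have "(\<Sum>n\<in>{k}. y ^ n /\<^sub>R fact n) \<le> (\<Sum>n. y ^ n /\<^sub>R fact n)"
      using assms by (intro sum_le_suminf summable_exp_generic) auto
    then show ?thesis by (simp add: exp_def)
  qed
  then show ?thesis using assms by (simp add: exp_minus field_simps)
qed

text \<open>With w = (y - a) (b - y), the exponential is at most a multiple of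
  \<open>w ^ (m + 2)\<close>. This cancels the pole \<open>w ^ m\<close> and leaves w^2, and w is at
  most b - a times the distance to either endpoint. It yields derivative 0 at the two gluing
  points.\<close>

lemma bump_quadratic:
  assumes c: "0 < c" and ab: "a < b"
  shows "\<exists>K\<ge>0. \<forall>y. \<bar>bump c a b p m y\<bar> \<le> K * (y - a)\<^sup>2 \<and> \<bar>bump c a b p m y\<bar> \<le> K * (y - b)\<^sup>2"
proof -
  have "compact ((\<lambda>t. \<bar>poly p t\<bar>) ` {a..b})"
    by (intro compact_continuous_image continuous_intros) auto
  then have "bdd_above ((\<lambda>t. \<bar>poly p t\<bar>) ` {a..b})" by (intro bounded_imp_bdd_above compact_imp_bounded)
  then obtain M where "\<forall>t\<in>{a..b}. \<bar>poly p t\<bar> \<le> M" by (auto simp: bdd_above_def)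
  then have M: "\<And>t. t \<in> {a..b} \<Longrightarrow> \<bar>poly p t\<bar> \<le> M" by blast
  have M0: "0 \<le> M" using M[of a] ab by auto
  define D where "D = M * fact (m + 2) / c ^ (m + 2)"
  have D: "0 \<le> D" using M0 c by (simp add: D_def)
  define K where "K = D * (b - a)\<^sup>2"
  have K: "0 \<le> K" using D by (simp add: K_def)
  have "\<bar>bump c a b p m y\<bar> \<le> K * (y - a)\<^sup>2 \<and> \<bar>bump c a b p m y\<bar> \<le> K * (y - b)\<^sup>2" for y
  proof (cases "a < y \<and> y < b")
    case True
    define w where "w = (y - a) * (b - y)"
    have w: "0 < w" using True by (simp add: w_def)
    have "exp (- c / w) \<le> fact (m + 2) / (c / w) ^ (m + 2)"
      using exp_minus_le_power[of "c / w" "m + 2"] c w by simp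
    also have "\<dots> = fact (m + 2) / c ^ (m + 2) * w ^ m * w\<^sup>2"
      by (simp add: power_divide power_add power2_eq_square)
    finally have e: "exp (- c / w) \<le> fact (m + 2) / c ^ (m + 2) * w ^ m * w\<^sup>2" .
    have "\<bar>bump c a b p m y\<bar> = \<bar>poly p y\<bar> / w ^ m * exp (- c / w)"
      using True w by (simp add: bump_def abs_mult flip: w_def)
    also have "\<dots> \<le> M / w ^ m * (fact (m + 2) / c ^ (m + 2) * w ^ m * w\<^sup>2)"
      using True w M0 e M[of y] by (intro mult_mono divide_right_mono) auto
    also have "\<dots> = D * w\<^sup>2" using w by (simp add: D_def)
    finally have bw: "\<bar>bump c a b p m y\<bar> \<le> D * w\<^sup>2" .
    have "w \<le> (b - a) * (y - a)" "w \<le> (b - a) * (b - y)"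
      unfolding w_def using True by (auto simp: mult.commute[of "y - a"] intro!: mult_right_mono mult_left_mono)
    then have "w\<^sup>2 \<le> ((b - a) * (y - a))\<^sup>2" "w\<^sup>2 \<le> ((b - a) * (b - y))\<^sup>2"
      using w by (auto intro!: power_mono)
    then have "w\<^sup>2 \<le> (b - a)\<^sup>2 * (y - a)\<^sup>2" "w\<^sup>2 \<le> (b - a)\<^sup>2 * (y - b)\<^sup>2"
      by (auto simp: power_mult_distrib power2_commute)
    then have "D * w\<^sup>2 \<le> K * (y - a)\<^sup>2" "D * w\<^sup>2 \<le> K * (y - b)\<^sup>2"
      unfolding K_def mult.assoc by (auto intro: mult_left_mono[OF _ D])
    then show ?thesis using bw by linarith
  next
    case False
    then have "bump c a b p m y = 0" unfolding bump_def by (rule if_not_P)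
    then show ?thesis using K by simp
  qed
  then show ?thesis using K by blast
qed

lemma DERIV_bump:
  assumes c: "0 < c" and ab: "a < b"
  shows "\<exists>q n. \<forall>t. (bump c a b p m has_real_derivative bump c a b q n t) (at t)"
proof -
  define W where "W = [:- a, 1:] * [:b, -1:]"
  \<comment> \<open>The numerator of the derivative over the common denominator
    \<open>W ^ (m + 2)\<close>: its terms come from the polynomial, the negative power and the
    exponential.\<close>
  define q where "q = pderiv p * W\<^sup>2 - smult (real m) (p * pderiv W * W) + smult c (p * pderiv W)"
  have pW: "poly W t = (t - a) * (b - t)" for t by (simp add: W_def algebra_simps)
  have "(bump c a b p m has_real_derivative bump c a b q (m + 2) t) (at t)" for t
  proof -
    consider "a < t \<and> t < b" | "t < a \<or> b < t" | "t = a \<or> t = b" by linarith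
    then show ?thesis
    proof cases
      case 1
      define w where "w = poly W t"
      have w: "0 < w" using 1 by (simp add: w_def pW)
      have "((\<lambda>t. poly p t / poly W t ^ m * exp (- c / poly W t)) has_real_derivative
          poly q t / w ^ (m + 2) * exp (- c / w)) (at t)"
        using w unfolding w_def
        by (auto intro!: derivative_eq_intros poly_DERIV simp del: power_Suc)
           (cases m; simp add: q_def field_simps power2_eq_square power_add)
      then have "((\<lambda>t. poly p t / ((t - a) * (b - t)) ^ m * exp (- c / ((t - a) * (b - t)))) has_real_derivative
          bump c a b q (m + 2) t) (at t)"
        using 1 unfolding w_def pW by (simp add: bump_def)
      then show ?thesis
      proof (rule has_field_derivative_transform_within_open[where S = "{a<..<b}"])
        show "\<And>x. x \<in> {a<..<b} \<Longrightarrow> poly p x / ((x - a) * (b - x)) ^ m * exp (- c / ((x - a) * (b - x))) = bump c a b p m x"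
          by (simp add: bump_def)
      qed (use 1 in auto)
    next
      case 2
      have "((\<lambda>_. 0) has_real_derivative bump c a b q (m + 2) t) (at t)"
        using 2 by (auto simp: bump_def)
      then show ?thesis
      proof (rule has_field_derivative_transform_within_open[where S = "- {a..b}"])
        show "\<And>x. x \<in> - {a..b} \<Longrightarrow> 0 = bump c a b p m x" by (auto simp: bump_def)
      qed (use 2 in \<open>auto intro!: open_Compl\<close>)
    next
      case 3
      obtain K where "\<And>y. \<bar>bump c a b p m y\<bar> \<le> K * (y - a)\<^sup>2" "\<And>y. \<bar>bump c a b p m y\<bar> \<le> K * (y - b)\<^sup>2"
        using bump_quadratic[OF c ab] by blast
      then have "(bump c a b p m has_real_derivative 0) (at t)"
        using 3 by (intro has_real_derivative_zero_quadratic[of t _ K]) auto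
      then show ?thesis using 3 by (auto simp: bump_def)
    qed
  qed
  then show ?thesis by blast
qed

definition bump_product :: "real \<Rightarrow> 'a::euclidean_space \<Rightarrow> 'a \<Rightarrow> ('a \<Rightarrow> real poly) \<Rightarrow> ('a \<Rightarrow> nat) \<Rightarrow> 'a \<Rightarrow> real" where
  "bump_product c a b P m x = (\<Prod>i\<in>Basis. bump c (a \<bullet> i) (b \<bullet> i) (P i) (m i) (x \<bullet> i))"

text \<open>A partial derivative in direction \<open>d\<close> changes only the factor of coordinate
  \<open>d\<close>, so the products again form a family closed under differentiation.\<close>

lemma bump_product_derivative:
  fixes a b :: "'a::euclidean_space"
  assumes c: "0 < c" and ab: "\<And>i. i \<in> Basis \<Longrightarrow> a \<bullet> i < b \<bullet> i"
  shows "bump_product c a b P m differentiable (at x)"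
    and "d \<in> Basis \<Longrightarrow> \<exists>P' m'. (\<lambda>x. frechet_derivative (bump_product c a b P m) (at x) d) = bump_product c a b P' m'"
proof -
  define B where "B i p n = bump c (a \<bullet> i) (b \<bullet> i) p n" for i p n
  have "\<forall>i\<in>Basis. \<exists>q n. \<forall>t. (B i (P i) (m i) has_real_derivative B i q n t) (at t)"
    using DERIV_bump[OF c ab] unfolding B_def by blast
  then obtain Q n where Qn: "\<And>i t. i \<in> Basis \<Longrightarrow> (B i (P i) (m i) has_real_derivative B i (Q i) (n i) t) (at t)"
    by metis
  have eq: "bump_product c a b P m = (\<lambda>x. \<Prod>i\<in>Basis. B i (P i) (m i) (x \<bullet> i))"
    by (simp add: bump_product_def[abs_def] B_def)
  have der: "(bump_product c a b P m has_derivative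
      (\<lambda>y. \<Sum>i\<in>Basis. (B i (Q i) (n i) (x \<bullet> i) * (y \<bullet> i)) * (\<Prod>j\<in>Basis - {i}. B j (P j) (m j) (x \<bullet> j)))) (at x)" for x
    unfolding eq
  proof (rule has_derivative_prod)
    fix i :: 'a assume i: "i \<in> Basis"
    have "((\<lambda>x. x \<bullet> i) has_derivative (\<lambda>y. y \<bullet> i)) (at x)" by (auto intro!: derivative_eq_intros)
    from has_derivative_compose[OF this, of "B i (P i) (m i)" "(*) (B i (Q i) (n i) (x \<bullet> i))"]
    show "((\<lambda>x. B i (P i) (m i) (x \<bullet> i)) has_derivative (\<lambda>y. B i (Q i) (n i) (x \<bullet> i) * (y \<bullet> i))) (at x)"
      using Qn[OF i] by (simp add: has_field_derivative_def)
  qed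
  show "bump_product c a b P m differentiable (at x)"
    using der differentiableI by blast
  assume d: "d \<in> Basis"
  have "frechet_derivative (bump_product c a b P m) (at x) d = bump_product c a b (P(d := Q d)) (m(d := n d)) x" for x
  proof -
    have "frechet_derivative (bump_product c a b P m) (at x) d =
      (\<Sum>i\<in>Basis. (B i (Q i) (n i) (x \<bullet> i) * (d \<bullet> i)) * (\<Prod>j\<in>Basis - {i}. B j (P j) (m j) (x \<bullet> j)))"
      by (simp only: frechet_derivative_at[OF der[of x], symmetric])
    also have "\<dots> = (\<Sum>i\<in>Basis. if i = d then B d (Q d) (n d) (x \<bullet> d) * (\<Prod>j\<in>Basis - {d}. B j (P j) (m j) (x \<bullet> j)) else 0)"
      using d by (intro sum.cong) (auto simp: inner_Basis)
    also have "\<dots> = B d (Q d) (n d) (x \<bullet> d) * (\<Prod>j\<in>Basis - {d}. B j (P j) (m j) (x \<bullet> j))"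
      using d by simp
    also have "\<dots> = (\<Prod>i\<in>Basis. B i ((P(d := Q d)) i) ((m(d := n d)) i) (x \<bullet> i))"
      using d by (subst prod.remove[of Basis d]) (auto intro!: prod.cong)
    finally show ?thesis by (simp add: bump_product_def B_def)
  qed
  then show "\<exists>P' m'. (\<lambda>x. frechet_derivative (bump_product c a b P m) (at x) d) = bump_product c a b P' m'"
    by blast
qed

lemma test_function_bump_product:
  fixes a b :: "'a::euclidean_space"
  assumes c: "0 < c" and ab: "\<And>i. i \<in> Basis \<Longrightarrow> a \<bullet> i < b \<bullet> i"
  shows "test_function (bump_product c a b P m)"
proof -
  have "\<exists>P' m'. iter_partial bs (bump_product c a b P m) = bump_product c a b P' m'" if "bs \<in> lists Basis" for bs
    using that
  proof (induction bs)
    case (Cons d bs)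
    then obtain P' m' where "iter_partial bs (bump_product c a b P m) = bump_product c a b P' m'" by auto
    then show ?case using bump_product_derivative(2)[OF c ab, of d P' m'] Cons by auto
  qed auto
  then have "iter_partial bs (bump_product c a b P m) differentiable_on UNIV" if "bs \<in> lists Basis" for bs
    using that bump_product_derivative(1)[OF c ab] by (metis differentiable_at_imp_differentiable_on)
  moreover have "compact (closure {x. bump_product c a b P m x \<noteq> 0})"
  proof -
    have "{x. bump_product c a b P m x \<noteq> 0} \<subseteq> cbox a b"
    proof
      fix x assume "x \<in> {x. bump_product c a b P m x \<noteq> 0}"
      then have "\<And>i. i \<in> Basis \<Longrightarrow> bump c (a \<bullet> i) (b \<bullet> i) (P i) (m i) (x \<bullet> i) \<noteq> 0"
        by (auto simp: bump_product_def)
      then have "\<And>i. i \<in> Basis \<Longrightarrow> a \<bullet> i < x \<bullet> i \<and> x \<bullet> i < b \<bullet> i"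
        unfolding bump_def by meson
      then show "x \<in> cbox a b" by (force simp: mem_box)
    qed
    then show ?thesis using bounded_subset[OF bounded_cbox] by (simp add: compact_closure)
  qed
  ultimately show ?thesis by (simp add: test_function_def)
qed

section \<open>Test functions separate square integrable functions\<close>

lemma test_functionD:
  assumes "test_function \<phi>"
  shows "continuous_on UNIV \<phi>" "\<exists>R>0. \<forall>x. R < norm x \<longrightarrow> \<phi> x = 0"
    and "bs \<in> lists Basis \<Longrightarrow> iter_partial bs \<phi> differentiable_on UNIV"
proof -
  show *: "bs \<in> lists Basis \<Longrightarrow> iter_partial bs \<phi> differentiable_on UNIV" for bs
    using assms by (simp add: test_function_def)
  show "continuous_on UNIV \<phi>" using differentiable_imp_continuous_on[OF *[of "[]"]] by simp
  have "bounded {x. \<phi> x \<noteq> 0}"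
    using assms closure_subset bounded_subset compact_imp_bounded unfolding test_function_def by metis
  then obtain R where "R > 0" "\<And>x. x \<in> {x. \<phi> x \<noteq> 0} \<Longrightarrow> norm x \<le> R" by (meson bounded_pos)
  then show "\<exists>R>0. \<forall>x. R < norm x \<longrightarrow> \<phi> x = 0" by (metis mem_Collect_eq not_le)
qed

lemma L2_space_compact_support:
  fixes f :: "'a::euclidean_space \<Rightarrow> real"
  assumes f: "f \<in> borel_measurable borel" and b: "\<And>x. \<bar>f x\<bar> \<le> M" and z: "\<And>x. R < norm x \<Longrightarrow> f x = 0"
  shows "f \<in> L2_space lborel" "integrable lborel f"
proof -
  have i: "integrable lborel (\<lambda>x::'a. indicator (cball 0 R) x *\<^sub>R (c::real))" for c
    by (rule integrable_real_indicator[THEN integrable_scaleR_left]) (use emeasure_lborel_cball_finite[of "0::'a" R] in auto)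
  show "f \<in> L2_space lborel"
  proof (rule L2_space_dominated[OF _ i[of "M\<^sup>2"]])
    fix x :: 'a
    have "\<bar>f x\<bar>\<^sup>2 \<le> M\<^sup>2" using b by (intro power_mono) auto
    then show "(f x)\<^sup>2 \<le> indicator (cball 0 R) x *\<^sub>R M\<^sup>2"
      using z[of x] by (auto split: split_indicator simp: not_le)
  qed (use f in auto)
  show "integrable lborel f"
  proof (rule Bochner_Integration.integrable_bound[OF i[of M]])
    have "norm (f x) \<le> norm (indicator (cball 0 R) x *\<^sub>R M)" for x
      using b[of x] z[of x] by (auto split: split_indicator simp: not_le)
    then show "AE x in lborel. norm (f x) \<le> norm (indicator (cball 0 R) x *\<^sub>R M)" by auto
  qed (use f in auto)
qed

lemma continuous_compact_support_bounded:
  fixes f :: "'a::euclidean_space \<Rightarrow> real"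
  assumes "continuous_on UNIV f" "\<And>x. R < norm x \<Longrightarrow> f x = 0"
  shows "\<exists>M. \<forall>x. \<bar>f x\<bar> \<le> M"
proof -
  have "compact (f ` cball 0 R)"
    using assms by (intro compact_continuous_image continuous_on_subset[OF assms(1)]) auto
  then obtain M where M: "\<And>y. y \<in> f ` cball 0 R \<Longrightarrow> norm y \<le> M" using compact_imp_bounded bounded_iff by metis
  have "\<bar>f x\<bar> \<le> max 0 M" for x
    using M[of "f x"] assms(2)[of x] by (cases "R < norm x") (auto simp: not_less le_max_iff_disj)
  then show ?thesis by blast
qed

lemma test_function_L2:
  fixes \<phi> :: "'a::euclidean_space \<Rightarrow> real"
  assumes "test_function \<phi>"
  shows "\<phi> \<in> L2_space lborel" "integrable lborel \<phi>" "\<phi> \<in> borel_measurable borel"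
proof -
  obtain R where R: "\<And>x. R < norm x \<Longrightarrow> \<phi> x = 0" using test_functionD(2)[OF assms] by blast
  obtain M where M: "\<And>x. \<bar>\<phi> x\<bar> \<le> M"
    using continuous_compact_support_bounded[OF test_functionD(1)[OF assms] R] by blast
  show m: "\<phi> \<in> borel_measurable borel"
    using test_functionD(1)[OF assms] by (rule borel_measurable_continuous_onI)
  show "\<phi> \<in> L2_space lborel" "integrable lborel \<phi>" by (rule L2_space_compact_support[OF m M R]; assumption)+
qed

text \<open>
  As \<open>c\<close> tends to \<open>0\<close>, the test functions \<open>bump_product c a b\<close> increase to the
  indicator function of the box.
\<close>

lemma integral_box_zero:
  fixes g :: "'a::euclidean_space \<Rightarrow> real"
  assumes g: "g \<in> L2_space lborel"
    and z: "\<And>\<phi>. test_function \<phi> \<Longrightarrow> (LINT x|lborel. g x * \<phi> x) = 0"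
  shows "(LINT x|lborel. g x * indicator (box a b) x) = 0"
proof (cases "\<forall>i\<in>Basis. a \<bullet> i < b \<bullet> i")
  case False
  then have "box a b = {}" by (auto simp: box_eq_empty not_less)
  then show ?thesis by simp
next
  case True
  have [measurable]: "g \<in> borel_measurable borel" using g by (auto simp: L2_space_def)
  define \<phi> where "\<phi> n = bump_product (1 / real (Suc n)) a b (\<lambda>_. 1) (\<lambda>_. 0)" for n
  have tf: "test_function (\<phi> n)" for n unfolding \<phi>_def using True by (intro test_function_bump_product) auto
  have [measurable]: "\<phi> n \<in> borel_measurable borel" for n by (rule test_function_L2[OF tf])
  have in_box: "\<phi> n x = (\<Prod>i\<in>Basis. exp (- (1 / real (Suc n)) / ((x \<bullet> i - a \<bullet> i) * (b \<bullet> i - x \<bullet> i))))" if "x \<in> box a b" for n x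
    using that unfolding \<phi>_def bump_product_def by (intro prod.cong) (auto simp: bump_def mem_box)
  have out_box: "\<phi> n x = 0" if "x \<notin> box a b" for n x
    using that unfolding \<phi>_def bump_product_def by (auto simp: bump_def mem_box)
  have lim: "(\<lambda>n. \<phi> n x) \<longlonglongrightarrow> indicator (box a b) x" for x
  proof (cases "x \<in> box a b")
    case True
    have "(\<lambda>n. \<Prod>i\<in>Basis. exp (- (1 / real (Suc n)) / ((x \<bullet> i - a \<bullet> i) * (b \<bullet> i - x \<bullet> i)))) \<longlonglongrightarrow> (\<Prod>i\<in>(Basis::'a set). 1)"
    proof (rule tendsto_prod)
      fix i :: 'a assume i: "i \<in> Basis"
      have "(x \<bullet> i - a \<bullet> i) * (b \<bullet> i - x \<bullet> i) \<noteq> 0" using True i by (force simp: mem_box)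
      then have "(\<lambda>n. exp (- (1 / real (Suc n)) / ((x \<bullet> i - a \<bullet> i) * (b \<bullet> i - x \<bullet> i)))) \<longlonglongrightarrow> exp (- 0 / ((x \<bullet> i - a \<bullet> i) * (b \<bullet> i - x \<bullet> i)))"
        by (intro tendsto_intros LIMSEQ_Suc[OF lim_1_over_n])
      then show "(\<lambda>n. exp (- (1 / real (Suc n)) / ((x \<bullet> i - a \<bullet> i) * (b \<bullet> i - x \<bullet> i)))) \<longlonglongrightarrow> 1" by simp
    qed
    then show ?thesis using True by (simp add: in_box)
  qed (simp add: out_box)
  have bnd: "\<bar>\<phi> n x\<bar> \<le> indicator (box a b) x" for n x
  proof (cases "x \<in> box a b")
    case True
    have "(\<Prod>i\<in>(Basis::'a set). exp (- (1 / real (Suc n)) / ((x \<bullet> i - a \<bullet> i) * (b \<bullet> i - x \<bullet> i)))) \<le> 1"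
      using True by (intro prod_le_1) (auto simp: mem_box)
    moreover have "0 \<le> (\<Prod>i\<in>(Basis::'a set). exp (- (1 / real (Suc n)) / ((x \<bullet> i - a \<bullet> i) * (b \<bullet> i - x \<bullet> i))))"
      by (intro prod_nonneg) auto
    ultimately show ?thesis using True by (simp add: in_box)
  qed (simp add: out_box)
  have "(\<lambda>n. LINT x|lborel. g x * \<phi> n x) \<longlonglongrightarrow> (LINT x|lborel. g x * indicator (box a b) x)"
  proof (rule integral_dominated_convergence)
    show "integrable lborel (\<lambda>x. (g x)\<^sup>2 + indicator (box a b) x)"
      using L2_spaceD(2)[OF g] by (intro Bochner_Integration.integrable_add integrable_real_indicator) (use emeasure_lborel_box_finite[of a b] in auto)
    show "AE x in lborel. (\<lambda>n. g x * \<phi> n x) \<longlonglongrightarrow> g x * indicator (box a b) x"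
      by (intro AE_I2 tendsto_mult lim tendsto_const)
    show "AE x in lborel. norm (g x * \<phi> n x) \<le> (g x)\<^sup>2 + indicator (box a b) x" for n
    proof (intro AE_I2)
      fix x
      have "\<bar>g x\<bar> * \<bar>\<phi> n x\<bar> \<le> \<bar>g x\<bar> * indicator (box a b) x" by (intro mult_left_mono bnd) auto
      also have "\<dots> \<le> (g x)\<^sup>2 + indicator (box a b) x"
      proof -
        have "0 \<le> (\<bar>g x\<bar> - 1/2)\<^sup>2" by simp
        also have "(\<bar>g x\<bar> - 1/2)\<^sup>2 = (g x)\<^sup>2 - \<bar>g x\<bar> + 1/4" by (simp add: power2_diff power_divide)
        finally have "\<bar>g x\<bar> \<le> (g x)\<^sup>2 + 1" by linarith
        then show ?thesis by (auto split: split_indicator)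
      qed
      finally show "norm (g x * \<phi> n x) \<le> (g x)\<^sup>2 + indicator (box a b) x" by (simp add: abs_mult)
    qed
  qed auto
  then show ?thesis unfolding z[OF tf] by (simp add: LIMSEQ_const_iff)
qed

text \<open>The positive and negative parts of \<open>g\<close> are densities of two measures that
  agree and are finite on boxes. Boxes are stable under intersection and generate the Borel sets, so
  the measures coincide. Equal densities force max 0 g = max 0 (-g), hence g = 0.\<close>

lemma L2_eq_zero_AE_boxes:
  fixes g :: "'a::euclidean_space \<Rightarrow> real"
  assumes g: "g \<in> L2_space lborel"
    and z: "\<And>a b. (LINT x|lborel. g x * indicator (box a b) x) = 0"
  shows "AE x in lborel. g x = 0"
proof -
  have [measurable]: "g \<in> borel_measurable borel" using g by (auto simp: L2_space_def)
  have int: "integrable lborel (\<lambda>x. g x * indicator (box a b) x)" for a b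
  proof (intro L2_integrable_mult[OF g] L2_space_dominated[where g = "indicator (box a b)"])
    show "integrable lborel (indicator (box a b) :: 'a \<Rightarrow> real)"
      by (intro integrable_real_indicator) (use emeasure_lborel_box_finite[of a b] in auto)
  qed (auto split: split_indicator)
  let ?p = "\<lambda>x. ennreal (max 0 (g x))" and ?m = "\<lambda>x. ennreal (max 0 (- g x))"
  have eq: "emeasure (density lborel ?p) (box a b) = emeasure (density lborel ?m) (box a b)"
    and fin: "emeasure (density lborel ?p) (box a b) \<noteq> \<infinity>" for a b
  proof -
    have 1: "integrable lborel (\<lambda>x. max 0 (g x) * indicator (box a b) x)"
      by (rule Bochner_Integration.integrable_bound[OF int[of a b]]) (auto split: split_indicator)
    have 2: "integrable lborel (\<lambda>x. max 0 (- g x) * indicator (box a b) x)"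
      by (rule Bochner_Integration.integrable_bound[OF int[of a b]]) (auto split: split_indicator)
    have "(LINT x|lborel. max 0 (g x) * indicator (box a b) x) - (LINT x|lborel. max 0 (- g x) * indicator (box a b) x) =
      (LINT x|lborel. max 0 (g x) * indicator (box a b) x - max 0 (- g x) * indicator (box a b) x)"
      using 1 2 by simp
    also have "\<dots> = (LINT x|lborel. g x * indicator (box a b) x)"
      by (intro Bochner_Integration.integral_cong) (auto split: split_indicator)
    finally have "(LINT x|lborel. max 0 (g x) * indicator (box a b) x) = (LINT x|lborel. max 0 (- g x) * indicator (box a b) x)"
      using z by simp
    moreover have "emeasure (density lborel ?p) (box a b) = ennreal (LINT x|lborel. max 0 (g x) * indicator (box a b) x)"
      by (subst nn_integral_eq_integral[OF 1, symmetric]) (auto simp: emeasure_density intro!: nn_integral_cong split: split_indicator)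
    moreover have "emeasure (density lborel ?m) (box a b) = ennreal (LINT x|lborel. max 0 (- g x) * indicator (box a b) x)"
      by (subst nn_integral_eq_integral[OF 2, symmetric]) (auto simp: emeasure_density intro!: nn_integral_cong split: split_indicator)
    ultimately show "emeasure (density lborel ?p) (box a b) = emeasure (density lborel ?m) (box a b)"
      "emeasure (density lborel ?p) (box a b) \<noteq> \<infinity>" by auto
  qed
  have "density lborel ?p = density lborel ?m"
  proof (rule measure_eqI_generator_eq[where E = "range (\<lambda>(a, b). box a b :: 'a set)" and \<Omega> = UNIV
      and A = "\<lambda>n. box (- (real n *\<^sub>R One)) (real n *\<^sub>R One)"])
    show "Int_stable (range (\<lambda>(a, b). box a b :: 'a set))"
      by (auto simp: Int_stable_def box_Int_box)
    show "sets (density lborel ?p) = sigma_sets UNIV (range (\<lambda>(a, b). box a b :: 'a set))"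
      "sets (density lborel ?m) = sigma_sets UNIV (range (\<lambda>(a, b). box a b :: 'a set))"
      by (simp_all add: borel_eq_box)
    show "(\<Union>n. box (- (real n *\<^sub>R One)) (real n *\<^sub>R One)) = (UNIV :: 'a set)"
      by (rule UN_box_eq_UNIV)
  qed (use eq fin in auto)
  then have "AE x in lborel. ?p x = ?m x" by (intro sigma_finite_measure.density_unique[OF sigma_finite_lborel]) auto
  then show ?thesis by (rule eventually_mono) (auto simp: max_def split: if_splits)
qed

section \<open>Borel representatives and the norm of weak derivatives\<close>

lemma L2_space_lebesgue_borel:
  fixes u :: "'a::euclidean_space \<Rightarrow> real"
  assumes u: "u \<in> L2_space lebesgue"
  shows "\<exists>v\<in>L2_space lborel. AE x in lborel. u x = v x"
proof -
  obtain v where v: "v \<in> borel_measurable lborel" "AE x in lborel. u x = v x"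
    using completion_ex_borel_measurable_real[of u lborel] u by (auto simp: L2_space_def)
  have "integrable lebesgue (\<lambda>x. (v x)\<^sup>2)"
  proof (rule Bochner_Integration.integrable_cong_AE[THEN iffD1])
    show "integrable lebesgue (\<lambda>x. (u x)\<^sup>2)" using u by (simp add: L2_space_def)
    show "AE x in lebesgue. (u x)\<^sup>2 = (v x)\<^sup>2" using AE_completion[OF v(2)] by (rule eventually_mono) simp
  qed (use u v in \<open>auto simp: L2_space_def intro: measurable_completion\<close>)
  then have "integrable lborel (\<lambda>x. (v x)\<^sup>2)" using v by (subst (asm) integrable_completion) auto
  then show ?thesis using v by (auto simp: L2_space_def)
qed

lemma L2_space_lborel_lebesgue:
  assumes "v \<in> L2_space lborel"
  shows "v \<in> L2_space lebesgue" "L2_norm lebesgue v = L2_norm lborel v"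
  using assms by (auto simp: L2_space_def L2_norm_def integrable_completion integral_completion intro: measurable_completion)

lemma integral_lebesgue_cong_lborel:
  assumes f: "f \<in> borel_measurable lebesgue" and g: "g \<in> borel_measurable lborel" and eq: "AE x in lborel. f x = (g x :: real)"
  shows "(LINT x|lebesgue. f x) = (LINT x|lborel. g x)"
proof -
  have "(LINT x|lebesgue. f x) = (LINT x|lebesgue. g x)"
    using f g AE_completion[OF eq] by (intro integral_cong_AE) (auto intro: measurable_completion)
  also have "\<dots> = (LINT x|lborel. g x)" using g by (rule integral_completion)
  finally show ?thesis .
qed

text \<open>\<open>Hk_norm\<close> selects its weak derivatives by \<open>SOME\<close>; this result
  makes their norms computable from any derivative exhibited explicitly.\<close>

lemma weak_partial_unique:
  fixes v :: "'a::euclidean_space \<Rightarrow> real"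
  assumes w: "weak_partial bs v g" "weak_partial bs v g'"
    and g: "g \<in> L2_space lebesgue" and g': "g' \<in> L2_space lborel"
  shows "L2_norm lebesgue g = L2_norm lborel g'"
proof -
  obtain h where h: "h \<in> L2_space lborel" "AE x in lborel. g x = h x" using L2_space_lebesgue_borel[OF g] by blast
  have gm: "g \<in> borel_measurable lebesgue" using g by (simp add: L2_space_def)
  have "AE x in lborel. h x - g' x = 0"
  proof (intro L2_eq_zero_AE_boxes integral_box_zero L2_space_diff h(1) g')
    fix \<phi> :: "'a \<Rightarrow> real" assume \<phi>: "test_function \<phi>"
    note \<phi>L = test_function_L2[OF \<phi>]
    have "(LINT x|lebesgue. g x * \<phi> x) = (LINT x|lebesgue. g' x * \<phi> x)"
      using w \<phi> unfolding weak_partial_def by force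
    moreover have "(LINT x|lebesgue. g x * \<phi> x) = (LINT x|lborel. h x * \<phi> x)"
      using gm \<phi>L(3) h by (intro integral_lebesgue_cong_lborel borel_measurable_times)
         (auto simp: L2_space_def intro: measurable_completion elim!: eventually_mono)
    moreover have "(LINT x|lebesgue. g' x * \<phi> x) = (LINT x|lborel. g' x * \<phi> x)"
      using g' \<phi>L(3) by (intro integral_completion) (auto simp: L2_space_def)
    moreover have "(LINT x|lborel. (h x - g' x) * \<phi> x) = (LINT x|lborel. h x * \<phi> x) - (LINT x|lborel. g' x * \<phi> x)"
      using L2_integrable_mult[OF h(1) \<phi>L(1)] L2_integrable_mult[OF g' \<phi>L(1)] by (simp add: left_diff_distrib)
    ultimately show "(LINT x|lborel. (h x - g' x) * \<phi> x) = 0" by simp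
  qed
  with h(2) have "AE x in lborel. g x = g' x" by eventually_elim simp
  then have "(LINT x|lebesgue. (g x)\<^sup>2) = (LINT x|lborel. (g' x)\<^sup>2)"
    using gm g' by (intro integral_lebesgue_cong_lborel) (auto simp: L2_space_def)
  then show ?thesis by (simp add: L2_norm_def)
qed

section \<open>Mollification\<close>

text \<open>Difference quotients of an integrable function have integral 0 by translation
  invariance. The mean value theorem bounds them by \<open>M\<close> on a fixed ball, so dominated
  convergence passes to the derivative.\<close>

lemma integral_directional_derivative:
  fixes \<psi> \<psi>' :: "'a::euclidean_space \<Rightarrow> real"
  assumes d: "\<And>x. ((\<lambda>t. \<psi> (x + t *\<^sub>R i)) has_real_derivative \<psi>' x) (at 0)"
    and m [measurable]: "\<psi> \<in> borel_measurable borel" "\<psi>' \<in> borel_measurable borel"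
    and M: "\<And>x. \<bar>\<psi>' x\<bar> \<le> M" and z: "\<And>x. R < norm x \<Longrightarrow> \<psi> x = 0" and int: "integrable lborel \<psi>"
    and i: "norm i \<le> 1"
  shows "(LINT x|lborel. \<psi>' x) = 0"
proof -
  have M0: "0 \<le> M" using M[of 0] by linarith
  have dall: "((\<lambda>t. \<psi> (x + t *\<^sub>R i)) has_real_derivative \<psi>' (x + r *\<^sub>R i)) (at r)" for x r
  proof -
    have "((\<lambda>t. \<psi> (x + (t + r) *\<^sub>R i)) has_real_derivative \<psi>' (x + r *\<^sub>R i)) (at 0)"
      using d[of "x + r *\<^sub>R i"] by (simp add: scaleR_add_left add_ac)
    then show ?thesis using DERIV_shift[of "\<lambda>t. \<psi> (x + t *\<^sub>R i)" "\<psi>' (x + r *\<^sub>R i)" 0 r] by simp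
  qed
  define \<tau> where "\<tau> n = 1 / real (Suc n)" for n
  have \<tau>: "0 < \<tau> n" "\<tau> n \<le> 1" for n by (auto simp: \<tau>_def)
  have \<tau>0: "\<tau> \<longlonglongrightarrow> 0" unfolding \<tau>_def by (rule LIMSEQ_Suc[OF lim_1_over_n])
  define q where "q n x = (\<psi> (x + \<tau> n *\<^sub>R i) - \<psi> x) / \<tau> n" for n x
  have qlim: "(\<lambda>n. q n x) \<longlonglongrightarrow> \<psi>' x" for x
  proof -
    have "((\<lambda>h. (\<psi> (x + h *\<^sub>R i) - \<psi> x) / h) \<longlongrightarrow> \<psi>' x) (at 0)"
      using d[of x] by (simp add: DERIV_def)
    moreover have "filterlim \<tau> (at 0) sequentially"
      using \<tau>0 \<tau>(1) by (intro filterlim_atI) (auto intro!: always_eventually simp: less_imp_neq[symmetric])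
    ultimately show ?thesis unfolding q_def by (rule filterlim_compose)
  qed
  have qb: "\<bar>q n x\<bar> \<le> M * indicator (cball 0 (R + 1)) x" for n x
  proof (cases "norm x \<le> R + 1")
    case True
    obtain z where "\<psi> (x + \<tau> n *\<^sub>R i) - \<psi> (x + 0 *\<^sub>R i) = (\<tau> n - 0) * \<psi>' (x + z *\<^sub>R i)"
      using MVT2[OF \<tau>(1)[of n], of "\<lambda>t. \<psi> (x + t *\<^sub>R i)" "\<lambda>t. \<psi>' (x + t *\<^sub>R i)"] dall by blast
    then have "q n x = \<psi>' (x + z *\<^sub>R i)" using \<tau>(1)[of n] by (simp add: q_def)
    then show ?thesis using M True by simp
  next
    case False
    have "norm (\<tau> n *\<^sub>R i) \<le> 1" using \<tau>[of n] i by (simp add: mult_le_one)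
    then have "R < norm (x + \<tau> n *\<^sub>R i)" using norm_diff_ineq[of x "\<tau> n *\<^sub>R i"] False by linarith
    then show ?thesis using z[of x] z[of "x + \<tau> n *\<^sub>R i"] False M0 by (simp add: q_def)
  qed
  have "(\<lambda>n. LINT x|lborel. q n x) \<longlonglongrightarrow> (LINT x|lborel. \<psi>' x)"
  proof (rule integral_dominated_convergence)
    show "integrable lborel (\<lambda>x. M * indicator (cball 0 (R + 1)) (x :: 'a))"
      using emeasure_lborel_cball_finite[of "0::'a" "R + 1"] by (intro integrable_mult_right integrable_real_indicator) auto
    show "q n \<in> borel_measurable lborel" for n unfolding q_def by measurable
  qed (use qlim qb in auto)
  moreover have "(LINT x|lborel. q n x) = 0" for n
    unfolding q_def using int integrable_lborel_translate[OF int, of "\<tau> n *\<^sub>R i"] integral_lborel_translate[OF m(1), of "\<tau> n *\<^sub>R i"]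
    by simp
  ultimately show ?thesis by (simp add: LIMSEQ_const_iff)
qed

lemma iter_partial_support:
  fixes \<phi> :: "'a::euclidean_space \<Rightarrow> real"
  assumes z: "\<And>x. R < norm x \<Longrightarrow> \<phi> x = 0"
  shows "R < norm x \<Longrightarrow> iter_partial bs \<phi> x = 0"
proof (induction bs arbitrary: x)
  case (Cons b bs)
  have "((\<lambda>_. 0) has_derivative (\<lambda>_. 0 :: real)) (at x)" by simp
  then have "(iter_partial bs \<phi> has_derivative (\<lambda>_. 0)) (at x)"
  proof (rule has_derivative_transform_within_open)
    show "open {x. R < norm x}" by (intro open_Collect_less continuous_intros)
  qed (use Cons in auto)
  from frechet_derivative_at[OF this] show ?case by (metis iter_partial.simps(2))
qed (simp add: z)

text \<open>Convolution of \<open>u\<close> with the reflected kernel. Sampling at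
  \<open>x + h\<close> lets differences of \<open>u\<close> appear directly when the kernel has mean
  zero or is even.\<close>

definition kernel_average :: "('a::euclidean_space \<Rightarrow> real) \<Rightarrow> ('a \<Rightarrow> real) \<Rightarrow> 'a \<Rightarrow> real" where
  "kernel_average k u x = (LINT h|lborel. k h * u (x + h))"

lemma borel_measurable_kernel_average [measurable]:
  assumes [measurable]: "k \<in> borel_measurable borel" "u \<in> borel_measurable borel"
  shows "kernel_average k u \<in> borel_measurable borel"
  unfolding kernel_average_def[abs_def] by measurable

lemma integrable_bounded_mult:
  fixes f k :: "'a \<Rightarrow> real"
  assumes f: "integrable M f" and k: "k \<in> borel_measurable M" and b: "\<And>x. \<bar>k x\<bar> \<le> B"
  shows "integrable M (\<lambda>x. k x * f x)"
proof (rule Bochner_Integration.integrable_bound)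
  show "integrable M (\<lambda>x. B * f x)" using f by simp
  have "0 \<le> B" using b order_trans[OF abs_ge_zero] by blast
  then show "AE x in M. norm (k x * f x) \<le> norm (B * f x)"
    using b by (auto simp: abs_mult intro!: mult_right_mono)
qed (use f k in auto)

lemma kernel_average_eq:
  assumes [measurable]: "k \<in> borel_measurable borel" "u \<in> borel_measurable borel"
  shows "kernel_average k u x = (LINT y|lborel. k (y - x) * u y)"
  using integral_lborel_translate[of "\<lambda>y. k (y - x) * u y" x]
  by (simp add: kernel_average_def add.commute)

lemma integrable_product_kernel:
  fixes f g :: "'a::euclidean_space \<Rightarrow> real" and k :: "'a \<times> 'a \<Rightarrow> real"
  assumes f: "integrable lborel f" and g: "integrable lborel g"
    and k [measurable]: "k \<in> borel_measurable (lborel \<Otimes>\<^sub>M lborel)" and b: "\<And>x. \<bar>k x\<bar> \<le> B"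
  shows "integrable (lborel \<Otimes>\<^sub>M lborel) (\<lambda>(x, y). k (x, y) * (f x * g y))"
proof -
  have [measurable]: "f \<in> borel_measurable borel" "g \<in> borel_measurable borel" using f g by auto
  have "(\<integral>\<^sup>+ p. ennreal (norm ((\<lambda>(x, y). f x * g y) p)) \<partial>(lborel \<Otimes>\<^sub>M lborel)) =
    (\<integral>\<^sup>+ x. \<integral>\<^sup>+ y. ennreal \<bar>f x\<bar> * ennreal \<bar>g y\<bar> \<partial>lborel \<partial>lborel)"
    by (subst lborel.nn_integral_fst[symmetric]) (auto simp: abs_mult ennreal_mult intro!: nn_integral_cong)
  also have "\<dots> = (\<integral>\<^sup>+ x. ennreal \<bar>f x\<bar> \<partial>lborel) * (\<integral>\<^sup>+ y. ennreal \<bar>g y\<bar> \<partial>lborel)"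
    by (simp add: nn_integral_cmult nn_integral_multc)
  also have "\<dots> < \<infinity>" using f g by (simp add: integrable_iff_bounded ennreal_mult_less_top)
  finally have "integrable (lborel \<Otimes>\<^sub>M lborel) (\<lambda>(x, y). f x * g y)"
    by (subst integrable_iff_bounded) auto
  from integrable_bounded_mult[OF this k b] show ?thesis by (simp add: case_prod_unfold)
qed

text \<open>For fixed y the function k(y - x) \<psi>(x) has directional derivative k(y - x)
  \<psi>'(x) - k'(y - x) \<psi>(x), which integrates to 0; Fubini does the rest. The reflection in
  the kernel cancels the usual minus sign.\<close>

lemma kernel_average_by_parts:
  fixes k k' u \<psi> \<psi>' :: "'a::euclidean_space \<Rightarrow> real"
  assumes k: "continuous_on UNIV k" "continuous_on UNIV k'" "\<And>x. \<bar>k x\<bar> \<le> B" "\<And>x. \<bar>k' x\<bar> \<le> B"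
      "\<And>x. ((\<lambda>t. k (x + t *\<^sub>R i)) has_real_derivative k' x) (at 0)"
    and u: "integrable lborel u"
    and \<psi>: "continuous_on UNIV \<psi>" "continuous_on UNIV \<psi>'" "\<And>x. R < norm x \<Longrightarrow> \<psi> x = 0" "\<And>x. R < norm x \<Longrightarrow> \<psi>' x = 0"
      "\<And>x. ((\<lambda>t. \<psi> (x + t *\<^sub>R i)) has_real_derivative \<psi>' x) (at 0)"
    and i: "norm i \<le> 1"
  shows "(LINT x|lborel. kernel_average k u x * \<psi>' x) = (LINT x|lborel. kernel_average k' u x * \<psi> x)"
proof -
  have [measurable]: "k \<in> borel_measurable borel" "k' \<in> borel_measurable borel"
    "\<psi> \<in> borel_measurable borel" "\<psi>' \<in> borel_measurable borel" "u \<in> borel_measurable borel"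
    using k(1,2) \<psi>(1,2) u by (auto intro: borel_measurable_continuous_onI)
  obtain M where M: "\<And>x. \<bar>\<psi> x\<bar> \<le> M" using continuous_compact_support_bounded[OF \<psi>(1,3)] by blast
  obtain M' where M': "\<And>x. \<bar>\<psi>' x\<bar> \<le> M'" using continuous_compact_support_bounded[OF \<psi>(2,4)] by blast
  have i\<psi>: "integrable lborel \<psi>" by (rule L2_space_compact_support(2)[of \<psi> M R]) (use M \<psi>(3) in auto)
  have i\<psi>': "integrable lborel \<psi>'" by (rule L2_space_compact_support(2)[of \<psi>' M' R]) (use M' \<psi>(4) in auto)
  have B0: "0 \<le> B" using k(3)[of 0] by linarith
  have inner: "(LINT x|lborel. k (y - x) * \<psi>' x) = (LINT x|lborel. k' (y - x) * \<psi> x)" for y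
  proof -
    have 1: "integrable lborel (\<lambda>x. k (y - x) * \<psi>' x)" by (rule integrable_bounded_mult[OF i\<psi>' _ k(3)]) auto
    have 2: "integrable lborel (\<lambda>x. k' (y - x) * \<psi> x)" by (rule integrable_bounded_mult[OF i\<psi> _ k(4)]) auto
    have 3: "integrable lborel (\<lambda>x. k (y - x) * \<psi> x)" by (rule integrable_bounded_mult[OF i\<psi> _ k(3)]) auto
    have "(LINT x|lborel. k (y - x) * \<psi>' x - k' (y - x) * \<psi> x) = 0"
    proof (rule integral_directional_derivative[where \<psi> = "\<lambda>x. k (y - x) * \<psi> x" and M = "B * M' + B * M" and R = R])
      fix x
      have f: "((\<lambda>t. k ((y - x) + t *\<^sub>R i)) has_real_derivative k' (y - x)) (at (- 0))"
        using k(5)[of "y - x"] by simp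
      have "((\<lambda>t. - t) has_real_derivative - 1) (at (0::real))" by (auto intro!: derivative_eq_intros)
      from DERIV_chain2[OF f this] have "((\<lambda>t. k (y - (x + t *\<^sub>R i))) has_real_derivative - k' (y - x)) (at 0)"
        by (simp add: algebra_simps)
      from DERIV_mult[OF this \<psi>(5)[of x]]
      show "((\<lambda>t. k (y - (x + t *\<^sub>R i)) * \<psi> (x + t *\<^sub>R i)) has_real_derivative k (y - x) * \<psi>' x - k' (y - x) * \<psi> x) (at 0)"
        by (simp add: algebra_simps)
      have "\<bar>k (y - x) * \<psi>' x\<bar> \<le> B * M'" "\<bar>k' (y - x) * \<psi> x\<bar> \<le> B * M"
        unfolding abs_mult using k(3,4) M M' B0 by (auto intro!: mult_mono)
      then show "\<bar>k (y - x) * \<psi>' x - k' (y - x) * \<psi> x\<bar> \<le> B * M' + B * M" by linarith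
    qed (use 3 i \<psi>(3) in auto)
    then show ?thesis using 1 2 by simp
  qed
  have sw: "(LINT x|lborel. kernel_average K u x * \<eta> x) = (LINT y|lborel. u y * (LINT x|lborel. K (y - x) * \<eta> x))"
    if [measurable]: "K \<in> borel_measurable borel" and Kb: "\<And>x. \<bar>K x\<bar> \<le> B" and \<eta>: "integrable lborel \<eta>" for K \<eta> :: "'a \<Rightarrow> real"
  proof -
    have [measurable]: "\<eta> \<in> borel_measurable borel" using \<eta> by auto
    have int: "integrable (lborel \<Otimes>\<^sub>M lborel) (\<lambda>(x, y). K (y - x) * (\<eta> x * u y))"
      using integrable_product_kernel[OF \<eta> u, of "\<lambda>(x, y). K (y - x)" B] Kb by auto
    have "(LINT x|lborel. kernel_average K u x * \<eta> x) = (LINT x|lborel. LINT y|lborel. K (y - x) * (\<eta> x * u y))"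
      by (simp add: kernel_average_eq mult_ac flip: integral_mult_right_zero)
    also have "\<dots> = (LINT y|lborel. LINT x|lborel. K (y - x) * (\<eta> x * u y))"
      by (rule lborel_pair.Fubini_integral[symmetric, OF int])
    also have "\<dots> = (LINT y|lborel. u y * (LINT x|lborel. K (y - x) * \<eta> x))"
      by (simp add: mult_ac flip: integral_mult_right_zero)
    finally show ?thesis .
  qed
  show ?thesis using sw[OF _ k(3) i\<psi>'] sw[OF _ k(4) i\<psi>] inner by simp
qed

text \<open>Minkowski's integral inequality for the mean square norm, from Cauchy-Schwarz with |k|
  split into two square roots and Tonelli. The general family \<open>D\<close> covers translates,
  first differences and second differences at once, and it is estimated only where the kernel is
  nonzero.\<close>

lemma kernel_average_L2:
  fixes k :: "'a::euclidean_space \<Rightarrow> real" and D :: "'a \<Rightarrow> 'a \<Rightarrow> real"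
  assumes k [measurable]: "k \<in> borel_measurable borel" and D [measurable]: "case_prod D \<in> borel_measurable (lborel \<Otimes>\<^sub>M lborel)"
    and \<kappa>: "(\<integral>\<^sup>+h. ennreal \<bar>k h\<bar> \<partial>lborel) \<le> ennreal \<kappa>" "0 \<le> \<kappa>" and S: "0 \<le> S"
    and D2: "\<And>h. k h \<noteq> 0 \<Longrightarrow> (\<integral>\<^sup>+x. ennreal ((D h x)\<^sup>2) \<partial>lborel) \<le> ennreal (S\<^sup>2)"
  shows "(\<lambda>x. LINT h|lborel. k h * D h x) \<in> L2_space lborel"
    "L2_norm lborel (\<lambda>x. LINT h|lborel. k h * D h x) \<le> \<kappa> * S"
proof -
  define g where "g x = (LINT h|lborel. k h * D h x)" for x
  have [measurable]: "(\<lambda>(h, x). D h x) \<in> borel_measurable (borel \<Otimes>\<^sub>M borel)"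
    using D by (simp add: measurable_cong_sets[OF sets_pair_measure_cong[OF sets_lborel sets_lborel] refl])
  have [measurable]: "g \<in> borel_measurable borel" unfolding g_def[abs_def] by measurable
  have "(\<integral>\<^sup>+x. ennreal ((g x)\<^sup>2) \<partial>lborel) \<le> (\<integral>\<^sup>+x. ennreal \<kappa> * (\<integral>\<^sup>+h. ennreal \<bar>k h\<bar> * ennreal ((D h x)\<^sup>2) \<partial>lborel) \<partial>lborel)"
  proof (rule nn_integral_mono)
    fix x :: 'a
    have "ennreal \<bar>g x\<bar> \<le> (\<integral>\<^sup>+h. ennreal \<bar>k h * D h x\<bar> \<partial>lborel)"
    proof (cases "integrable lborel (\<lambda>h. k h * D h x)")
      case True
      then show ?thesis using integral_norm_bound_ennreal[OF True] by (simp add: g_def)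
    qed (simp add: g_def not_integrable_integral_eq)
    also have "\<dots> = (\<integral>\<^sup>+h. ennreal (sqrt \<bar>k h\<bar>) * ennreal (sqrt \<bar>k h\<bar> * \<bar>D h x\<bar>) \<partial>lborel)"
      by (intro nn_integral_cong) (simp add: abs_mult ennreal_mult[symmetric] mult.assoc[symmetric])
    finally have "(ennreal \<bar>g x\<bar>)\<^sup>2 \<le> (\<integral>\<^sup>+h. ennreal (sqrt \<bar>k h\<bar>) * ennreal (sqrt \<bar>k h\<bar> * \<bar>D h x\<bar>) \<partial>lborel)\<^sup>2"
      by (intro power_mono) auto
    also have "\<dots> \<le> (\<integral>\<^sup>+h. (ennreal (sqrt \<bar>k h\<bar>))\<^sup>2 \<partial>lborel) * (\<integral>\<^sup>+h. (ennreal (sqrt \<bar>k h\<bar> * \<bar>D h x\<bar>))\<^sup>2 \<partial>lborel)"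
      by (rule Cauchy_Schwarz_nn_integral) measurable
    also have "\<dots> = (\<integral>\<^sup>+h. ennreal \<bar>k h\<bar> \<partial>lborel) * (\<integral>\<^sup>+h. ennreal \<bar>k h\<bar> * ennreal ((D h x)\<^sup>2) \<partial>lborel)"
      by (simp add: ennreal_power power_mult_distrib ennreal_mult)
    also have "\<dots> \<le> ennreal \<kappa> * (\<integral>\<^sup>+h. ennreal \<bar>k h\<bar> * ennreal ((D h x)\<^sup>2) \<partial>lborel)"
      by (intro mult_right_mono \<kappa>(1)) auto
    finally show "ennreal ((g x)\<^sup>2) \<le> ennreal \<kappa> * (\<integral>\<^sup>+h. ennreal \<bar>k h\<bar> * ennreal ((D h x)\<^sup>2) \<partial>lborel)"
      by (simp add: ennreal_power)
  qed
  also have "\<dots> = ennreal \<kappa> * (\<integral>\<^sup>+x. \<integral>\<^sup>+h. ennreal \<bar>k h\<bar> * ennreal ((D h x)\<^sup>2) \<partial>lborel \<partial>lborel)"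
    by (rule nn_integral_cmult) measurable
  also have "(\<integral>\<^sup>+x. \<integral>\<^sup>+h. ennreal \<bar>k h\<bar> * ennreal ((D h x)\<^sup>2) \<partial>lborel \<partial>lborel) =
      (\<integral>\<^sup>+h. \<integral>\<^sup>+x. ennreal \<bar>k h\<bar> * ennreal ((D h x)\<^sup>2) \<partial>lborel \<partial>lborel)"
    by (rule lborel_pair.Fubini') measurable
  also have "\<dots> = (\<integral>\<^sup>+h. ennreal \<bar>k h\<bar> * (\<integral>\<^sup>+x. ennreal ((D h x)\<^sup>2) \<partial>lborel) \<partial>lborel)"
    by (intro nn_integral_cong nn_integral_cmult) measurable
  also have "\<dots> \<le> (\<integral>\<^sup>+h. ennreal \<bar>k h\<bar> * ennreal (S\<^sup>2) \<partial>lborel)"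
  proof (rule nn_integral_mono)
    fix h :: 'a
    show "ennreal \<bar>k h\<bar> * (\<integral>\<^sup>+x. ennreal ((D h x)\<^sup>2) \<partial>lborel) \<le> ennreal \<bar>k h\<bar> * ennreal (S\<^sup>2)"
      by (cases "k h = 0") (auto intro!: mult_left_mono D2)
  qed
  also have "\<dots> = (\<integral>\<^sup>+h. ennreal \<bar>k h\<bar> \<partial>lborel) * ennreal (S\<^sup>2)" by (rule nn_integral_multc) measurable
  also have "\<dots> \<le> ennreal \<kappa> * ennreal (S\<^sup>2)" by (intro mult_right_mono \<kappa>) auto
  finally have "(\<integral>\<^sup>+x. ennreal ((g x)\<^sup>2) \<partial>lborel) \<le> ennreal \<kappa> * (ennreal \<kappa> * ennreal (S\<^sup>2))"
    by (metis (no_types, lifting) mult_left_mono zero_le order_trans)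
  also have "\<dots> = ennreal ((\<kappa> * S)\<^sup>2)"
    using \<kappa>(2) S by (simp add: ennreal_mult[symmetric] power2_eq_square mult_ac)
  finally have le: "(\<integral>\<^sup>+x. ennreal ((g x)\<^sup>2) \<partial>lborel) \<le> ennreal ((\<kappa> * S)\<^sup>2)" .
  then have "g \<in> L2_space lborel" by (intro L2_spaceI_nn) (auto intro: le_less_trans)
  moreover from L2_norm_le_nn[OF this le] have "L2_norm lborel g \<le> \<kappa> * S" using \<kappa> S by simp
  ultimately show "(\<lambda>x. LINT h|lborel. k h * D h x) \<in> L2_space lborel"
    "L2_norm lborel (\<lambda>x. LINT h|lborel. k h * D h x) \<le> \<kappa> * S" by (simp_all add: g_def[abs_def])
qed

section \<open>A twice continuously differentiable mollifier\<close>

lemma has_real_derivative_max_power: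
  "((\<lambda>r. (max 0 r) ^ (n + 2)) has_real_derivative real (n + 2) * (max 0 r) ^ (n + 1)) (at r)"
proof -
  consider "r > 0" | "r < 0" | "r = 0" by linarith
  then show ?thesis
  proof cases
    case 1
    have "((\<lambda>r. r ^ (n + 2)) has_real_derivative real (n + 2) * r ^ (n + 1)) (at r)"
      using DERIV_pow[of "n + 2" r] by simp
    then have "((\<lambda>r. (max 0 r) ^ (n + 2)) has_real_derivative real (n + 2) * r ^ (n + 1)) (at r)"
      by (rule has_field_derivative_transform_within_open[where S = "{0<..}"]) (use 1 in auto)
    then show ?thesis using 1 by simp
  next
    case 2
    have "((\<lambda>_. 0) has_real_derivative 0) (at r)" by simp
    then have "((\<lambda>r. (max 0 r) ^ (n + 2)) has_real_derivative 0) (at r)"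
      by (rule has_field_derivative_transform_within_open[where S = "{..<0}"]) (use 2 in auto)
    then show ?thesis using 2 by simp
  next
    case 3
    have "((\<lambda>r::real. (max 0 r) ^ (n + 2)) has_real_derivative 0) (at 0)"
    proof (rule has_real_derivative_zero_quadratic[where K = 1])
      fix y :: real assume y: "\<bar>y - 0\<bar> \<le> 1"
      have "(max 0 y) ^ n * (max 0 y)\<^sup>2 \<le> 1 * y\<^sup>2"
        using y by (intro mult_mono power_le_one) (auto simp: max_def)
      then show "\<bar>(max 0 y) ^ (n + 2)\<bar> \<le> 1 * (y - 0)\<^sup>2" unfolding power_add by simp
    qed
    then show ?thesis using 3 by simp
  qed
qed

definition quad_bump :: "'a::euclidean_space \<Rightarrow> real" where
  "quad_bump x = max 0 (1 - x \<bullet> x)"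

text \<open>Only two derivatives fall on the kernel. The third power of the truncated paraboloid
  makes them continuous and explicit, and both the function and its second partials are
  even.\<close>

definition mollifier :: "'a::euclidean_space \<Rightarrow> real" where
  "mollifier x = quad_bump x ^ 3"

definition mollifier_partial :: "'a::euclidean_space \<Rightarrow> 'a \<Rightarrow> real" where
  "mollifier_partial i x = - 6 * (x \<bullet> i) * quad_bump x ^ 2"

definition mollifier_partial2 :: "'a::euclidean_space \<Rightarrow> 'a \<Rightarrow> 'a \<Rightarrow> real" where
  "mollifier_partial2 i j x = - 6 * (i \<bullet> j) * quad_bump x ^ 2 + 24 * (x \<bullet> i) * (x \<bullet> j) * quad_bump x"

lemma quad_bump_bounds: "0 \<le> quad_bump x" "quad_bump x \<le> 1"
  by (auto simp: quad_bump_def)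

lemma quad_bump_outside: "1 < norm x \<Longrightarrow> quad_bump x = 0"
  by (simp add: quad_bump_def dot_square_norm)

lemma quad_bump_inside: "norm x \<le> 1 / 2 \<Longrightarrow> 3 / 4 \<le> quad_bump x"
  using power_mono[of "norm x" "1/2" 2] by (simp add: quad_bump_def dot_square_norm power_divide)

lemma mollifier_continuous:
  "continuous_on UNIV (mollifier :: 'a::euclidean_space \<Rightarrow> real)"
  "continuous_on UNIV (mollifier_partial (i :: 'a))"
  "continuous_on UNIV (mollifier_partial2 (i :: 'a) j)"
  unfolding mollifier_def[abs_def] mollifier_partial_def[abs_def] mollifier_partial2_def[abs_def] quad_bump_def[abs_def]
  by (intro continuous_intros)+

lemma mollifier_outside:
  assumes "1 < norm x"
  shows "mollifier x = 0" "mollifier_partial i x = 0" "mollifier_partial2 i j x = 0"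
  by (simp_all add: mollifier_def mollifier_partial_def mollifier_partial2_def quad_bump_outside[OF assms])

lemma mollifier_bounds:
  fixes x i j :: "'a::euclidean_space"
  assumes "norm i \<le> 1" "norm j \<le> 1"
  shows "0 \<le> mollifier x" "\<bar>mollifier x\<bar> \<le> 1" "\<bar>mollifier_partial i x\<bar> \<le> 6" "\<bar>mollifier_partial2 i j x\<bar> \<le> 30"
proof -
  note q = quad_bump_bounds[of x]
  show "0 \<le> mollifier x" "\<bar>mollifier x\<bar> \<le> 1" using q by (auto simp: mollifier_def power_le_one)
  have in1: "\<bar>x \<bullet> k\<bar> \<le> 1" if "norm x \<le> 1" "norm k \<le> 1" for k
    using Cauchy_Schwarz_ineq2[of x k] mult_mono[OF that] by simp
  have ij: "\<bar>i \<bullet> j\<bar> \<le> 1" using Cauchy_Schwarz_ineq2[of i j] mult_mono[OF assms] by simp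
  have q2: "\<bar>quad_bump x ^ 2\<bar> \<le> 1" "\<bar>quad_bump x\<bar> \<le> 1" using q by (auto simp: power_le_one)
  show "\<bar>mollifier_partial i x\<bar> \<le> 6"
  proof (cases "1 < norm x")
    case False
    then have "\<bar>x \<bullet> i\<bar> * \<bar>quad_bump x ^ 2\<bar> \<le> 1 * 1" using in1 assms q2 by (intro mult_mono) auto
    then show ?thesis by (simp add: mollifier_partial_def abs_mult)
  qed (simp add: mollifier_outside)
  show "\<bar>mollifier_partial2 i j x\<bar> \<le> 30"
  proof (cases "1 < norm x")
    case False
    have "\<bar>i \<bullet> j\<bar> * \<bar>quad_bump x ^ 2\<bar> \<le> 1 * 1" using ij q2 by (intro mult_mono) auto
    moreover have "\<bar>x \<bullet> i\<bar> * \<bar>x \<bullet> j\<bar> * \<bar>quad_bump x\<bar> \<le> 1 * 1 * 1" using False in1 assms q2 by (intro mult_mono) auto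
    moreover have "\<bar>mollifier_partial2 i j x\<bar> \<le> 6 * (\<bar>i \<bullet> j\<bar> * \<bar>quad_bump x ^ 2\<bar>) + 24 * (\<bar>x \<bullet> i\<bar> * \<bar>x \<bullet> j\<bar> * \<bar>quad_bump x\<bar>)"
      unfolding mollifier_partial2_def by (rule order_trans[OF abs_triangle_ineq]) (simp add: abs_mult)
    ultimately show ?thesis by linarith
  qed (simp add: mollifier_outside)
qed

lemma quad_bump_power_derivative:
  "((\<lambda>t. quad_bump (x + t *\<^sub>R i) ^ (n + 2)) has_real_derivative
     real (n + 2) * quad_bump x ^ (n + 1) * (- 2 * (x \<bullet> i))) (at 0)"
proof -
  have 1: "((\<lambda>t. 1 - (x + t *\<^sub>R i) \<bullet> (x + t *\<^sub>R i)) has_real_derivative - 2 * (x \<bullet> i)) (at 0)"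
  proof -
    have "(\<lambda>t. 1 - (x + t *\<^sub>R i) \<bullet> (x + t *\<^sub>R i)) = (\<lambda>t. 1 - x \<bullet> x - 2 * t * (x \<bullet> i) - t\<^sup>2 * (i \<bullet> i))"
      by (auto simp: inner_add_left inner_add_right inner_commute power2_eq_square)
    then show ?thesis by (auto intro!: derivative_eq_intros)
  qed
  have 2: "((\<lambda>r. (max 0 r) ^ (n + 2)) has_real_derivative real (n + 2) * quad_bump x ^ (n + 1))
     (at (1 - (x + 0 *\<^sub>R i) \<bullet> (x + 0 *\<^sub>R i)))"
    using has_real_derivative_max_power[of n "1 - x \<bullet> x"] by (simp add: quad_bump_def)
  show ?thesis using DERIV_chain2[OF 2 1] by (simp add: quad_bump_def)
qed

lemma mollifier_derivative:
  "((\<lambda>t. mollifier (x + t *\<^sub>R i)) has_real_derivative mollifier_partial i x) (at 0)"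
  "((\<lambda>t. mollifier_partial j (x + t *\<^sub>R i)) has_real_derivative mollifier_partial2 i j x) (at 0)"
proof -
  show "((\<lambda>t. mollifier (x + t *\<^sub>R i)) has_real_derivative mollifier_partial i x) (at 0)"
    using quad_bump_power_derivative[of x i 1]
    by (simp add: mollifier_def mollifier_partial_def numeral_3_eq_3 power2_eq_square mult_ac)
  have 1: "((\<lambda>t. quad_bump (x + t *\<^sub>R i) ^ 2) has_real_derivative 2 * quad_bump x * (- 2 * (x \<bullet> i))) (at 0)"
    using quad_bump_power_derivative[of x i 0] by (simp add: numeral_2_eq_2)
  have 2: "((\<lambda>t. - 6 * ((x + t *\<^sub>R i) \<bullet> j)) has_real_derivative - 6 * (i \<bullet> j)) (at 0)"
    by (auto intro!: derivative_eq_intros simp: inner_add_left)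
  show "((\<lambda>t. mollifier_partial j (x + t *\<^sub>R i)) has_real_derivative mollifier_partial2 i j x) (at 0)"
    using DERIV_mult[OF 2 1] by (simp add: mollifier_partial_def mollifier_partial2_def algebra_simps)
qed

lemma scaled_derivative:
  fixes f f' :: "'a::real_vector \<Rightarrow> real"
  assumes f: "\<And>x. ((\<lambda>t. f (x + t *\<^sub>R i)) has_real_derivative f' x) (at 0)" and \<delta>: "0 < \<delta>"
  shows "((\<lambda>t. a * f ((1 / \<delta>) *\<^sub>R (x + t *\<^sub>R i))) has_real_derivative (a / \<delta>) * f' ((1 / \<delta>) *\<^sub>R x)) (at 0)"
proof -
  have 1: "((\<lambda>t. f ((1 / \<delta>) *\<^sub>R x + t *\<^sub>R i)) has_real_derivative f' ((1 / \<delta>) *\<^sub>R x)) (at (0 / \<delta>))"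
    using f[of "(1 / \<delta>) *\<^sub>R x"] by simp
  have 2: "((\<lambda>t. t / \<delta>) has_real_derivative 1 / \<delta>) (at 0)" using \<delta> by (auto intro!: derivative_eq_intros)
  have eq: "(1 / \<delta>) *\<^sub>R (x + t *\<^sub>R i) = (1 / \<delta>) *\<^sub>R x + (t / \<delta>) *\<^sub>R i" for t
    by (simp add: scaleR_add_right)
  show ?thesis using DERIV_cmult[OF DERIV_chain2[OF 1 2], of a] \<delta> unfolding eq by simp
qed

section \<open>Averages against kernels that are bounded, of mean zero, or even\<close>

lemma kernel_mass_le:
  fixes k :: "'a::euclidean_space \<Rightarrow> real"
  assumes "\<And>h. \<bar>k h\<bar> \<le> m" "\<And>h. \<delta> < norm h \<Longrightarrow> k h = 0" "0 \<le> \<delta>"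
  shows "(\<integral>\<^sup>+h. ennreal \<bar>k h\<bar> \<partial>lborel) \<le> ennreal (m * (unit_ball_vol DIM('a) * \<delta> ^ DIM('a)))"
proof -
  have m: "0 \<le> m" using assms(1)[of 0] by linarith
  have "(\<integral>\<^sup>+h. ennreal \<bar>k h\<bar> \<partial>lborel) \<le> (\<integral>\<^sup>+h. ennreal m * indicator (cball 0 \<delta>) (h::'a) \<partial>lborel)"
  proof (rule nn_integral_mono)
    fix h :: 'a
    show "ennreal \<bar>k h\<bar> \<le> ennreal m * indicator (cball 0 \<delta>) h"
      using assms(1)[of h] assms(2)[of h] by (cases "norm h \<le> \<delta>") (auto intro: ennreal_leI)
  qed
  also have "\<dots> = ennreal m * ennreal (unit_ball_vol DIM('a) * \<delta> ^ DIM('a))"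
    using assms(3) by (simp add: nn_integral_cmult_indicator emeasure_cball)
  also have "\<dots> = ennreal (m * (unit_ball_vol DIM('a) * \<delta> ^ DIM('a)))"
    using m assms(3) by (intro ennreal_mult[symmetric]) auto
  finally show ?thesis .
qed

lemma integral_lborel_reflect:
  fixes f :: "'a::euclidean_space \<Rightarrow> real"
  assumes [measurable]: "f \<in> borel_measurable borel"
  shows "(LINT x|lborel. f (- x)) = (LINT x|lborel. f x)"
proof -
  have "lborel = (distr lborel borel uminus :: 'a measure)"
    using lborel_affine[of "-1" "0::'a"] by (simp add: density_1)
  then have "(LINT x|lborel. f x) = (LINT x|distr lborel borel uminus. f x)" by metis
  also have "\<dots> = (LINT x|lborel. f (- x))" by (rule integral_distr) auto
  finally show ?thesis by simp
qed

lemma kernel_average_norm: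
  fixes u :: "'a::euclidean_space \<Rightarrow> real"
  assumes u: "u \<in> L2_space lborel" and [measurable]: "k \<in> borel_measurable borel"
    and kb: "\<And>h. \<bar>k h\<bar> \<le> m" and k0: "\<And>h. \<delta> < norm h \<Longrightarrow> k h = 0" and \<delta>: "0 \<le> \<delta>"
  shows "kernel_average k u \<in> L2_space lborel"
    "L2_norm lborel (kernel_average k u) \<le> m * (unit_ball_vol DIM('a) * \<delta> ^ DIM('a)) * L2_norm lborel u"
proof -
  have [measurable]: "u \<in> borel_measurable borel" using u by (auto simp: L2_space_def)
  have m: "0 \<le> m" using kb[of 0] by linarith
  have "(\<integral>\<^sup>+x. ennreal ((u (x + h))\<^sup>2) \<partial>lborel) \<le> ennreal ((L2_norm lborel u)\<^sup>2)" for h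
    using L2_norm_eq_nn_integral[OF L2_space_translate[OF u, of h]] L2_norm_translate[of u h] by simp
  then have "(\<lambda>x. LINT h|lborel. k h * (\<lambda>h x. u (x + h)) h x) \<in> L2_space lborel \<and>
    L2_norm lborel (\<lambda>x. LINT h|lborel. k h * (\<lambda>h x. u (x + h)) h x) \<le> (m * (unit_ball_vol DIM('a) * \<delta> ^ DIM('a))) * L2_norm lborel u"
    using kernel_mass_le[of k m \<delta>, OF kb k0 \<delta>] m \<delta>
    by (intro conjI kernel_average_L2[where \<kappa> = "m * (unit_ball_vol DIM('a) * \<delta> ^ DIM('a))" and S = "L2_norm lborel u"]) auto
  then show "kernel_average k u \<in> L2_space lborel"
    "L2_norm lborel (kernel_average k u) \<le> m * (unit_ball_vol DIM('a) * \<delta> ^ DIM('a)) * L2_norm lborel u"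
    by (simp_all add: kernel_average_def[abs_def])
qed

text \<open>A kernel of mean zero permits subtracting u(x) under the integral, so only first
  differences over shifts up to \<delta> enter.\<close>

lemma kernel_average_first_difference:
  fixes u :: "'a::euclidean_space \<Rightarrow> real"
  assumes u: "u \<in> L2_space lborel" "integrable lborel u" and [measurable]: "k \<in> borel_measurable borel"
    and kb: "\<And>h. \<bar>k h\<bar> \<le> m" and k0: "\<And>h. \<delta> < norm h \<Longrightarrow> k h = 0" and \<delta>: "0 \<le> \<delta>"
    and ki: "integrable lborel k" "(LINT h|lborel. k h) = 0"
    and G: "\<And>h. norm h \<le> \<delta> \<Longrightarrow> modulus u h \<le> G"
  shows "L2_norm lborel (kernel_average k u) \<le> m * (unit_ball_vol DIM('a) * \<delta> ^ DIM('a)) * G"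
proof -
  have [measurable]: "u \<in> borel_measurable borel" using u by (auto simp: L2_space_def)
  have m: "0 \<le> m" using kb[of 0] by linarith
  have G0: "0 \<le> G" using order_trans[OF modulus_nonneg(1) G[of 0]] \<delta> by simp
  have eq: "kernel_average k u x = (LINT h|lborel. k h * (u (x + h) - u x))" for x
  proof -
    have "integrable lborel (\<lambda>h. k h * u (h + x))"
      by (intro integrable_bounded_mult[OF _ _ kb] integrable_lborel_translate u) auto
    then have "(LINT h|lborel. k h * u (x + h) - k h * u x) = (LINT h|lborel. k h * u (x + h)) - (LINT h|lborel. k h) * u x"
      using ki(1) by (simp add: add.commute)
    then show ?thesis using ki(2) by (simp add: kernel_average_def right_diff_distrib)
  qed
  have D: "(\<integral>\<^sup>+x. ennreal ((u (x + h) - u x)\<^sup>2) \<partial>lborel) \<le> ennreal (G\<^sup>2)" if "k h \<noteq> 0" for h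
  proof -
    have "norm h \<le> \<delta>" using k0[of h] that by force
    then have "(modulus u h)\<^sup>2 \<le> G\<^sup>2" using G by (intro power_mono) auto
    then show ?thesis unfolding nn_integral_diff_eq_modulus[OF u(1)] by (rule ennreal_leI)
  qed
  have "L2_norm lborel (\<lambda>x. LINT h|lborel. k h * (\<lambda>h x. u (x + h) - u x) h x) \<le> (m * (unit_ball_vol DIM('a) * \<delta> ^ DIM('a))) * G"
    using kernel_mass_le[of k m \<delta>, OF kb k0 \<delta>] m \<delta> G0 D
    by (intro kernel_average_L2[where S = G]) auto
  then show ?thesis by (simp add: eq[abs_def])
qed

text \<open>For an even kernel, averaging over h and -h gives half a centred second difference, a
  translate of the one in \<open>modulus2\<close>. With total mass 1 this estimates the
  approximation error, with total mass 0 the second derivatives.\<close>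

lemma kernel_average_second_difference:
  fixes u :: "'a::euclidean_space \<Rightarrow> real"
  assumes u: "u \<in> L2_space lborel" "integrable lborel u" and [measurable]: "k \<in> borel_measurable borel"
    and kb: "\<And>h. \<bar>k h\<bar> \<le> m" and k0: "\<And>h. \<delta> < norm h \<Longrightarrow> k h = 0" and \<delta>: "0 \<le> \<delta>"
    and ki: "integrable lborel k" and ke: "\<And>h. k (- h) = k h"
    and S: "\<And>h. norm h \<le> \<delta> \<Longrightarrow> modulus2 u h \<le> S"
  shows "L2_norm lborel (\<lambda>x. kernel_average k u x - (LINT h|lborel. k h) * u x)
     \<le> m * (unit_ball_vol DIM('a) * \<delta> ^ DIM('a)) * S"
proof -
  have [measurable]: "u \<in> borel_measurable borel" using u by (auto simp: L2_space_def)
  have m: "0 \<le> m" using kb[of 0] by linarith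
  have S0: "0 \<le> S" using order_trans[OF modulus_nonneg(2) S[of 0]] \<delta> by simp
  define E where "E h x = (u (x + h) - 2 * u x + u (x - h)) / 2" for h x
  have eq: "kernel_average k u x - (LINT h|lborel. k h) * u x = (LINT h|lborel. k h * E h x)" for x
  proof -
    have i1: "integrable lborel (\<lambda>h. k h * u (x + h))"
      using integrable_bounded_mult[OF integrable_lborel_translate[OF u(2), of x] _ kb] by (simp add: add.commute)
    have "integrable (distr lborel borel uminus) (\<lambda>h. k h * u (x + h))"
    proof -
      have "lborel = (distr lborel borel uminus :: 'a measure)" using lborel_affine[of "-1" "0::'a"] by (simp add: density_1)
      then show ?thesis using i1 by metis
    qed
    then have i2: "integrable lborel (\<lambda>h. k h * u (x - h))"
      by (subst (asm) integrable_distr_eq) (auto simp: ke)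
    have "(LINT h|lborel. k h * u (x - h)) = (LINT h|lborel. k h * u (x + h))"
      using integral_lborel_reflect[of "\<lambda>h. k h * u (x + h)"] by (simp add: ke)
    then have "kernel_average k u x = (LINT h|lborel. k h * u (x + h)) / 2 + (LINT h|lborel. k h * u (x - h)) / 2"
      by (simp add: kernel_average_def)
    also have "\<dots> - (LINT h|lborel. k h) * u x = (LINT h|lborel. k h * u (x + h) / 2 + k h * u (x - h) / 2 - k h * u x)"
      using i1 i2 ki by simp
    also have "\<dots> = (LINT h|lborel. k h * E h x)"
      by (intro Bochner_Integration.integral_cong) (auto simp: E_def field_simps)
    finally show ?thesis .
  qed
  have D: "(\<integral>\<^sup>+x. ennreal ((E h x)\<^sup>2) \<partial>lborel) \<le> ennreal (S\<^sup>2)" if "k h \<noteq> 0" for h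
  proof -
    have h: "norm h \<le> \<delta>" using k0[of h] that by force
    define v where "v x = u (x + 2 *\<^sub>R h) - 2 * u (x + h) + u x" for x
    have v: "v \<in> L2_space lborel" unfolding v_def
      by (intro L2_space_add L2_space_diff L2_space_cmult L2_space_translate u(1))
    have [measurable]: "v \<in> borel_measurable borel" using v by (auto simp: L2_space_def)
    have "v (x - h) / 2 = E h x" for x by (simp add: v_def E_def scaleR_2)
    then have E: "E h = (\<lambda>x. (1 / 2) * v (x + - h))" by auto
    have EL: "E h \<in> L2_space lborel" unfolding E by (intro L2_space_cmult L2_space_translate v)
    have "L2_norm lborel (E h) = 1 / 2 * L2_norm lborel v"
      unfolding E L2_norm_cmult by (subst L2_norm_translate) auto
    also have "\<dots> \<le> S" using S[OF h] S0 by (simp add: modulus2_def v_def[abs_def])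
    finally have "(L2_norm lborel (E h))\<^sup>2 \<le> S\<^sup>2" by (intro power_mono) auto
    then show ?thesis unfolding L2_norm_eq_nn_integral[OF EL] by (rule ennreal_leI)
  qed
  have "L2_norm lborel (\<lambda>x. LINT h|lborel. k h * E h x) \<le> (m * (unit_ball_vol DIM('a) * \<delta> ^ DIM('a))) * S"
    using kernel_mass_le[of k m \<delta>, OF kb k0 \<delta>] m \<delta> S0 D
    by (intro kernel_average_L2[where S = S]) (auto simp: E_def)
  then show ?thesis by (simp add: eq)
qed

text \<open>In \<open>iter_partial\<close> the head of the word is the outermost derivative, so
  integration by parts peels it first; hence the order \<open>k2 j i\<close>. The steps themselves
  carry no sign, so for one letter the explicit \<open>- 1\<close> offsets the sign in the
  definition of a weak derivative.\<close>

lemma weak_partial_kernel_average: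
  fixes u :: "'a::euclidean_space \<Rightarrow> real" and k0 :: "'a \<Rightarrow> real" and k1 :: "'a \<Rightarrow> 'a \<Rightarrow> real" and k2 :: "'a \<Rightarrow> 'a \<Rightarrow> 'a \<Rightarrow> real"
  assumes u: "u \<in> L2_space lborel" "integrable lborel u"
    and c: "continuous_on UNIV k0" "\<And>i. continuous_on UNIV (k1 i)" "\<And>i j. continuous_on UNIV (k2 i j)"
    and b: "\<And>x. \<bar>k0 x\<bar> \<le> B" "\<And>i x. i \<in> Basis \<Longrightarrow> \<bar>k1 i x\<bar> \<le> B" "\<And>i j x. i \<in> Basis \<Longrightarrow> j \<in> Basis \<Longrightarrow> \<bar>k2 i j x\<bar> \<le> B"
    and d: "\<And>i x. i \<in> Basis \<Longrightarrow> ((\<lambda>t. k0 (x + t *\<^sub>R i)) has_real_derivative k1 i x) (at 0)"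
      "\<And>i j x. i \<in> Basis \<Longrightarrow> j \<in> Basis \<Longrightarrow> ((\<lambda>t. k1 j (x + t *\<^sub>R i)) has_real_derivative k2 i j x) (at 0)"
    and i: "i \<in> Basis" and j: "j \<in> Basis"
  shows "weak_partial [] (kernel_average k0 u) (kernel_average k0 u)"
    and "weak_partial [i] (kernel_average k0 u) (\<lambda>x. (- 1) * kernel_average (k1 i) u x)"
    and "weak_partial [i, j] (kernel_average k0 u) (kernel_average (k2 j i) u)"
proof -
  have [measurable]: "u \<in> borel_measurable borel" using u by (auto simp: L2_space_def)
  have km: "kernel_average k u \<in> borel_measurable borel" if "continuous_on UNIV k" for k
    using borel_measurable_continuous_onI[OF that] by measurable
  have step: "(LINT x|lborel. kernel_average k u x * iter_partial (l # bs) \<phi> x) = (LINT x|lborel. kernel_average k' u x * iter_partial bs \<phi> x)"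
    if \<phi>: "test_function \<phi>" and l: "l \<in> Basis" "bs \<in> lists Basis" and k: "continuous_on UNIV k" "continuous_on UNIV k'" "\<And>x. \<bar>k x\<bar> \<le> B" "\<And>x. \<bar>k' x\<bar> \<le> B"
      "\<And>x. ((\<lambda>t. k (x + t *\<^sub>R l)) has_real_derivative k' x) (at 0)" for \<phi> k k' l bs
  proof -
    obtain R where R: "\<And>x. R < norm x \<Longrightarrow> \<phi> x = 0" using test_functionD(2)[OF \<phi>] by blast
    have diff: "iter_partial bs \<phi> differentiable (at x)" for x
      using test_functionD(3)[OF \<phi> l(2)] by (simp add: differentiable_on_def)
    show ?thesis
    proof (rule kernel_average_by_parts[OF k u(2)])
      show "continuous_on UNIV (iter_partial bs \<phi>)" "continuous_on UNIV (iter_partial (l # bs) \<phi>)"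
        using test_functionD(3)[OF \<phi>, of "l # bs"] test_functionD(3)[OF \<phi>, of bs] l
        by (auto intro!: differentiable_imp_continuous_on simp del: iter_partial.simps)
      show "R < norm x \<Longrightarrow> iter_partial bs \<phi> x = 0" "R < norm x \<Longrightarrow> iter_partial (l # bs) \<phi> x = 0" for x
        by (rule iter_partial_support[where \<phi> = \<phi> and R = R, OF R]; assumption)+
      show "norm l \<le> 1" using l by simp
      fix x
      have f: "(iter_partial bs \<phi> has_derivative frechet_derivative (iter_partial bs \<phi>) (at x)) (at x)"
        using diff[of x] by (simp add: frechet_derivative_works)
      have g: "((\<lambda>t. x + t *\<^sub>R l) has_derivative (\<lambda>t. t *\<^sub>R l)) (at 0)" by (auto intro!: derivative_eq_intros)
      have "((\<lambda>t. iter_partial bs \<phi> (x + t *\<^sub>R l)) has_derivative (\<lambda>t. frechet_derivative (iter_partial bs \<phi>) (at x) (t *\<^sub>R l))) (at 0)"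
        using has_derivative_compose[OF g, of "iter_partial bs \<phi>"] f by simp
      moreover have "frechet_derivative (iter_partial bs \<phi>) (at x) (t *\<^sub>R l) = iter_partial (l # bs) \<phi> x * t" for t
        using linear_frechet_derivative[OF diff[of x]] by (simp add: linear_scale)
      ultimately show "((\<lambda>t. iter_partial bs \<phi> (x + t *\<^sub>R l)) has_real_derivative iter_partial (l # bs) \<phi> x) (at 0)"
        by (simp add: has_field_derivative_def)
    qed
  qed
  have leb: "(LINT x|lebesgue. v x * iter_partial bs \<phi> x) = (LINT x|lborel. v x * iter_partial bs \<phi> x)"
    if "test_function \<phi>" "bs \<in> lists Basis" "v \<in> borel_measurable borel" for v bs \<phi>
  proof (rule integral_completion)
    have "iter_partial bs \<phi> \<in> borel_measurable borel"
      using test_functionD(3)[OF that(1,2)] by (intro borel_measurable_continuous_onI differentiable_imp_continuous_on)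
    then show "(\<lambda>x. v x * iter_partial bs \<phi> x) \<in> borel_measurable lborel" using that(3) by simp
  qed
  show "weak_partial [] (kernel_average k0 u) (kernel_average k0 u)" by (simp add: weak_partial_def)
  show "weak_partial [i] (kernel_average k0 u) (\<lambda>x. (- 1) * kernel_average (k1 i) u x)"
    unfolding weak_partial_def
  proof (intro allI impI)
    fix \<phi> :: "'a \<Rightarrow> real" assume \<phi>: "test_function \<phi>"
    have "(LINT x|lebesgue. kernel_average k0 u x * iter_partial [i] \<phi> x) = (LINT x|lborel. kernel_average k0 u x * iter_partial [i] \<phi> x)"
      using i by (intro leb \<phi> km c) auto
    also have "\<dots> = (LINT x|lborel. kernel_average (k1 i) u x * iter_partial [] \<phi> x)"
      using i b d c by (intro step[OF \<phi>]) auto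
    also have "\<dots> = (LINT x|lebesgue. kernel_average (k1 i) u x * iter_partial [] \<phi> x)"
      by (intro leb[symmetric] \<phi> km c) auto
    finally show "(LINT x|lebesgue. kernel_average k0 u x * iter_partial [i] \<phi> x) =
      (- 1) ^ length [i] * (LINT x|lebesgue. (- 1) * kernel_average (k1 i) u x * \<phi> x)" by simp
  qed
  show "weak_partial [i, j] (kernel_average k0 u) (kernel_average (k2 j i) u)"
    unfolding weak_partial_def
  proof (intro allI impI)
    fix \<phi> :: "'a \<Rightarrow> real" assume \<phi>: "test_function \<phi>"
    have "(LINT x|lebesgue. kernel_average k0 u x * iter_partial [i, j] \<phi> x) = (LINT x|lborel. kernel_average k0 u x * iter_partial [i, j] \<phi> x)"
      using i j by (intro leb \<phi> km c) auto
    also have "\<dots> = (LINT x|lborel. kernel_average (k1 i) u x * iter_partial [j] \<phi> x)"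
      using i j b d c by (intro step[OF \<phi>]) auto
    also have "\<dots> = (LINT x|lborel. kernel_average (k2 j i) u x * iter_partial [] \<phi> x)"
      using i j b d c by (intro step[OF \<phi>]) auto
    also have "\<dots> = (LINT x|lebesgue. kernel_average (k2 j i) u x * iter_partial [] \<phi> x)"
      by (intro leb[symmetric] \<phi> km c) auto
    finally show "(LINT x|lebesgue. kernel_average k0 u x * iter_partial [i, j] \<phi> x) =
      (- 1) ^ length [i, j] * (LINT x|lebesgue. kernel_average (k2 j i) u x * \<phi> x)" by simp
  qed
qed

text \<open>On the ball of radius \<delta>/2 the paraboloid is at least 3/4, and 27/64 is its cube.
  The lower bound makes the normalizing factor comparable to the reciprocal volume.\<close>

lemma integral_mollifier_lower_bound:
  assumes \<delta>: "0 < \<delta>"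
  shows "integrable lborel (\<lambda>h::'a::euclidean_space. mollifier ((1 / \<delta>) *\<^sub>R h))"
    "27 / 64 * (unit_ball_vol DIM('a) * (\<delta> / 2) ^ DIM('a)) \<le> (LINT h|lborel. mollifier ((1 / \<delta>) *\<^sub>R (h::'a)))"
proof -
  have out: "mollifier ((1 / \<delta>) *\<^sub>R h) = 0" if "\<delta> < norm h" for h :: 'a
    using that \<delta> by (intro mollifier_outside) (simp add: field_simps)
  have "continuous_on UNIV (\<lambda>h::'a. mollifier ((1 / \<delta>) *\<^sub>R h))"
    by (intro continuous_on_compose2[OF mollifier_continuous(1)] continuous_intros) auto
  then have [measurable]: "(\<lambda>h::'a. mollifier ((1 / \<delta>) *\<^sub>R h)) \<in> borel_measurable borel" by (rule borel_measurable_continuous_onI)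
  show int: "integrable lborel (\<lambda>h::'a. mollifier ((1 / \<delta>) *\<^sub>R h))"
    by (rule L2_space_compact_support(2)[where M = 1 and R = \<delta>]) (use out mollifier_bounds[of 0 0] in auto)
  have i2: "integrable lborel (\<lambda>h::'a. 27 / 64 * indicator (cball 0 (\<delta> / 2)) h :: real)"
    using emeasure_lborel_cball_finite[of "0::'a" "\<delta> / 2"] by (intro integrable_mult_right integrable_real_indicator) auto
  have "27 / 64 * (unit_ball_vol DIM('a) * (\<delta> / 2) ^ DIM('a)) = (LINT h|lborel. 27 / 64 * indicator (cball 0 (\<delta> / 2)) (h::'a))"
    using \<delta> by (simp add: measure_def emeasure_cball)
  also have "\<dots> \<le> (LINT h|lborel. mollifier ((1 / \<delta>) *\<^sub>R (h::'a)))"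
  proof (rule integral_mono[OF i2 int])
    fix h :: 'a
    show "27 / 64 * indicator (cball 0 (\<delta> / 2)) h \<le> mollifier ((1 / \<delta>) *\<^sub>R h)"
    proof (cases "norm h \<le> \<delta> / 2")
      case True
      then have "norm ((1 / \<delta>) *\<^sub>R h) \<le> 1 / 2" using \<delta> by (simp add: field_simps)
      from power_mono[OF quad_bump_inside[OF this], of 3] show ?thesis
        using True by (simp add: mollifier_def power_divide)
    qed (use mollifier_bounds(1)[of 0 0] in auto)
  qed
  finally show "27 / 64 * (unit_ball_vol DIM('a) * (\<delta> / 2) ^ DIM('a)) \<le> (LINT h|lborel. mollifier ((1 / \<delta>) *\<^sub>R (h::'a)))" .
qed

text \<open>Mollify at scale \<delta>. The error and the second derivatives see even kernels, hence
  second differences, with a factor 1/\<delta>^2 for the latter. The first partials of the kernel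
  are odd with mean zero, so the gradient is controlled by first differences over \<delta>.\<close>

lemma smooth_approximation:
  "\<exists>q>0. \<forall>\<delta> (u::'a::euclidean_space \<Rightarrow> real) Z G S. 0 < \<delta> \<longrightarrow> u \<in> L2_space lborel \<longrightarrow> integrable lborel u \<longrightarrow>
     L2_norm lborel u \<le> Z \<longrightarrow> (\<forall>h. norm h \<le> \<delta> \<longrightarrow> modulus u h \<le> G) \<longrightarrow> (\<forall>h. norm h \<le> \<delta> \<longrightarrow> modulus2 u h \<le> S) \<longrightarrow>
     (\<exists>v\<in>L2_space lborel. L2_norm lborel (\<lambda>x. u x - v x) \<le> q * S \<and>
        (\<forall>bs\<in>lists Basis. length bs \<le> 2 \<longrightarrow>
           (\<exists>g\<in>L2_space lborel. weak_partial bs v g \<and> L2_norm lborel g \<le> q * (Z + G / \<delta> + S / \<delta>\<^sup>2))))"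
proof -
  let ?n = "DIM('a)" let ?v = "unit_ball_vol (real DIM('a))"
  \<comment> \<open>Bounds the normalizing factor \<open>c\<close> times the volume of the ball of
    radius \<delta>: the reciprocal of 27/64, and \<open>2 ^ DIM('a)\<close> for passing from the
    half ball to the ball.\<close>
  define Q where "Q = 64 / 27 * (2::real) ^ ?n"
  have Q: "0 < Q" by (simp add: Q_def)
  show ?thesis
  \<comment> \<open>The mollifier, its first and its second partials are bounded by 1, 6 and 30; the
    largest serves for all.\<close>
  proof (intro exI[of _ "30 * Q"] conjI allI impI)
    show "0 < 30 * Q" using Q by simp
    fix \<delta> Z G S :: real and u :: "'a \<Rightarrow> real"
    assume \<delta>: "0 < \<delta>" and u: "u \<in> L2_space lborel" "integrable lborel u" and Z: "L2_norm lborel u \<le> Z"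
      and G: "\<forall>h. norm h \<le> \<delta> \<longrightarrow> modulus u h \<le> G" and S: "\<forall>h. norm h \<le> \<delta> \<longrightarrow> modulus2 u h \<le> S"
    have Z0: "0 \<le> Z" using L2_norm_nonneg Z by (rule order_trans)
    have G0: "0 \<le> G" using order_trans[OF modulus_nonneg(1) G[rule_format, of 0]] \<delta> by simp
    have S0: "0 \<le> S" using order_trans[OF modulus_nonneg(2) S[rule_format, of 0]] \<delta> by simp
    define I where "I = (LINT h|lborel. mollifier ((1 / \<delta>) *\<^sub>R (h::'a)))"
    have I: "27 / 64 * (?v * (\<delta> / 2) ^ ?n) \<le> I" unfolding I_def by (rule integral_mollifier_lower_bound[OF \<delta>])
    have I0: "0 < I" by (rule less_le_trans[OF _ I]) (use \<delta> in simp)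
    define c where "c = 1 / I"
    have c0: "0 < c" using I0 by (simp add: c_def)
    have cQ: "c * (?v * \<delta> ^ ?n) \<le> Q"
    proof -
      have "?v * \<delta> ^ ?n = Q * (27 / 64 * (?v * (\<delta> / 2) ^ ?n))" by (simp add: Q_def power_divide)
      also have "\<dots> \<le> Q * I" using I Q by (intro mult_left_mono) auto
      finally show ?thesis using I0 by (simp add: c_def field_simps)
    qed
    define k0 where "k0 h = c * mollifier ((1 / \<delta>) *\<^sub>R h)" for h :: 'a
    define k1 where "k1 i h = c / \<delta> * mollifier_partial i ((1 / \<delta>) *\<^sub>R h)" for i h :: 'a
    define k2 where "k2 i j h = c / \<delta> / \<delta> * mollifier_partial2 i j ((1 / \<delta>) *\<^sub>R h)" for i j h :: 'a
    have cont: "continuous_on UNIV k0" "continuous_on UNIV (k1 i)" "continuous_on UNIV (k2 i j)" for i j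
      unfolding k0_def[abs_def] k1_def[abs_def] k2_def[abs_def]
      by (intro continuous_intros continuous_on_compose2[OF mollifier_continuous(1)]
         continuous_on_compose2[OF mollifier_continuous(2)] continuous_on_compose2[OF mollifier_continuous(3)]; simp)+
    have [measurable]: "k0 \<in> borel_measurable borel" "k1 i \<in> borel_measurable borel" "k2 i j \<in> borel_measurable borel" for i j
      using cont by (auto intro: borel_measurable_continuous_onI)
    have bnd: "\<bar>k0 h\<bar> \<le> c" "\<bar>k1 i h\<bar> \<le> 6 * c / \<delta>" "\<bar>k2 i j h\<bar> \<le> 30 * c / \<delta>\<^sup>2"
      if "i \<in> Basis" "j \<in> Basis" for i j h
    proof -
      note mb = mollifier_bounds[of i j "(1 / \<delta>) *\<^sub>R h"]
      have ij: "norm i \<le> 1" "norm j \<le> 1" using that by auto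
      have "c * \<bar>mollifier ((1 / \<delta>) *\<^sub>R h)\<bar> \<le> c * 1" using mb(2)[OF ij] c0 by (intro mult_left_mono) auto
      then show "\<bar>k0 h\<bar> \<le> c" using c0 by (simp add: k0_def abs_mult)
      have "c / \<delta> * \<bar>mollifier_partial i ((1 / \<delta>) *\<^sub>R h)\<bar> \<le> c / \<delta> * 6" using mb(3)[OF ij] c0 \<delta> by (intro mult_left_mono) auto
      then show "\<bar>k1 i h\<bar> \<le> 6 * c / \<delta>" using c0 \<delta> by (simp add: k1_def abs_mult mult.commute)
      have "c / \<delta> / \<delta> * \<bar>mollifier_partial2 i j ((1 / \<delta>) *\<^sub>R h)\<bar> \<le> c / \<delta> / \<delta> * 30" using mb(4)[OF ij] c0 \<delta> by (intro mult_left_mono) auto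
      then show "\<bar>k2 i j h\<bar> \<le> 30 * c / \<delta>\<^sup>2" using c0 \<delta> by (simp add: k2_def abs_mult mult.commute power2_eq_square)
    qed
    have out: "k0 h = 0" "k1 i h = 0" "k2 i j h = 0" if "\<delta> < norm h" for i j h
    proof -
      have "1 < norm ((1 / \<delta>) *\<^sub>R h)" using that \<delta> by (simp add: field_simps)
      from mollifier_outside[OF this] show "k0 h = 0" "k1 i h = 0" "k2 i j h = 0" by (simp_all add: k0_def k1_def k2_def)
    qed
    have der: "((\<lambda>t. k0 (x + t *\<^sub>R i)) has_real_derivative k1 i x) (at 0)"
      "((\<lambda>t. k1 j (x + t *\<^sub>R i)) has_real_derivative k2 i j x) (at 0)" for i j x
      unfolding k0_def k1_def k2_def by (intro scaled_derivative mollifier_derivative \<delta>)+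
    obtain e :: 'a where e: "e \<in> Basis" by (meson nonempty_Basis equals0I)
    have int: "integrable lborel k0" "i \<in> Basis \<Longrightarrow> integrable lborel (k1 i)" "i \<in> Basis \<Longrightarrow> j \<in> Basis \<Longrightarrow> integrable lborel (k2 i j)" for i j
    proof -
      show "integrable lborel k0" by (rule L2_space_compact_support(2)[where M = c and R = \<delta>]) (use bnd(1)[OF e e] out in auto)
      show "i \<in> Basis \<Longrightarrow> integrable lborel (k1 i)"
        by (rule L2_space_compact_support(2)[where M = "6 * c / \<delta>" and R = \<delta>]) (use bnd(2)[OF _ e] out in auto)
      show "i \<in> Basis \<Longrightarrow> j \<in> Basis \<Longrightarrow> integrable lborel (k2 i j)"
        by (rule L2_space_compact_support(2)[where M = "30 * c / \<delta>\<^sup>2" and R = \<delta>]) (use bnd(3) out in auto)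
    qed
    have mean0: "(LINT h|lborel. k0 h) = 1"
      using I0 integral_mollifier_lower_bound(1)[OF \<delta>, where 'a='a] by (simp add: k0_def I_def c_def)
    have mean1: "(LINT h|lborel. k1 i h) = 0" if "i \<in> Basis" for i
      by (rule integral_directional_derivative[where \<psi> = k0 and i = i and M = "6 * c / \<delta>" and R = \<delta>])
         (use der out bnd(2)[OF that e] int that in auto)
    have mean2: "(LINT h|lborel. k2 i j h) = 0" if "i \<in> Basis" "j \<in> Basis" for i j
      by (rule integral_directional_derivative[where \<psi> = "k1 j" and i = i and M = "30 * c / \<delta>\<^sup>2" and R = \<delta>])
         (use der out bnd(3)[OF that] int that in auto)
    have even0: "k0 (- h) = k0 h" for h by (simp add: k0_def mollifier_def quad_bump_def)
    have even2: "k2 i j (- h) = k2 i j h" for i j h by (simp add: k2_def mollifier_partial2_def quad_bump_def)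
    have \<delta>0: "0 \<le> \<delta>" using \<delta> by simp
    define v where "v = kernel_average k0 u"
    have v: "v \<in> L2_space lborel" "L2_norm lborel v \<le> Q * Z"
    proof -
      note n = kernel_average_norm[of u k0 c \<delta>, OF u(1) _ bnd(1)[OF e e] out(1) \<delta>0]
      show "v \<in> L2_space lborel" unfolding v_def by (rule n(1)) auto
      have "L2_norm lborel v \<le> c * (?v * \<delta> ^ ?n) * L2_norm lborel u" unfolding v_def by (rule n(2)) auto
      also have "\<dots> \<le> Q * Z" using cQ Z Q by (intro mult_mono) auto
      finally show "L2_norm lborel v \<le> Q * Z" .
    qed
    have diff: "L2_norm lborel (\<lambda>x. u x - v x) \<le> Q * S"
    proof -
      have "L2_norm lborel (\<lambda>x. kernel_average k0 u x - (LINT h|lborel. k0 h) * u x) \<le> c * (?v * \<delta> ^ ?n) * S"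
        by (rule kernel_average_second_difference[of u k0 c \<delta>, OF u _ bnd(1)[OF e e] out(1) \<delta>0 int(1) even0])
           (use S in auto)
      also have "\<dots> \<le> Q * S" using cQ S0 by (intro mult_right_mono) auto
      finally show ?thesis unfolding mean0 v_def by (subst L2_norm_minus_commute) simp
    qed
    have first: "kernel_average (k1 i) u \<in> L2_space lborel" "L2_norm lborel (kernel_average (k1 i) u) \<le> 6 * Q * (G / \<delta>)" if i: "i \<in> Basis" for i
    proof -
      show "kernel_average (k1 i) u \<in> L2_space lborel"
        by (rule kernel_average_norm(1)[of u "k1 i" "6 * c / \<delta>" \<delta>, OF u(1) _ bnd(2)[OF i e] out(2) \<delta>0]) auto
      have "L2_norm lborel (kernel_average (k1 i) u) \<le> 6 * c / \<delta> * (?v * \<delta> ^ ?n) * G"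
        by (rule kernel_average_first_difference[of u "k1 i" "6 * c / \<delta>" \<delta>, OF u _ bnd(2)[OF i e] out(2) \<delta>0 int(2)[OF i] mean1[OF i]])
           (use G in auto)
      also have "\<dots> = (c * (?v * \<delta> ^ ?n)) * (6 * (G / \<delta>))" by simp
      also have "\<dots> \<le> Q * (6 * (G / \<delta>))" using cQ G0 \<delta> by (intro mult_right_mono) auto
      finally show "L2_norm lborel (kernel_average (k1 i) u) \<le> 6 * Q * (G / \<delta>)" by (simp add: mult_ac)
    qed
    have second: "kernel_average (k2 i j) u \<in> L2_space lborel" "L2_norm lborel (kernel_average (k2 i j) u) \<le> 30 * Q * (S / \<delta>\<^sup>2)"
      if i: "i \<in> Basis" and j: "j \<in> Basis" for i j
    proof -
      show "kernel_average (k2 i j) u \<in> L2_space lborel"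
        by (rule kernel_average_norm(1)[of u "k2 i j" "30 * c / \<delta>\<^sup>2" \<delta>, OF u(1) _ bnd(3)[OF i j] out(3) \<delta>0]) auto
      have "L2_norm lborel (\<lambda>x. kernel_average (k2 i j) u x - (LINT h|lborel. k2 i j h) * u x) \<le> 30 * c / \<delta>\<^sup>2 * (?v * \<delta> ^ ?n) * S"
        by (rule kernel_average_second_difference[of u "k2 i j" "30 * c / \<delta>\<^sup>2" \<delta>, OF u _ bnd(3)[OF i j] out(3) \<delta>0 int(3)[OF i j] even2])
           (use S in auto)
      also have "\<dots> = (c * (?v * \<delta> ^ ?n)) * (30 * (S / \<delta>\<^sup>2))" by simp
      also have "\<dots> \<le> Q * (30 * (S / \<delta>\<^sup>2))" using cQ S0 by (intro mult_right_mono) auto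
      finally show "L2_norm lborel (kernel_average (k2 i j) u) \<le> 30 * Q * (S / \<delta>\<^sup>2)" unfolding mean2[OF i j] by (simp add: mult_ac)
    qed
    define B where "B = c + 6 * c / \<delta> + 30 * c / \<delta>\<^sup>2"
    have B: "c \<le> B" "6 * c / \<delta> \<le> B" "30 * c / \<delta>\<^sup>2 \<le> B" using c0 \<delta> by (auto simp: B_def)
    have wp: "weak_partial [] v v" "weak_partial [i] v (\<lambda>x. (- 1) * kernel_average (k1 i) u x)" "weak_partial [i, j] v (kernel_average (k2 j i) u)"
      if "i \<in> Basis" "j \<in> Basis" for i j
    proof -
      note w = weak_partial_kernel_average[of u k0 k1 k2 B i j, OF u cont order_trans[OF bnd(1)[OF e e] B(1)]
        order_trans[OF bnd(2)[OF _ e] B(2)] order_trans[OF bnd(3) B(3)] der that, folded v_def]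
      show "weak_partial [] v v" by (rule w(1)) assumption+
      show "weak_partial [i] v (\<lambda>x. (- 1) * kernel_average (k1 i) u x)" by (rule w(2)) assumption+
      show "weak_partial [i, j] v (kernel_average (k2 j i) u)" by (rule w(3)) assumption+
    qed
    define T where "T = 30 * Q * (Z + G / \<delta> + S / \<delta>\<^sup>2)"
    have G1: "0 \<le> G / \<delta>" and S1: "0 \<le> S / \<delta>\<^sup>2" using G0 S0 \<delta> by auto
    have QT: "0 \<le> Q * Z" "0 \<le> Q * (G / \<delta>)" "0 \<le> Q * (S / \<delta>\<^sup>2)" by (intro mult_nonneg_nonneg less_imp_le[OF Q] Z0 G1 S1)+
    have T: "Q * Z \<le> T" "6 * Q * (G / \<delta>) \<le> T" "30 * Q * (S / \<delta>\<^sup>2) \<le> T"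
    proof -
      have "T = 30 * (Q * Z) + 30 * (Q * (G / \<delta>)) + 30 * (Q * (S / \<delta>\<^sup>2))" unfolding T_def distrib_left mult.assoc ..
      moreover have "6 * Q * (G / \<delta>) = 6 * (Q * (G / \<delta>))" "30 * Q * (S / \<delta>\<^sup>2) = 30 * (Q * (S / \<delta>\<^sup>2))"
        by (rule mult.assoc)+
      moreover have "a \<le> 30 * a + 30 * b + 30 * c" "6 * b \<le> 30 * a + 30 * b + 30 * c" "30 * c \<le> 30 * a + 30 * b + 30 * c"
        if "0 \<le> a" "0 \<le> b" "0 \<le> c" for a b c :: real using that by linarith+
      note this[OF QT]
      ultimately show "Q * Z \<le> T" "6 * Q * (G / \<delta>) \<le> T" "30 * Q * (S / \<delta>\<^sup>2) \<le> T"
        by (simp_all only:)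
    qed
    show "\<exists>v\<in>L2_space lborel. L2_norm lborel (\<lambda>x. u x - v x) \<le> 30 * Q * S \<and>
        (\<forall>bs\<in>lists Basis. length bs \<le> 2 \<longrightarrow>
           (\<exists>g\<in>L2_space lborel. weak_partial bs v g \<and> L2_norm lborel g \<le> 30 * Q * (Z + G / \<delta> + S / \<delta>\<^sup>2)))"
      unfolding T_def[symmetric]
    proof (rule bexI[OF _ v(1)], intro conjI ballI impI)
      have "0 \<le> Q * S" using Q S0 by simp
      then show "L2_norm lborel (\<lambda>x. u x - v x) \<le> 30 * Q * S" using diff by linarith
      fix bs :: "'a list" assume bs: "bs \<in> lists Basis" "length bs \<le> 2"
      then consider "bs = []" | i where "bs = [i]" "i \<in> Basis" | i j where "bs = [i, j]" "i \<in> Basis" "j \<in> Basis"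
        by (cases bs; cases "tl bs") auto
      then show "\<exists>g\<in>L2_space lborel. weak_partial bs v g \<and> L2_norm lborel g \<le> T"
      proof cases
        case 1
        then show ?thesis using wp(1)[OF e e] v T by (intro bexI[of _ v]) auto
      next
        case (2 i)
        have "(\<lambda>x. (- 1) * kernel_average (k1 i) u x) \<in> L2_space lborel" by (rule L2_space_cmult[OF first(1)[OF 2(2)]])
        moreover have "L2_norm lborel (\<lambda>x. (- 1) * kernel_average (k1 i) u x) \<le> T"
          unfolding L2_norm_cmult using first(2)[OF 2(2)] T(2) by simp
        ultimately show ?thesis using wp(2)[OF 2(2) e] 2(1) by blast
      next
        case (3 i j)
        show ?thesis using wp(3)[OF 3(2,3)] second[OF 3(3,2)] T(3) unfolding 3(1)
          by (intro bexI[of _ "kernel_average (k2 j i) u"]) auto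
      qed
    qed
  qed
qed

section \<open>Besov norms from second differences\<close>

lemma Hk_norm_nonneg [simp]: "0 \<le> Hk_norm k v"
  by (simp add: Hk_norm_def sum_nonneg)

text \<open>Each selected weak derivative has the norm of the exhibited one, and the number of words
  bounds the number of summands.\<close>

lemma Hk_space_norm_le:
  fixes v :: "'a::euclidean_space \<Rightarrow> real"
  assumes v: "v \<in> L2_space lborel" and b: "0 \<le> b"
    and g: "\<And>bs. bs \<in> lists Basis \<Longrightarrow> length bs \<le> k \<Longrightarrow>
      \<exists>g\<in>L2_space lborel. weak_partial bs v g \<and> L2_norm lborel g \<le> b"
  shows "v \<in> Hk_space k"
    "Hk_norm k v \<le> sqrt (real (card {bs \<in> lists (Basis :: 'a set). length bs \<le> k})) * b"
proof -
  let ?A = "{bs \<in> lists (Basis :: 'a set). length bs \<le> k}"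
  show "v \<in> Hk_space k"
    unfolding Hk_space_def using v g L2_space_lborel_lebesgue(1) by blast
  have "(L2_norm lebesgue (SOME g. g \<in> L2_space lebesgue \<and> weak_partial bs v g))\<^sup>2 \<le> b\<^sup>2" if bs: "bs \<in> ?A" for bs
  proof -
    obtain h where h: "h \<in> L2_space lborel" "weak_partial bs v h" "L2_norm lborel h \<le> b" using g bs by blast
    let ?g = "SOME g. g \<in> L2_space lebesgue \<and> weak_partial bs v g"
    have "?g \<in> L2_space lebesgue \<and> weak_partial bs v ?g"
      by (rule someI[of _ h]) (use h L2_space_lborel_lebesgue(1) in blast)
    then have "L2_norm lebesgue ?g = L2_norm lborel h" using weak_partial_unique h by blast
    then show ?thesis using h(3) by (simp add: power_mono)
  qed
  then have "(\<Sum>bs\<in>?A. (L2_norm lebesgue (SOME g. g \<in> L2_space lebesgue \<and> weak_partial bs v g))\<^sup>2) \<le> real (card ?A) * b\<^sup>2"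
    by (rule sum_bounded_above)
  then have "Hk_norm k v \<le> sqrt (real (card ?A) * b\<^sup>2)" unfolding Hk_norm_def by (rule real_sqrt_le_mono)
  then show "Hk_norm k v \<le> sqrt (real (card ?A)) * b" using b by (simp add: real_sqrt_mult)
qed

lemma K_functional_le:
  assumes "u0 \<in> X0" "u1 \<in> X1" "AE x in lebesgue. u x = u0 x + u1 x" "0 \<le> n0 u0" "0 \<le> n1 u1" "0 \<le> t"
  shows "0 \<le> K_functional X0 n0 X1 n1 t u" "K_functional X0 n0 X1 n1 t u \<le> n0 u0 + t * n1 u1"
proof -
  let ?S = "{sqrt ((n0 u0)\<^sup>2 + t\<^sup>2 * (n1 u1)\<^sup>2) | u0 u1. u0 \<in> X0 \<and> u1 \<in> X1 \<and> (AE x in lebesgue. u x = u0 x + u1 x)}"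
  have mem: "sqrt ((n0 u0)\<^sup>2 + t\<^sup>2 * (n1 u1)\<^sup>2) \<in> ?S" using assms by blast
  have nn: "0 \<le> y" if "y \<in> ?S" for y using that by auto
  show "0 \<le> K_functional X0 n0 X1 n1 t u"
    unfolding K_functional_def using mem nn by (intro cInf_greatest) auto
  have "K_functional X0 n0 X1 n1 t u \<le> sqrt ((n0 u0)\<^sup>2 + t\<^sup>2 * (n1 u1)\<^sup>2)"
    unfolding K_functional_def using nn by (intro cInf_lower[OF mem] bdd_belowI)
  also have "\<dots> = sqrt ((n0 u0)\<^sup>2 + (t * n1 u1)\<^sup>2)" by (simp add: power_mult_distrib)
  also have "\<dots> \<le> n0 u0 + t * n1 u1" using assms by (intro sqrt_sum_squares_le_sum) auto
  finally show "K_functional X0 n0 X1 n1 t u \<le> n0 u0 + t * n1 u1" .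
qed

text \<open>The K-functional at t = \<delta>^2 is tested with the mollification at scale \<delta>.
  Its gradient, of size G/\<delta>, is weighted by t, so it contributes G \<delta>; this is why
  first differences are required only in the form
  \<open>modulus u k * \<delta> \<le> H * \<delta> powr \<sigma>\<close>.\<close>

lemma besov_bound_of_moduli:
  assumes \<delta>0: "0 < \<delta>0" "\<delta>0 \<le> 1"
  shows "\<exists>C>0. \<forall>(u::'a::euclidean_space \<Rightarrow> real) w \<sigma> Y Z H. u \<in> L2_space lborel \<longrightarrow> integrable lborel u \<longrightarrow>
     (AE x in lborel. w x = u x) \<longrightarrow>
     0 < \<sigma> \<longrightarrow> \<sigma> \<le> 2 \<longrightarrow> 0 \<le> Y \<longrightarrow> L2_norm lborel u \<le> Z \<longrightarrow> 0 \<le> H \<longrightarrow>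
     (\<forall>k. norm k \<le> \<delta>0 \<longrightarrow> modulus2 u k \<le> Y * norm k powr \<sigma>) \<longrightarrow>
     (\<forall>\<delta> k. 0 < \<delta> \<longrightarrow> \<delta> \<le> \<delta>0 \<longrightarrow> norm k \<le> \<delta> \<longrightarrow> modulus u k * \<delta> \<le> H * \<delta> powr \<sigma>) \<longrightarrow>
     w \<in> besov_space \<sigma> \<and> besov_norm \<sigma> w \<le> C * (Y + Z + H)"
proof -
  obtain q where q: "q > 0" and smooth: "\<forall>\<delta> (u::'a \<Rightarrow> real) Z G S. 0 < \<delta> \<longrightarrow> u \<in> L2_space lborel \<longrightarrow> integrable lborel u \<longrightarrow>
     L2_norm lborel u \<le> Z \<longrightarrow> (\<forall>h. norm h \<le> \<delta> \<longrightarrow> modulus u h \<le> G) \<longrightarrow> (\<forall>h. norm h \<le> \<delta> \<longrightarrow> modulus2 u h \<le> S) \<longrightarrow>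
     (\<exists>v\<in>L2_space lborel. L2_norm lborel (\<lambda>x. u x - v x) \<le> q * S \<and>
        (\<forall>bs\<in>lists Basis. length bs \<le> 2 \<longrightarrow>
           (\<exists>g\<in>L2_space lborel. weak_partial bs v g \<and> L2_norm lborel g \<le> q * (Z + G / \<delta> + S / \<delta>\<^sup>2))))"
    using smooth_approximation[where 'a='a] by (elim exE conjE) (rule that)
  define m where "m = sqrt (real (card {bs \<in> lists (Basis :: 'a set). length bs \<le> 2}))"
  have m: "0 \<le> m" by (simp add: m_def)
  define C where "C = q + m * q + 1 / \<delta>0\<^sup>2"
  have C: "0 < C" using q m \<delta>0 by (auto simp: C_def intro!: add_nonneg_pos add_pos_nonneg)
  show ?thesis
  proof (rule exI[of _ C], intro conjI C allI impI)
    fix u w :: "'a \<Rightarrow> real" and \<sigma> Y Z H :: real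
    assume u: "u \<in> L2_space lborel" "integrable lborel u" and w: "AE x in lborel. w x = u x" and \<sigma>: "0 < \<sigma>" "\<sigma> \<le> 2" and Y: "0 \<le> Y"
      and Z: "L2_norm lborel u \<le> Z" and H: "0 \<le> H"
      and m2: "\<forall>k. norm k \<le> \<delta>0 \<longrightarrow> modulus2 u k \<le> Y * norm k powr \<sigma>"
      and m1: "\<forall>\<delta> k. 0 < \<delta> \<longrightarrow> \<delta> \<le> \<delta>0 \<longrightarrow> norm k \<le> \<delta> \<longrightarrow> modulus u k * \<delta> \<le> H * \<delta> powr \<sigma>"
    have Z0: "0 \<le> Z" using L2_norm_nonneg Z by (rule order_trans)
    let ?K = "\<lambda>t. K_functional (L2_space lebesgue) (L2_norm lebesgue) (Hk_space 2) (Hk_norm 2) t w"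
    define zero where "zero = (\<lambda>_ :: 'a. 0 :: real)"
    have wpz: "weak_partial bs zero zero" for bs by (simp add: weak_partial_def zero_def)
    have zL: "zero \<in> L2_space lborel" by (simp add: L2_space_def zero_def)
    have zn: "L2_norm lborel zero = 0" by (simp add: L2_norm_def zero_def)
    have zH: "zero \<in> Hk_space 2" "Hk_norm 2 zero \<le> 0"
    proof -
      have ex: "\<exists>g\<in>L2_space lborel. weak_partial bs zero g \<and> L2_norm lborel g \<le> 0" for bs
        using zL wpz zn by (intro bexI[of _ zero]) auto
      show "zero \<in> Hk_space 2" "Hk_norm 2 zero \<le> 0"
        using Hk_space_norm_le[of zero 0 2, OF zL order_refl ex] by auto
    qed
    have zH0: "Hk_norm 2 zero = 0"
      using zH(2) Hk_norm_nonneg by (rule antisym)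
    have AEw: "AE x in lebesgue. w x = u x" using w by (rule AE_completion)
    have uL: "u \<in> L2_space lebesgue" "L2_norm lebesgue u = L2_norm lborel u" by (rule L2_space_lborel_lebesgue[OF u(1)])+
    have K: "0 \<le> ?K t \<and> ?K t \<le> L2_norm lborel u" if "0 \<le> t" for t
      using K_functional_le[of u "L2_space lebesgue" zero "Hk_space 2" w "L2_norm lebesgue" "Hk_norm 2" t]
        uL zH(1) zH0 that AEw by (simp add: zero_def)
    have bound: "t powr (- (\<sigma> / 2)) * ?K t \<le> C * (Y + Z + H)" if t: "0 < t" for t
    proof (cases "t \<le> \<delta>0\<^sup>2")
      case True
      \<comment> \<open>The \<open>H^2\<close> part carries the weight \<open>t\<close> and costs
        1/\<delta>^2 from second derivatives, so at this scale it balances the approximation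
        error.\<close>
      define \<delta> where "\<delta> = sqrt t"
      have \<delta>: "0 < \<delta>" "\<delta> \<le> \<delta>0" "t = \<delta>\<^sup>2" using t True \<delta>0 by (auto simp: \<delta>_def real_le_lsqrt)
      define p where "p = \<delta> powr \<sigma>"
      have p: "0 < p" using \<delta> by (simp add: p_def)
      define G where "G = H * p / \<delta>"
      define S where "S = Y * p"
      have "modulus u h \<le> G" if "norm h \<le> \<delta>" for h
        using m1 \<delta> that by (simp add: G_def p_def field_simps)
      moreover have "modulus2 u h \<le> S" if "norm h \<le> \<delta>" for h
      proof -
        have "modulus2 u h \<le> Y * norm h powr \<sigma>" using m2 that \<delta> by simp
        also have "\<dots> \<le> S" unfolding S_def p_def using that \<sigma> Y by (intro mult_left_mono powr_mono2) auto
        finally show ?thesis .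
      qed
      ultimately obtain v where v: "v \<in> L2_space lborel" "L2_norm lborel (\<lambda>x. u x - v x) \<le> q * S"
        and vg: "\<And>bs. bs \<in> lists Basis \<Longrightarrow> length bs \<le> 2 \<Longrightarrow>
           \<exists>g\<in>L2_space lborel. weak_partial bs v g \<and> L2_norm lborel g \<le> q * (Z + G / \<delta> + S / \<delta>\<^sup>2)"
        using smooth[rule_format (no_asm), OF \<delta>(1) u Z] by blast
      have nn: "0 \<le> q * (Z + G / \<delta> + S / \<delta>\<^sup>2)" using q Z0 H Y p \<delta> by (auto simp: G_def S_def)
      note vH = Hk_space_norm_le[of v _ 2, OF v(1) nn vg, folded m_def]
      have d: "(\<lambda>x. u x - v x) \<in> L2_space lborel" by (intro L2_space_diff u v)
      have AE2: "AE x in lebesgue. w x = (u x - v x) + v x" using AEw by (rule eventually_mono) simp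
      have "?K t \<le> L2_norm lebesgue (\<lambda>x. u x - v x) + t * Hk_norm 2 v"
        by (rule K_functional_le(2)[OF _ _ AE2]) (use L2_space_lborel_lebesgue[OF d] vH(1) t in auto)
      also have "\<dots> \<le> q * S + t * (m * (q * (Z + G / \<delta> + S / \<delta>\<^sup>2)))"
        using L2_space_lborel_lebesgue[OF d] v(2) vH(2) t by (intro add_mono mult_left_mono) auto
      also have "t * (m * (q * (Z + G / \<delta> + S / \<delta>\<^sup>2))) = m * q * (\<delta>\<^sup>2 * Z + H * p + Y * p)"
        using \<delta> by (simp add: G_def S_def field_simps power2_eq_square)
      also have "\<dots> \<le> m * q * (p * Z + H * p + Y * p)"
      proof (intro mult_left_mono add_mono mult_right_mono)
        have "\<delta> powr 2 \<le> \<delta> powr \<sigma>" using \<delta> \<delta>0 \<sigma> by (intro powr_mono') auto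
        then show "\<delta>\<^sup>2 \<le> p" using \<delta> by (simp add: p_def powr_numeral)
      qed (use Z0 m q H Y in auto)
      also have "q * S + m * q * (p * Z + H * p + Y * p) = p * (q * Y + m * q * (Z + H + Y))"
        by (simp add: S_def algebra_simps)
      also have "\<dots> \<le> p * (C * (Y + Z + H))"
      proof (intro mult_left_mono)
        have "q * Y \<le> q * (Y + Z + H)" using q Z0 H by (intro mult_left_mono) auto
        moreover have "0 \<le> 1 / \<delta>0\<^sup>2 * (Y + Z + H)" using Y Z0 H by simp
        moreover have "C * (Y + Z + H) = q * (Y + Z + H) + m * q * (Z + H + Y) + 1 / \<delta>0\<^sup>2 * (Y + Z + H)"
          by (simp add: C_def algebra_simps)
        ultimately show "q * Y + m * q * (Z + H + Y) \<le> C * (Y + Z + H)" by linarith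
      qed (use p in auto)
      finally have Kp: "?K t \<le> p * (C * (Y + Z + H))" by simp
      have tp: "t powr (- (\<sigma> / 2)) = 1 / p"
      proof -
        have "t powr (- (\<sigma> / 2)) = (\<delta> powr 2) powr (- (\<sigma> / 2))" using \<delta> by (simp add: powr_numeral)
        also have "\<dots> = \<delta> powr (- \<sigma>)" by (simp add: powr_powr)
        finally show ?thesis by (simp add: p_def powr_minus_divide)
      qed
      show ?thesis unfolding tp using Kp p by (simp add: field_simps)
    next
      \<comment> \<open>For large \<open>t\<close> the trivial splitting of \<open>w\<close> into
        \<open>u\<close> and 0 suffices, because \<open>t powr (- (\<sigma> / 2))\<close> is at most
        1/\<delta>0^2.\<close>
      case False
      then have t2: "\<delta>0\<^sup>2 < t" by simp
      have "t powr (- (\<sigma> / 2)) \<le> (\<delta>0\<^sup>2) powr (- (\<sigma> / 2))"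
        using t2 \<delta>0 \<sigma> by (intro powr_mono2') auto
      also have "\<dots> \<le> (\<delta>0\<^sup>2) powr (- 1)"
        using \<delta>0 \<sigma> by (intro powr_mono') (auto simp: power_le_one)
      also have "\<dots> = 1 / \<delta>0\<^sup>2" using \<delta>0 by (simp add: powr_minus_divide)
      finally have "t powr (- (\<sigma> / 2)) * ?K t \<le> 1 / \<delta>0\<^sup>2 * Z"
        using K[of t] t Z by (intro mult_mono) auto
      also have "\<dots> \<le> C * (Y + Z + H)"
        using q m Y Z0 H \<delta>0 by (intro mult_mono) (auto simp: C_def)
      finally show ?thesis .
    qed
    have "\<exists>u0\<in>L2_space lebesgue. \<exists>u1\<in>Hk_space 2. AE x in lebesgue. w x = u0 x + u1 x"
      using uL(1) zH(1) AEw by (intro bexI[of _ u] bexI[of _ zero]) (auto simp: zero_def)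
    moreover have "bdd_above ((\<lambda>t. t powr (- (\<sigma> / 2)) * ?K t) ` {0<..})"
      using bound by (intro bdd_aboveI2) auto
    ultimately show "w \<in> besov_space \<sigma>" by (simp add: besov_space_def interp_space_def)
    show "besov_norm \<sigma> w \<le> C * (Y + Z + H)"
      unfolding besov_norm_def interp_norm_def using bound by (intro cSUP_least) auto
  qed
qed

text \<open>At order 1/2 the parallelogram identity leaves room: 2 P \<delta> from the doubled step
  plus P \<delta> from the second difference stay below 4 P \<delta>. So first differences inherit
  the size \<open>Y\<close> of the second ones without any further loss near the critical exponent,
  unlike the sharper linear decay.\<close>

lemma modulus_decay_half:
  fixes u :: "'a::euclidean_space \<Rightarrow> real"
  assumes u: "u \<in> L2_space lborel" and \<delta>0: "0 < \<delta>0" "\<delta>0 \<le> 1 / 2" and Z: "L2_norm lborel u \<le> Z" and Y: "0 \<le> Y"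
    and \<sigma>: "1 / 2 \<le> \<sigma>" and m2: "\<And>k. norm k \<le> \<delta>0 \<Longrightarrow> modulus2 u k \<le> Y * norm k powr \<sigma>" and k: "norm k \<le> 1"
  shows "(modulus u k)\<^sup>2 \<le> (Y\<^sup>2 + 4 * Z\<^sup>2 / \<delta>0) * norm k"
proof (cases "k = 0")
  case False
  define P where "P = Y\<^sup>2 + 4 * Z\<^sup>2 / \<delta>0"
  have P: "Y\<^sup>2 \<le> P" "4 * Z\<^sup>2 / \<delta>0 \<le> P" using \<delta>0 by (auto simp: P_def)
  have "\<forall>k :: 'a. norm k = \<delta> \<longrightarrow> (modulus u k)\<^sup>2 \<le> P * \<delta>" if "0 < \<delta>" "\<delta> \<le> 1" for \<delta>
  proof (rule dyadic_downward_induct[OF \<delta>0, where Q = "\<lambda>\<delta>. \<forall>k :: 'a. norm k = \<delta> \<longrightarrow> (modulus u k)\<^sup>2 \<le> P * \<delta>"])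
    fix \<delta> :: real assume d: "\<delta>0 < \<delta>" "\<delta> \<le> 1"
    show "\<forall>k :: 'a. norm k = \<delta> \<longrightarrow> (modulus u k)\<^sup>2 \<le> P * \<delta>"
    proof (intro allI impI)
      fix k :: 'a
      have "modulus u k \<le> 2 * Z" using modulus_le_norm[OF u, of k] Z by linarith
      then have "(modulus u k)\<^sup>2 \<le> (2 * Z)\<^sup>2" by (intro power_mono) auto
      also have "\<dots> = 4 * Z\<^sup>2 / \<delta>0 * \<delta>0" using \<delta>0 by (simp add: power_mult_distrib)
      also have "\<dots> \<le> P * \<delta>" using P d \<delta>0 order_trans[OF zero_le_power2 P(1)] by (intro mult_mono) auto
      finally show "(modulus u k)\<^sup>2 \<le> P * \<delta>" .
    qed
  next
    fix \<delta> :: real assume d: "0 < \<delta>" "\<delta> \<le> \<delta>0" and IH: "\<forall>k :: 'a. norm k = 2 * \<delta> \<longrightarrow> (modulus u k)\<^sup>2 \<le> P * (2 * \<delta>)"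
    show "\<forall>k :: 'a. norm k = \<delta> \<longrightarrow> (modulus u k)\<^sup>2 \<le> P * \<delta>"
    proof (intro allI impI)
      fix k :: 'a assume k: "norm k = \<delta>"
      have "P * (2 * \<delta>) = 2 * (P * \<delta>)" by simp
      then have 1: "(modulus u (2 *\<^sub>R k))\<^sup>2 \<le> 2 * (P * \<delta>)" using IH k d by (metis norm_scaleR abs_of_pos zero_less_numeral)
      have "(modulus2 u k)\<^sup>2 \<le> (Y * \<delta> powr \<sigma>)\<^sup>2" using m2[of k] k d by (intro power_mono) auto
      also have "\<dots> = Y\<^sup>2 * \<delta> powr (2 * \<sigma>)" by (simp add: power_mult_distrib power2_eq_square powr_add[symmetric])
      also have "\<dots> \<le> Y\<^sup>2 * \<delta> powr 1" using d \<delta>0 \<sigma> by (intro mult_left_mono powr_mono') auto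
      also have "\<dots> \<le> P * \<delta>" using d P(1) by (simp add: mult_right_mono)
      finally show "(modulus u k)\<^sup>2 \<le> P * \<delta>"
        using modulus_parallelogram[OF u, of k] 1 mult_right_mono[OF order_trans[OF zero_le_power2 P(1)], of \<delta>] d
        by simp
    qed
  qed (use that in auto)
  then show ?thesis using False k by (simp add: P_def)
qed (simp add: modulus_def L2_norm_def)

lemma near_solution_integrable:
  assumes K: "bounded K" and u: "near_solution s K N u"
  shows "integrable lborel u"
proof -
  obtain R where R: "\<And>x. x \<in> K \<Longrightarrow> norm x \<le> R" using K bounded_iff by blast
  have "(indicator (cball 0 R) :: 'a \<Rightarrow> real) \<in> L2_space lborel"
    by (rule L2_space_compact_support(1)[where M = 1 and R = R]) (auto intro: borel_measurable_indicator split: split_indicator)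
  from L2_integrable_mult[OF this near_solutionD(1)[OF u]]
  show ?thesis
  proof (rule Bochner_Integration.integrable_cong[THEN iffD1, rotated -1])
    show "indicator (cball 0 R) x * u x = u x" for x
      using R[of x] near_solutionD(2)[OF u, of x] by (cases "x \<in> K") auto
  qed auto
qed

text \<open>In both regimes the second differences have size N over the root of the distance
  \<open>z\<close>. First differences must not be worse: order 1/2 is enough for them, since
  \<sigma> is at most 3/2.\<close>

lemma near_solution_besov:
  fixes \<Omega> :: "'a::euclidean_space set"
  assumes \<Omega>: "bounded_lipschitz_domain \<Omega>"
  shows "\<exists>C>0. \<forall>s u w N. 0 < s \<longrightarrow> s < 1 \<longrightarrow> 0 < N \<longrightarrow> near_solution s (closure \<Omega>) N u \<longrightarrow>
     (AE x in lborel. w x = u x) \<longrightarrow>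
     (\<forall>\<tau>. 0 < \<tau> \<longrightarrow> \<tau> < 1 \<longrightarrow> \<tau> \<le> 2 * s \<longrightarrow> w \<in> besov_space \<tau> \<and> besov_norm \<tau> w \<le> C * N / sqrt (1 - \<tau>)) \<and>
     (1 / 2 < s \<longrightarrow> w \<in> besov_space (s + 1 / 2) \<and> besov_norm (s + 1 / 2) w \<le> C * N / sqrt (2 * s - 1))"
proof -
  have K: "bounded (closure \<Omega>)" using \<Omega> by (simp add: bounded_lipschitz_domain_def bounded_closure)
  obtain C1 \<delta>0 where C1: "C1 > 0" and \<delta>0: "\<delta>0 > 0" "\<delta>0 \<le> 1 / 2"
    and reg: "\<forall>s u N. 0 < s \<longrightarrow> s < 1 \<longrightarrow> 0 < N \<longrightarrow> near_solution s (closure \<Omega>) N u \<longrightarrow>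
     L2_norm lborel u \<le> C1 * N \<and>
     (\<forall>\<tau> k. 0 < \<tau> \<longrightarrow> \<tau> < 1 \<longrightarrow> \<tau> \<le> 2 * s \<longrightarrow> norm k \<le> \<delta>0 \<longrightarrow>
        modulus2 u k \<le> C1 * N / sqrt (1 - \<tau>) * norm k powr \<tau>) \<and>
     (1 / 2 < s \<longrightarrow> (\<forall>k. norm k \<le> \<delta>0 \<longrightarrow>
        modulus2 u k \<le> C1 * N / sqrt (2 * s - 1) * norm k powr (s + 1 / 2)))"
    using near_solution_modulus2[OF \<Omega>] by (elim exE conjE) (rule that)
  have \<delta>1: "\<delta>0 \<le> 1" using \<delta>0 by simp
  obtain C2 where C2: "C2 > 0" and bes: "\<forall>(u::'a \<Rightarrow> real) w \<sigma> Y Z H. u \<in> L2_space lborel \<longrightarrow> integrable lborel u \<longrightarrow>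
     (AE x in lborel. w x = u x) \<longrightarrow>
     0 < \<sigma> \<longrightarrow> \<sigma> \<le> 2 \<longrightarrow> 0 \<le> Y \<longrightarrow> L2_norm lborel u \<le> Z \<longrightarrow> 0 \<le> H \<longrightarrow>
     (\<forall>k. norm k \<le> \<delta>0 \<longrightarrow> modulus2 u k \<le> Y * norm k powr \<sigma>) \<longrightarrow>
     (\<forall>\<delta> k. 0 < \<delta> \<longrightarrow> \<delta> \<le> \<delta>0 \<longrightarrow> norm k \<le> \<delta> \<longrightarrow> modulus u k * \<delta> \<le> H * \<delta> powr \<sigma>) \<longrightarrow>
     w \<in> besov_space \<sigma> \<and> besov_norm \<sigma> w \<le> C2 * (Y + Z + H)"
    using besov_bound_of_moduli[OF \<delta>0(1) \<delta>1, where 'a='a] by (elim exE conjE) (rule that)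
  define C where "C = C2 * ((3 + 2 / \<delta>0) * C1)"
  have C: "0 < C" using C1 C2 \<delta>0 by (auto simp: C_def intro!: mult_pos_pos add_pos_pos)
  have main: "w \<in> besov_space \<sigma> \<and> besov_norm \<sigma> w \<le> C * N / sqrt z"
    if s: "0 < s" "s < 1" and N: "0 < N" and u: "near_solution s (closure \<Omega>) N u" and w: "AE x in lborel. w x = u x"
      and \<sigma>: "0 < \<sigma>" "\<sigma> \<le> 3 / 2" and z: "0 < z" "z \<le> 1"
      and m2: "\<And>k. norm k \<le> \<delta>0 \<Longrightarrow> modulus2 u k \<le> C1 * N / sqrt z * norm k powr \<sigma>" for s u w N \<sigma> z
  proof -
    note uD = near_solutionD(1)[OF u]
    define Z where "Z = C1 * N"
    define Y where "Y = C1 * N / sqrt z"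
    define H where "H = Y + 2 * Z / \<delta>0"
    have Z0: "0 < Z" using C1 N by (simp add: Z_def)
    have Y0: "0 < Y" using C1 N z by (simp add: Y_def)
    have H0: "0 \<le> H" using Y0 Z0 \<delta>0 by (simp add: H_def)
    have ZY: "Z \<le> Y"
    proof -
      have "sqrt z \<le> 1" using z by simp
      then have "Z * sqrt z \<le> Z * 1" using Z0 by (intro mult_left_mono) auto
      then show ?thesis using z by (simp add: Y_def Z_def field_simps)
    qed
    have uZ: "L2_norm lborel u \<le> Z" unfolding Z_def using reg s N u by blast
    have m1: "modulus u k * \<delta> \<le> H * \<delta> powr \<sigma>" if d: "0 < \<delta>" "\<delta> \<le> \<delta>0" "norm k \<le> \<delta>" for \<delta> k
    proof (cases "\<sigma> \<le> 1")
      \<comment> \<open>The required order \<sigma> - 1 of the first differences is at most 0, so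
        boundedness by twice the norm of \<open>u\<close> suffices.\<close>
      case True
      have "modulus u k \<le> 2 * Z" using modulus_le_norm[OF uD, of k] uZ by linarith
      also have "\<dots> \<le> 2 * Z / \<delta>0" using Z0 \<delta>0 by (simp add: field_simps mult_left_le)
      also have "\<dots> \<le> H" using Y0 by (simp add: H_def)
      finally have "modulus u k \<le> H" .
      moreover have "\<delta> powr 1 \<le> \<delta> powr \<sigma>" using d \<delta>0 True by (intro powr_mono') auto
      ultimately show ?thesis using d H0 by (intro mult_mono) auto
    next
      \<comment> \<open>Here \<sigma> - 1 lies between 0 and 1/2, and decay of order 1/2 covers it
        on scales below 1.\<close>
      case False
      have "(modulus u k)\<^sup>2 \<le> (Y\<^sup>2 + 4 * Z\<^sup>2 / \<delta>0) * norm k"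
      proof (rule modulus_decay_half[OF uD \<delta>0 uZ])
        show "\<And>k. norm k \<le> \<delta>0 \<Longrightarrow> modulus2 u k \<le> Y * norm k powr \<sigma>" unfolding Y_def by (rule m2)
      qed (use Y0 False d \<delta>0 in auto)
      also have "\<dots> \<le> (Y\<^sup>2 + 4 * Z\<^sup>2 / \<delta>0) * \<delta>" using d \<delta>0 by (intro mult_left_mono) auto
      also have "\<dots> \<le> H\<^sup>2 * \<delta>"
      proof (intro mult_right_mono)
        have "H\<^sup>2 = Y\<^sup>2 + 2 * Y * (2 * Z / \<delta>0) + (2 * Z / \<delta>0)\<^sup>2" by (simp add: H_def power2_sum)
        moreover have "0 \<le> 2 * Y * (2 * Z / \<delta>0)" using Y0 Z0 \<delta>0 by simp
        moreover have "4 * Z\<^sup>2 / \<delta>0 \<le> (2 * Z / \<delta>0)\<^sup>2"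
        proof -
          have "4 * Z\<^sup>2 / \<delta>0 \<le> 4 * Z\<^sup>2 / (\<delta>0 * \<delta>0)" using \<delta>0 by (intro divide_left_mono) (auto simp: mult_left_le)
          then show ?thesis by (simp add: power_divide power_mult_distrib power2_eq_square)
        qed
        ultimately show "Y\<^sup>2 + 4 * Z\<^sup>2 / \<delta>0 \<le> H\<^sup>2" by linarith
      qed (use d in auto)
      also have "\<dots> = (H * \<delta> powr (1/2))\<^sup>2" using d by (simp add: power_mult_distrib powr_half_sqrt)
      finally have "modulus u k \<le> H * \<delta> powr (1/2)" by (rule power2_le_imp_le) (use H0 in simp)
      then have "modulus u k * \<delta> \<le> H * \<delta> powr (1/2) * \<delta> powr 1" using d H0 by (intro mult_mono) auto
      also have "\<dots> = H * \<delta> powr (3/2)" unfolding mult.assoc powr_add[symmetric] by simp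
      also have "\<dots> \<le> H * \<delta> powr \<sigma>" using d \<delta>0 \<sigma> H0 by (intro mult_left_mono powr_mono') auto
      finally show ?thesis .
    qed
    have "w \<in> besov_space \<sigma> \<and> besov_norm \<sigma> w \<le> C2 * (Y + Z + H)"
      using bes[rule_format (no_asm), of u w \<sigma> Y Z H] uD near_solution_integrable[OF K u] w \<sigma> Y0 uZ H0 m1 m2
      unfolding Y_def[symmetric] by auto
    moreover have "C2 * (Y + Z + H) \<le> C * N / sqrt z"
    proof -
      have "2 * Z / \<delta>0 \<le> 2 * Y / \<delta>0" using ZY \<delta>0 by (intro divide_right_mono) auto
      then have "Y + Z + H \<le> 3 * Y + 2 * Y / \<delta>0" using ZY unfolding H_def by linarith
      also have "\<dots> = (3 + 2 / \<delta>0) * Y" by (simp add: distrib_right)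
      finally have "C2 * (Y + Z + H) \<le> C2 * ((3 + 2 / \<delta>0) * Y)" using C2 by (intro mult_left_mono) auto
      also have "\<dots> = C * N / sqrt z" by (simp add: C_def Y_def)
      finally show ?thesis .
    qed
    ultimately show ?thesis by simp
  qed
  have "(\<forall>\<tau>. 0 < \<tau> \<longrightarrow> \<tau> < 1 \<longrightarrow> \<tau> \<le> 2 * s \<longrightarrow> w \<in> besov_space \<tau> \<and> besov_norm \<tau> w \<le> C * N / sqrt (1 - \<tau>)) \<and>
     (1 / 2 < s \<longrightarrow> w \<in> besov_space (s + 1 / 2) \<and> besov_norm (s + 1 / 2) w \<le> C * N / sqrt (2 * s - 1))"
    if s: "0 < s" "s < 1" and N: "0 < N" and u: "near_solution s (closure \<Omega>) N u" and w: "AE x in lborel. w x = u x" for s u w N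
  proof (intro conjI[of "\<forall>\<tau>. _ \<tau>"] allI impI)
    note r = reg[rule_format (no_asm), OF s N u]
    show "w \<in> besov_space \<tau> \<and> besov_norm \<tau> w \<le> C * N / sqrt (1 - \<tau>)" if "0 < \<tau>" "\<tau> < 1" "\<tau> \<le> 2 * s" for \<tau>
      using that r by (intro main[OF s N u w]) auto
    show "w \<in> besov_space (s + 1 / 2) \<and> besov_norm (s + 1 / 2) w \<le> C * N / sqrt (2 * s - 1)" if "1 / 2 < s"
      using that r s by (intro main[OF s N u w]) auto
  qed
  then show ?thesis using C by blast
qed

section \<open>From Lebesgue to Borel representatives\<close>

text \<open>\<open>Hs_form\<close> integrates over the product of two completed measures; Tonelli on
  that product rests on this fact.\<close>

lemma sigma_finite_lebesgue: "sigma_finite_measure (lebesgue :: 'a::euclidean_space measure)"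
proof
  show "\<exists>A. countable A \<and> A \<subseteq> sets (lebesgue :: 'a measure) \<and> \<Union> A = space lebesgue \<and> (\<forall>a\<in>A. emeasure lebesgue a \<noteq> \<infinity>)"
  proof (intro exI[of _ "range (\<lambda>n::nat. cball 0 (real n))"] conjI ballI)
    show "\<Union> (range (\<lambda>n::nat. cball 0 (real n))) = space (lebesgue :: 'a measure)"
      using real_arch_simple by (auto simp: mem_cball)
    fix a :: "'a set" assume "a \<in> range (\<lambda>n::nat. cball 0 (real n))"
    then show "emeasure lebesgue a \<noteq> \<infinity>" using emeasure_lborel_cball_finite[of "0::'a"] by (auto simp: less_top)
  qed auto
qed

interpretation lebesgue: sigma_finite_measure "lebesgue :: 'a::euclidean_space measure"
  by (rule sigma_finite_lebesgue)

interpretation lebesgue_pair: pair_sigma_finite "lebesgue :: 'a::euclidean_space measure" "lebesgue :: 'b::euclidean_space measure" ..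

text \<open>The complement of the support is a possibly uncountable union of open sets on which
  \<open>v\<close> vanishes almost everywhere. Lindelof selects countably many with the same union,
  so the exceptional sets remain null together.\<close>

lemma ess_support_AE:
  fixes v :: "'a::euclidean_space \<Rightarrow> real"
  shows "AE x in lebesgue. x \<notin> ess_support v \<longrightarrow> v x = 0"
proof -
  let ?F = "{U. open U \<and> (AE x in lebesgue. x \<in> U \<longrightarrow> v x = 0)}"
  obtain F' where F': "F' \<subseteq> ?F" "countable F'" "\<Union>F' = \<Union>?F"
    by (rule Lindelof[of ?F]) auto
  have "AE x in lebesgue. \<forall>U\<in>F'. x \<in> U \<longrightarrow> v x = 0"
    using F' by (subst AE_ball_countable) auto
  then show ?thesis
  proof (rule eventually_mono)
    fix x assume *: "\<forall>U\<in>F'. x \<in> U \<longrightarrow> v x = 0"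
    show "x \<notin> ess_support v \<longrightarrow> v x = 0"
    proof
      assume "x \<notin> ess_support v"
      then have "x \<in> \<Union>F'" unfolding F'(3) ess_support_def by blast
      then show "v x = 0" using * by blast
    qed
  qed
qed

lemma ess_support_subset:
  assumes "closed K" "\<And>x. x \<notin> K \<Longrightarrow> v x = 0"
  shows "ess_support v \<subseteq> K"
proof -
  have "- K \<in> {U. open U \<and> (AE x in lebesgue. x \<in> U \<longrightarrow> v x = 0)}"
    using assms by (auto intro!: AE_I2)
  then have "- K \<subseteq> \<Union>{U. open U \<and> (AE x in lebesgue. x \<in> U \<longrightarrow> v x = 0)}" by (rule Union_upper)
  then show ?thesis unfolding ess_support_def by blast
qed

lemma measurable_lebesgue_pair:
  fixes f :: "'a::euclidean_space \<times> 'a \<Rightarrow> 'b::{second_countable_topology, t2_space}"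
  assumes "f \<in> borel_measurable borel"
  shows "f \<in> borel_measurable (lebesgue \<Otimes>\<^sub>M lebesgue)"
proof -
  have id: "(\<lambda>x. x) \<in> lebesgue \<rightarrow>\<^sub>M (lborel :: 'a measure)"
    by (rule measurable_completion) (rule measurable_ident_sets[OF refl])
  have "(\<lambda>p. (fst p, snd p)) \<in> lebesgue \<Otimes>\<^sub>M lebesgue \<rightarrow>\<^sub>M (lborel \<Otimes>\<^sub>M lborel :: ('a \<times> 'a) measure)"
  proof (rule measurable_Pair)
    show "fst \<in> lebesgue \<Otimes>\<^sub>M (lebesgue :: 'a measure) \<rightarrow>\<^sub>M (lborel :: 'a measure)"
      by (rule measurable_compose[OF measurable_fst id])
    show "snd \<in> (lebesgue :: 'a measure) \<Otimes>\<^sub>M lebesgue \<rightarrow>\<^sub>M (lborel :: 'a measure)"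
      by (rule measurable_compose[OF measurable_snd id])
  qed
  moreover have "f \<in> borel_measurable (lborel \<Otimes>\<^sub>M lborel)" using assms by (simp add: lborel_prod)
  ultimately show ?thesis using measurable_compose by fastforce
qed

text \<open>
  Splitting the singular weight symmetrically turns the energy form into an \<open>L\<^sup>2\<close> inner product on
  pairs of points.
\<close>

definition gagliardo :: "real \<Rightarrow> ('a::euclidean_space \<Rightarrow> real) \<Rightarrow> 'a \<times> 'a \<Rightarrow> real" where
  "gagliardo s v p = (v (fst p) - v (snd p)) * sqrt (riesz_kernel s (fst p - snd p))"

lemma gagliardo_mult:
  fixes u v :: "'a::euclidean_space \<Rightarrow> real"
  shows "gagliardo s u p * gagliardo s v p =
    (u (fst p) - u (snd p)) * (v (fst p) - v (snd p)) / norm (fst p - snd p) powr (real DIM('a) + 2 * s)"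
proof -
  have "sqrt (riesz_kernel s (fst p - snd p)) * sqrt (riesz_kernel s (fst p - snd p)) = riesz_kernel s (fst p - snd p)"
    by simp
  moreover have "gagliardo s u p * gagliardo s v p = (u (fst p) - u (snd p)) * (v (fst p) - v (snd p)) *
      (sqrt (riesz_kernel s (fst p - snd p)) * sqrt (riesz_kernel s (fst p - snd p)))"
    unfolding gagliardo_def by (simp only: mult_ac)
  ultimately have "gagliardo s u p * gagliardo s v p = (u (fst p) - u (snd p)) * (v (fst p) - v (snd p)) * riesz_kernel s (fst p - snd p)"
    by (simp only:)
  then show ?thesis by (simp add: riesz_kernel_def)
qed

lemma Hs_form_gagliardo:
  fixes u v :: "'a::euclidean_space \<Rightarrow> real"
  shows "Hs_form s u v = frac_const DIM('a) s / 2 * (LINT p|(lebesgue \<Otimes>\<^sub>M lebesgue). gagliardo s u p * gagliardo s v p)"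
  unfolding gagliardo_mult Hs_form_def by (simp add: case_prod_unfold)

lemma Hs_space_gagliardo:
  fixes v :: "'a::euclidean_space \<Rightarrow> real"
  shows "v \<in> Hs_space s \<longleftrightarrow> v \<in> L2_space lebesgue \<and> integrable (lebesgue \<Otimes>\<^sub>M lebesgue) (\<lambda>p. (gagliardo s v p)\<^sup>2)"
  unfolding power2_eq_square[of "gagliardo s v _"] gagliardo_mult Hs_space_def
  by (simp add: case_prod_unfold power2_eq_square)

lemma borel_measurable_gagliardo [measurable]:
  assumes [measurable]: "v \<in> borel_measurable borel"
  shows "gagliardo s v \<in> borel_measurable borel"
proof -
  have "(\<lambda>p. (v (fst p) - v (snd p)) * sqrt (riesz_kernel s (fst p - snd p))) \<in> borel_measurable (borel \<Otimes>\<^sub>M borel)"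
    by measurable
  then show ?thesis by (simp add: gagliardo_def[abs_def] borel_prod)
qed

text \<open>Tonelli, the substitution y = x + h and a second exchange of integrals. For a Borel
  function the iterated integrals over \<open>lebesgue\<close> and \<open>lborel\<close>
  agree.\<close>

lemma energy_eq_gagliardo:
  fixes v :: "'a::euclidean_space \<Rightarrow> real"
  assumes [measurable]: "v \<in> borel_measurable borel"
  shows "(\<integral>\<^sup>+p. ennreal ((gagliardo s v p)\<^sup>2) \<partial>(lebesgue \<Otimes>\<^sub>M lebesgue)) = energy s v"
proof -
  define F where "F p = ennreal ((gagliardo s v p)\<^sup>2)" for p
  have F [measurable]: "F \<in> borel_measurable borel" unfolding F_def by measurable
  have "F \<in> borel_measurable (borel \<Otimes>\<^sub>M borel)" using F by (simp add: borel_prod)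
  then have Fx: "(\<lambda>y. F (x, y)) \<in> borel_measurable borel" for x by measurable
  have eq: "F (x, h + x) = ennreal (riesz_kernel s h) * ennreal ((v (x + h) - v x)\<^sup>2)" for x h
    by (simp add: F_def gagliardo_def power_mult_distrib ennreal_mult mult.commute add.commute power2_commute[of "v x"])
  have "(\<integral>\<^sup>+p. F p \<partial>(lebesgue \<Otimes>\<^sub>M lebesgue)) = (\<integral>\<^sup>+x. \<integral>\<^sup>+y. F (x, y) \<partial>lebesgue \<partial>lebesgue)"
    by (rule lebesgue.nn_integral_fst[symmetric]) (rule measurable_lebesgue_pair[OF F])
  also have "\<dots> = (\<integral>\<^sup>+x. \<integral>\<^sup>+y. F (x, y) \<partial>lborel \<partial>lborel)" by (simp add: nn_integral_completion)
  also have "\<dots> = (\<integral>\<^sup>+x. \<integral>\<^sup>+h. F (x, h + x) \<partial>lborel \<partial>lborel)"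
    by (intro nn_integral_cong nn_integral_lborel_translate[symmetric] Fx)
  also have "\<dots> = (\<integral>\<^sup>+x. \<integral>\<^sup>+h. ennreal (riesz_kernel s h) * ennreal ((v (x + h) - v x)\<^sup>2) \<partial>lborel \<partial>lborel)"
    unfolding eq ..
  also have "\<dots> = (\<integral>\<^sup>+h. \<integral>\<^sup>+x. ennreal (riesz_kernel s h) * ennreal ((v (x + h) - v x)\<^sup>2) \<partial>lborel \<partial>lborel)"
    by (rule lborel_pair.Fubini') measurable
  also have "\<dots> = energy s v"
    unfolding energy_def by (intro nn_integral_cong nn_integral_cmult) measurable
  finally show ?thesis unfolding F_def .
qed

lemma gagliardo_L2:
  fixes v :: "'a::euclidean_space \<Rightarrow> real"
  assumes v: "v \<in> borel_measurable borel"
  shows "gagliardo s v \<in> L2_space (lebesgue \<Otimes>\<^sub>M lebesgue) \<longleftrightarrow> energy s v < \<infinity>"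
    and "enn2real (energy s v) = (L2_norm (lebesgue \<Otimes>\<^sub>M lebesgue) (gagliardo s v))\<^sup>2"
proof -
  have m: "gagliardo s v \<in> borel_measurable (lebesgue \<Otimes>\<^sub>M lebesgue)"
    using v by (intro measurable_lebesgue_pair borel_measurable_gagliardo)
  show "gagliardo s v \<in> L2_space (lebesgue \<Otimes>\<^sub>M lebesgue) \<longleftrightarrow> energy s v < \<infinity>"
    using m energy_eq_gagliardo[OF v, of s] by (simp add: L2_space_def integrable_iff_bounded)
  have "(LINT p|(lebesgue \<Otimes>\<^sub>M lebesgue). (gagliardo s v p)\<^sup>2) = enn2real (energy s v)"
    using m energy_eq_gagliardo[OF v, of s] by (subst integral_eq_nn_integral) auto
  then show "enn2real (energy s v) = (L2_norm (lebesgue \<Otimes>\<^sub>M lebesgue) (gagliardo s v))\<^sup>2"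
    by (simp add: L2_norm_sq)
qed

text \<open>An exceptional null set in one variable produces null strips in both variables of the
  product, outside which the two kernels coincide.\<close>

lemma gagliardo_cong_AE:
  fixes u w :: "'a::euclidean_space \<Rightarrow> real"
  assumes m: "u \<in> borel_measurable lebesgue" "w \<in> borel_measurable lebesgue" and eq: "AE x in lebesgue. w x = u x"
  shows "AE p in lebesgue \<Otimes>\<^sub>M lebesgue. gagliardo s w p = gagliardo s u p"
proof -
  have [measurable]: "(\<lambda>p. w (fst p)) \<in> borel_measurable (lebesgue \<Otimes>\<^sub>M (lebesgue :: 'a measure))"
    "(\<lambda>p. u (fst p)) \<in> borel_measurable (lebesgue \<Otimes>\<^sub>M (lebesgue :: 'a measure))"
    "(\<lambda>p. w (snd p)) \<in> borel_measurable ((lebesgue :: 'a measure) \<Otimes>\<^sub>M lebesgue)"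
    "(\<lambda>p. u (snd p)) \<in> borel_measurable ((lebesgue :: 'a measure) \<Otimes>\<^sub>M lebesgue)"
    using measurable_compose[OF measurable_fst m(1)] measurable_compose[OF measurable_fst m(2)]
      measurable_compose[OF measurable_snd m(1)] measurable_compose[OF measurable_snd m(2)] by auto
  have "AE p in lebesgue \<Otimes>\<^sub>M lebesgue. w (fst p) = u (fst p) \<and> w (snd p) = u (snd p)"
  proof (rule lebesgue_pair.AE_pair_measure)
    show "{p \<in> space (lebesgue \<Otimes>\<^sub>M lebesgue). w (fst p) = u (fst p) \<and> w (snd p) = u (snd p)} \<in> sets (lebesgue \<Otimes>\<^sub>M lebesgue)"
      by measurable
    show "AE x in lebesgue. AE y in lebesgue. w (fst (x, y)) = u (fst (x, y)) \<and> w (snd (x, y)) = u (snd (x, y))"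
      using eq by (rule eventually_mono) (use eq in auto)
  qed
  then show ?thesis by (rule eventually_mono) (simp add: gagliardo_def)
qed

text \<open>Polarization of the squared norm of \<open>gagliardo\<close> turns the energy defect
  into twice the form, and the restriction of the test function to \<open>\<Omega>\<close> costs no
  norm in Cauchy-Schwarz. The remaining work is to replace \<open>w\<close> by a Borel
  function.\<close>

lemma weak_solution_near_solution:
  fixes \<Omega> :: "'a::euclidean_space set"
  assumes \<Omega>: "open \<Omega>" and s: "0 < s" "s < 1" and f: "f \<in> L2_space (lebesgue_on \<Omega>)"
    and w: "weak_solution s \<Omega> (L2_functional \<Omega> f) w" and N: "L2_norm (lebesgue_on \<Omega>) f \<le> N"
  shows "\<exists>u. near_solution s (closure \<Omega>) N u \<and> (AE x in lborel. w x = u x)"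
proof -
  let ?P = "lebesgue \<Otimes>\<^sub>M lebesgue :: ('a \<times> 'a) measure"
  have wH: "w \<in> Hs_space s" "ess_support w \<subseteq> closure \<Omega>"
    and eq: "\<And>v. v \<in> Hs_tilde s \<Omega> \<Longrightarrow> Hs_form s w v = L2_functional \<Omega> f v"
    using w by (auto simp: weak_solution_def Hs_tilde_def)
  have wL: "w \<in> L2_space lebesgue" using wH by (simp add: Hs_space_def)
  obtain v where v: "v \<in> L2_space lborel" "AE x in lborel. w x = v x" using L2_space_lebesgue_borel[OF wL] by blast
  \<comment> \<open>The support condition makes this a change on a null set only; afterwards
    \<open>u\<close> vanishes at every point outside the closure, which pointwise support arguments
    rely on.\<close>
  define u where "u x = indicator (closure \<Omega>) x * v x" for x
  have [measurable]: "v \<in> borel_measurable borel" using v by (simp add: L2_space_def)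
  have um [measurable]: "u \<in> borel_measurable borel" unfolding u_def
    by (intro borel_measurable_times borel_measurable_indicator) auto
  have uL: "u \<in> L2_space lborel"
    by (rule L2_space_mono[OF v(1)]) (auto simp: u_def split: split_indicator)
  have u0: "u x = 0" if "x \<notin> closure \<Omega>" for x using that by (simp add: u_def)
  have wu: "AE x in lebesgue. w x = u x"
    using ess_support_AE[of w] AE_completion[OF v(2)]
    by eventually_elim (use wH(2) in \<open>auto simp: u_def split: split_indicator\<close>)
  have wu': "AE x in lborel. w x = u x" using wu by (simp add: AE_completion_iff)
  have wm: "w \<in> borel_measurable lebesgue" using wL by (simp add: L2_space_def)
  have um': "u \<in> borel_measurable lebesgue" using um by (intro measurable_completion) simp
  have gAE: "AE p in ?P. gagliardo s w p = gagliardo s u p" by (rule gagliardo_cong_AE[OF um' wm wu])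
  have gum: "gagliardo s u \<in> borel_measurable ?P" by (intro measurable_lebesgue_pair borel_measurable_gagliardo um)
  have gwm: "gagliardo s w \<in> borel_measurable ?P"
  proof -
    have [measurable]: "(\<lambda>p. w (fst p)) \<in> borel_measurable ?P" "(\<lambda>p. w (snd p)) \<in> borel_measurable ?P"
      using measurable_compose[OF measurable_fst wm] measurable_compose[OF measurable_snd wm] by auto
    have [measurable]: "(\<lambda>p. riesz_kernel s (fst p - snd p)) \<in> borel_measurable ?P"
    proof (rule measurable_lebesgue_pair)
      have "(\<lambda>p. riesz_kernel s (fst p - snd p)) \<in> borel_measurable (borel \<Otimes>\<^sub>M (borel :: 'a measure))" by measurable
      then show "(\<lambda>p. riesz_kernel s (fst p - snd p)) \<in> borel_measurable (borel :: ('a \<times> 'a) measure)" by (simp add: borel_prod)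
    qed
    show ?thesis unfolding gagliardo_def[abs_def] by measurable
  qed
  have "integrable ?P (\<lambda>p. (gagliardo s w p)\<^sup>2)" using wH(1) by (simp add: Hs_space_gagliardo)
  then have "integrable ?P (\<lambda>p. (gagliardo s u p)\<^sup>2)"
    by (rule integrable_cong_AE_imp) (use gum gAE in auto)
  then have gu: "gagliardo s u \<in> L2_space ?P" using gum by (simp add: L2_space_def)
  then have ue: "energy s u < \<infinity>" using gagliardo_L2(1)[OF um] by blast
  have "near_solution s (closure \<Omega>) N u"
    unfolding near_solution_def
  proof (intro conjI ballI allI impI uL u0 ue)
    fix v :: "'a \<Rightarrow> real"
    assume vL: "v \<in> L2_space lborel" and v0: "\<forall>x. x \<notin> closure \<Omega> \<longrightarrow> v x = 0" and ve: "energy s v < \<infinity>"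
    have vm [measurable]: "v \<in> borel_measurable borel" using vL by (simp add: L2_space_def)
    have gv: "gagliardo s v \<in> L2_space ?P" using gagliardo_L2(1)[OF vm] ve by blast
    have gvm: "gagliardo s v \<in> borel_measurable ?P" using gv by (simp add: L2_space_def)
    have vt: "v \<in> Hs_tilde s \<Omega>"
      unfolding Hs_tilde_def Hs_space_gagliardo
      using L2_space_lborel_lebesgue(1)[OF vL] gv ess_support_subset[OF closed_closure, of \<Omega> v] v0
      by (auto simp: L2_space_def)
    have form: "L2_functional \<Omega> f v = frac_const DIM('a) s / 2 * (LINT p|?P. gagliardo s u p * gagliardo s v p)"
    proof -
      have "(LINT p|?P. gagliardo s w p * gagliardo s v p) = (LINT p|?P. gagliardo s u p * gagliardo s v p)"
        using gum gwm gvm gAE by (intro integral_cong_AE) auto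
      then show ?thesis using eq[OF vt] by (simp add: Hs_form_gagliardo)
    qed
    have "gagliardo s (\<lambda>x. u x + v x) = (\<lambda>p. gagliardo s u p + gagliardo s v p)"
      by (auto simp: gagliardo_def algebra_simps)
    then have "enn2real (energy s (\<lambda>x. u x + v x)) = enn2real (energy s u) + 2 * (LINT p|?P. gagliardo s u p * gagliardo s v p) + enn2real (energy s v)"
      using gagliardo_L2(2)[of "\<lambda>x. u x + v x" s] gagliardo_L2(2)[OF um, of s] gagliardo_L2(2)[OF vm, of s] L2_norm_sq_add[OF gu gv] by simp
    moreover have "0 \<le> frac_const DIM('a) s / 2"
      using s by (auto simp: frac_const_def intro!: divide_nonneg_nonneg mult_nonneg_nonneg Gamma_real_nonneg less_imp_le[OF Gamma_real_pos])
    ultimately have "frac_const DIM('a) s / 2 * \<bar>enn2real (energy s (\<lambda>x. u x + v x)) - enn2real (energy s u) - enn2real (energy s v)\<bar>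
      = 2 * \<bar>L2_functional \<Omega> f v\<bar>"
      unfolding form by (simp add: abs_mult)
    also have "\<bar>L2_functional \<Omega> f v\<bar> \<le> N * L2_norm lborel v"
    proof -
      have O: "\<Omega> \<in> sets lebesgue" using \<Omega> by simp
      have iv: "integrable lebesgue (\<lambda>x. (v x)\<^sup>2)" using L2_space_lborel_lebesgue(1)[OF vL] by (simp add: L2_space_def)
      have iv': "integrable lebesgue (\<lambda>x. indicator \<Omega> x * (v x)\<^sup>2)"
        using integrable_mult_indicator[OF O iv] by simp
      have vO: "v \<in> L2_space (lebesgue_on \<Omega>)"
        using iv' O L2_space_lborel_lebesgue(1)[OF vL]
        by (auto simp: L2_space_def integrable_restrict_space intro: measurable_restrict_space1)
      have "(L2_norm (lebesgue_on \<Omega>) v)\<^sup>2 = (LINT x|lebesgue. indicator \<Omega> x * (v x)\<^sup>2)"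
        unfolding L2_norm_sq using O by (subst integral_restrict_space) auto
      also have "\<dots> \<le> (LINT x|lebesgue. (v x)\<^sup>2)"
        by (rule integral_mono[OF iv' iv]) (auto split: split_indicator)
      also have "\<dots> = (L2_norm lborel v)\<^sup>2" using L2_space_lborel_lebesgue(2)[OF vL] by (simp flip: L2_norm_sq)
      finally have vn: "L2_norm (lebesgue_on \<Omega>) v \<le> L2_norm lborel v" by (rule power2_le_imp_le) simp
      have "\<bar>L2_functional \<Omega> f v\<bar> \<le> L2_norm (lebesgue_on \<Omega>) f * L2_norm (lebesgue_on \<Omega>) v"
        unfolding L2_functional_def by (rule L2_Cauchy_Schwarz[OF f vO])
      also have "\<dots> \<le> N * L2_norm lborel v"
        using N vn order_trans[OF L2_norm_nonneg N] by (intro mult_mono) auto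
      finally show ?thesis .
    qed
    finally show "frac_const DIM('a) s / 2 * \<bar>enn2real (energy s (\<lambda>x. u x + v x)) - enn2real (energy s u) - enn2real (energy s v)\<bar>
      \<le> 2 * N * L2_norm lborel v" by simp
  qed
  with wu' show ?thesis by blast
qed

text \<open>The estimates hold for positive \<open>N\<close>, but the norm of \<open>f\<close> may
  be 0. They are therefore applied to every \<open>N\<close> above the norm and passed to the
  limit.\<close>

lemma le_mult_if_le_mult_above:
  fixes c x a :: real
  assumes c: "0 < c" and le: "\<And>N. a < N \<Longrightarrow> x \<le> c * N"
  shows "x \<le> c * a"
proof (rule ccontr)
  assume "\<not> x \<le> c * a"
  then have "a < (a + x / c) / 2" using c by (simp add: field_simps)
  from le[OF this] show False using \<open>\<not> x \<le> c * a\<close> c by (simp add: field_simps)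
qed

theorem theorem1p1:
  fixes \<Omega> :: "'a::euclidean_space set"
  assumes "bounded_lipschitz_domain \<Omega>"
  shows "\<exists>C>0. \<forall>s f u.
    0 < s \<and> s < 1 \<and> f \<in> L2_space (lebesgue_on \<Omega>) \<and>
    weak_solution s \<Omega> (L2_functional \<Omega> f) u \<longrightarrow>
      (s \<noteq> 1/2 \<longrightarrow>
         u \<in> besov_dot (s + min s (1/2)) \<Omega> \<and>
         besov_norm (s + min s (1/2)) u
           \<le> C / sqrt \<bar>1 - 2 * s\<bar> * L2_norm (lebesgue_on \<Omega>) f) \<and>
      (s = 1/2 \<longrightarrow>
         (\<forall>\<epsilon>. 0 < \<epsilon> \<and> \<epsilon> < 1 \<longrightarrow>
            u \<in> besov_dot (1 - \<epsilon>) \<Omega> \<and>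
            besov_norm (1 - \<epsilon>) u \<le> C / sqrt \<epsilon> * L2_norm (lebesgue_on \<Omega>) f))"
proof -
  obtain C where C: "C > 0" and reg: "\<forall>s u w N. 0 < s \<longrightarrow> s < 1 \<longrightarrow> 0 < N \<longrightarrow> near_solution s (closure \<Omega>) N u \<longrightarrow>
     (AE x in lborel. w x = u x) \<longrightarrow>
     (\<forall>\<tau>. 0 < \<tau> \<longrightarrow> \<tau> < 1 \<longrightarrow> \<tau> \<le> 2 * s \<longrightarrow> w \<in> besov_space \<tau> \<and> besov_norm \<tau> w \<le> C * N / sqrt (1 - \<tau>)) \<and>
     (1 / 2 < s \<longrightarrow> w \<in> besov_space (s + 1 / 2) \<and> besov_norm (s + 1 / 2) w \<le> C * N / sqrt (2 * s - 1))"
    using near_solution_besov[OF assms] by (elim exE conjE) (rule that)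
  show ?thesis
  proof (rule exI[of _ C], intro conjI[OF C] allI impI, elim conjE)
    fix s f and u :: "'a \<Rightarrow> real"
    assume s: "0 < s" "s < 1" and f: "f \<in> L2_space (lebesgue_on \<Omega>)" and u: "weak_solution s \<Omega> (L2_functional \<Omega> f) u"
    define n where "n = L2_norm (lebesgue_on \<Omega>) f"
    have n0: "0 \<le> n" by (simp add: n_def)
    have O: "open \<Omega>" using assms by (simp add: bounded_lipschitz_domain_def)
    have supp: "ess_support u \<subseteq> closure \<Omega>" using u by (simp add: weak_solution_def Hs_tilde_def)
    have key: "(\<forall>\<tau>. 0 < \<tau> \<longrightarrow> \<tau> < 1 \<longrightarrow> \<tau> \<le> 2 * s \<longrightarrow> u \<in> besov_space \<tau> \<and> besov_norm \<tau> u \<le> C * N / sqrt (1 - \<tau>)) \<and>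
     (1 / 2 < s \<longrightarrow> u \<in> besov_space (s + 1 / 2) \<and> besov_norm (s + 1 / 2) u \<le> C * N / sqrt (2 * s - 1))"
      if N: "n < N" for N
    proof -
      obtain v where v: "near_solution s (closure \<Omega>) N v" "AE x in lborel. u x = v x"
        using weak_solution_near_solution[OF O s f u, of N] N by (auto simp: n_def)
      have "0 < N" using n0 N by linarith
      from reg[rule_format (no_asm), OF s this v] show ?thesis .
    qed
    \<comment> \<open>Applied with \<tau> = 2s below the critical value, where 1 - \<tau> = |1 -
      2s|, and with \<tau> = 1 - \<epsilon> at s = 1/2.\<close>
    have sub: "u \<in> besov_dot \<tau> \<Omega> \<and> besov_norm \<tau> u \<le> C / sqrt (1 - \<tau>) * n" if \<tau>: "0 < \<tau>" "\<tau> < 1" "\<tau> \<le> 2 * s" for \<tau>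
    proof
      show "u \<in> besov_dot \<tau> \<Omega>" using key[of "n + 1"] \<tau> supp by (simp add: besov_dot_def)
      show "besov_norm \<tau> u \<le> C / sqrt (1 - \<tau>) * n"
      proof (rule le_mult_if_le_mult_above)
        show "0 < C / sqrt (1 - \<tau>)" using C \<tau> by simp
        show "besov_norm \<tau> u \<le> C / sqrt (1 - \<tau>) * N" if "n < N" for N using key[OF that] \<tau> by simp
      qed
    qed
    have sup: "u \<in> besov_dot (s + 1 / 2) \<Omega> \<and> besov_norm (s + 1 / 2) u \<le> C / sqrt (2 * s - 1) * n" if s2: "1 / 2 < s"
    proof
      show "u \<in> besov_dot (s + 1 / 2) \<Omega>" using key[of "n + 1"] s2 supp by (simp add: besov_dot_def)
      show "besov_norm (s + 1 / 2) u \<le> C / sqrt (2 * s - 1) * n"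
      proof (rule le_mult_if_le_mult_above)
        show "0 < C / sqrt (2 * s - 1)" using C s2 by simp
        show "besov_norm (s + 1 / 2) u \<le> C / sqrt (2 * s - 1) * N" if "n < N" for N using key[OF that] s2 by simp
      qed
    qed
    have "u \<in> besov_dot (s + min s (1/2)) \<Omega> \<and> besov_norm (s + min s (1/2)) u \<le> C / sqrt \<bar>1 - 2 * s\<bar> * n" if "s \<noteq> 1/2"
    proof (cases "s < 1/2")
      case True
      then have "s + min s (1/2) = 2 * s" "\<bar>1 - 2 * s\<bar> = 1 - 2 * s" by auto
      then show ?thesis using sub[of "2 * s"] True s by simp
    next
      case False
      then have "s + min s (1/2) = s + 1/2" "\<bar>1 - 2 * s\<bar> = 2 * s - 1" using that by auto
      then show ?thesis using sup False that by simp
    qed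
    moreover have "u \<in> besov_dot (1 - \<epsilon>) \<Omega> \<and> besov_norm (1 - \<epsilon>) u \<le> C / sqrt \<epsilon> * n" if "s = 1/2" "0 < \<epsilon> \<and> \<epsilon> < 1" for \<epsilon>
      using sub[of "1 - \<epsilon>"] that by simp
    ultimately show "(s \<noteq> 1/2 \<longrightarrow> u \<in> besov_dot (s + min s (1/2)) \<Omega> \<and>
         besov_norm (s + min s (1/2)) u \<le> C / sqrt \<bar>1 - 2 * s\<bar> * L2_norm (lebesgue_on \<Omega>) f) \<and>
      (s = 1/2 \<longrightarrow> (\<forall>\<epsilon>. 0 < \<epsilon> \<and> \<epsilon> < 1 \<longrightarrow> u \<in> besov_dot (1 - \<epsilon>) \<Omega> \<and>
            besov_norm (1 - \<epsilon>) u \<le> C / sqrt \<epsilon> * L2_norm (lebesgue_on \<Omega>) f))"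
      unfolding n_def by blast
  qed
qed

end
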